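(* Let $\mathcal I_s$ and $\mathcal I_t$ be intuitionistic ($\mathbf{IL}$-)theories, with a fixed choice of $\mathbf{IL}$-parameters in $\mathcal I_t$: witnessing types $\tau_P$ and formulas $\widetilde P(\mathbf x,a)$ for the computational predicate symbols $P$ of $\mathcal I_s$, formulas $\mathrm W_\tau(x)$ for the finite types $\tau$, and bounding types $\widehat{\boldsymbol\tau}$ and formulas $\forall\mathbf x\sqsubset_{\boldsymbol\tau}\mathbf a\,A$ for formulas $A$ of $\mathcal I_t$. Suppose that (i) the corresponding $\mathbf{AL}$-parameters $\widetilde P^\bullet(\mathbf x,a):\equiv(\widetilde P(\mathbf x,a))^*$, $\mathrm W^\bullet_\tau(x):\equiv(\mathrm W_\tau(x))^*$ and $\forall^\bullet\mathbf x\sqsubset_{\boldsymbol\tau}\mathbf a\,A:\equiv(\forall\mathbf x\sqsubset_{\boldsymbol\tau}\mathbf a\,A^{\mathsf f})^*$ (with the same $\tau_P$ and $\widehat{\boldsymbol\tau}$), for the source $\mathcal I_s^*$ and target $\mathcal I_t^*$, satisfy (A1)–(A4) and satisfy (A5) for all formulas $|A|^{\mathbf x}_{\mathbf y}$ with $A$ a formula of $\mathcal I_s^*$; and (ii) every non-logical axiom of $\mathcal I_s$ is $|\cdot|_\bullet$-witnessable in $\mathcal I_t$. Then every sequent provable in $\mathcal I_s$ is $|\cdot|_\bullet$-witnessable in $\mathcal I_t$.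
   Context: An $\mathbf{IL}$-theory extends first-order intuitionistic logic by constants, predicate symbols and non-logical axioms (sequents). Intuitionistic affine logic $\mathbf{AL}$ is intuitionistic linear logic ($\otimes,\multimap,\forall,\exists,!,\bot$) with weakening; an $\mathbf{AL}$-theory extends it by symbols and axioms. Girard translation $(\cdot)^*$ of $\mathbf{IL}$ into $\mathbf{AL}$: $P^*=P$, $(A\wedge B)^*=A^*\otimes B^*$, $(A\to B)^*=\,!A^*\multimap B^*$, $(\forall xA)^*=\forall xA^*$, $(\exists xA)^*=\exists x!A^*$; for an $\mathbf{IL}$-theory $\mathcal I$, $\mathcal I^*$ has the same language and axioms $!\Gamma^*\vdash A^*$ for each axiom $\Gamma\vdash A$ of $\mathcal I$. Forgetful translation $(\cdot)^{\mathsf f}$ of $\mathbf{AL}$ into $\mathbf{IL}$: $P^{\mathsf f}=P$, $(!A)^{\mathsf f}=A^{\mathsf f}$, $(A\otimes B)^{\mathsf f}=A^{\mathsf f}\wedge B^{\mathsf f}$, $(A\multimap B)^{\mathsf f}=A^{\mathsf f}\to B^{\mathsf f}$, quantifiers unchanged. Finite types: generated from $\mathbb B,\mathbb N$ by $\to$; $\mathbf{IL}^\omega$ is the intuitionistic theory of finite types (equality, booleans $\mathsf T,\mathsf F,\mathbb B$ with case distinction $\mathrm{if}$, typing predicates $\sigma(x)$, combinators $\mathrm K,\mathrm S$, application $fx$, with typing and defining axioms), and $\mathbf{AL}^\omega:=(\mathbf{IL}^\omega)^*$. Bold letters are tuples, $\varepsilon$ empty; tuple types curried/componentwise; $\mathbf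 t\mathbf s:=t_1\mathbf s,\dots$. Assumptions (A1)–(A5) for a source $\mathbf{AL}$-theory $\mathcal A_s$ and target $\mathcal A_t$ with parameters $\tau_P,\widetilde P,\mathrm W_\tau,\widehat{\boldsymbol\tau},\forall\mathbf x\sqsubset\mathbf a A$: (A1) $\mathcal A_t$ extends $\mathbf{AL}^\omega$. (A2) predicate symbols of $\mathcal A_s$ are split into computational/non-computational and are predicate symbols of $\mathcal A_t$. (A3) $\widetilde P(\mathbf x,a)\vdash_{\mathcal A_t}P(\mathbf x)$ ($a$ of type $\tau_P$). (A4) $\widetilde P(\mathbf x,a)\vdash\mathrm W_{\tau_P}(a)$, $\vdash\mathrm W(\mathrm K)$, $\vdash\mathrm W(\mathrm S)$ (at all types), $\mathrm W_\tau(x),\mathrm W_{\tau\to\rho}(f)\vdash\mathrm W_\rho(fx)$. (A5) $\mathbf x$ is not free in $\forall\mathbf x\sqsubset_{\boldsymbol\tau}\mathbf a A$ ($\mathbf a$ of types $\widehat{\boldsymbol\tau}$), and (Q1) $A\vdash B$ implies $\forall\mathbf x\sqsubset\mathbf aA\vdash\forall\mathbf x\sqsubset\mathbf aB$; (Q2) $\vdash\forall\mathbf x\sqsubset_{\boldsymbol\tau}\mathbf a\,!\mathrm W_{\boldsymbol\tau}(\mathbf x)$; there are terms $\eta:\boldsymbol\tau\to\widehat{\boldsymbol\tau}$, $\sqcup:\widehat{\boldsymbol\tau}\to\widehat{\boldsymbol\tau}\to\widehat{\boldsymbol\tau}$, $\circ:(\boldsymbol\rho\to\widehat{\boldsymbol\tau})\to\widehat{\boldsymbol\rho}\to\widehat{\boldsymbol\tau}$,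 provably in $\mathrm W$, with (C$_\eta$) $!\mathrm W(\mathbf z),!\forall\mathbf x\sqsubset\eta(\mathbf z)A\vdash A[\mathbf z/\mathbf x]$; (C$_\sqcup$) $!\mathrm W(\mathbf x_1,\mathbf x_2),!\forall\mathbf x\sqsubset(\mathbf x_1\sqcup\mathbf x_2)A\vdash\forall\mathbf x\sqsubset\mathbf x_1A\otimes\forall\mathbf x\sqsubset\mathbf x_2A$; (C$_\circ$) $!\mathrm W(\mathbf f),!\mathrm W(\mathbf z),!\forall\mathbf x\sqsubset_{\boldsymbol\tau}(\mathbf f\circ\mathbf z)A\vdash\forall\mathbf y\sqsubset_{\boldsymbol\rho}\mathbf z\,!\forall\mathbf x\sqsubset_{\boldsymbol\tau}\mathbf f\mathbf y A$ (all in $\mathcal A_t$; $\mathrm W$ of a tuple is a list in antecedents, a $\otimes$ in succedents). Witnessing types: $\tau^+_P=\tau_P$ (computational) or $\varepsilon$, $\tau^-_P=\varepsilon$; $\boldsymbol\tau^+_{A\multimap B}=(\boldsymbol\tau^+_A\to\boldsymbol\tau^+_B,\boldsymbol\tau^+_A\to\boldsymbol\tau^-_B\to\boldsymbol\tau^-_A)$, $\boldsymbol\tau^-_{A\multimap B}=(\boldsymbol\tau^+_A,\boldsymbol\tau^-_B)$; $\otimes$ concatenates; quantifiers unchanged; $\boldsymbol\tau^+_{!A}=\boldsymbol\tau^+_A$, $\boldsymbol\tau^-_{!A}=\widehat{\boldsymbol\tau^-_A}$. $\mathbf{AL}$-interpretation: $|P(\mathbf x)|^a_\varepsilon=\widetilde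 P(\mathbf x,a)$ (computational), $|P(\mathbf x)|^\varepsilon_\varepsilon=P(\mathbf x)$ (otherwise); $|A\multimap B|^{\mathbf f,\mathbf g}_{\mathbf x,\mathbf w}=|A|^{\mathbf x}_{\mathbf g\mathbf x\mathbf w}\multimap|B|^{\mathbf f\mathbf x}_{\mathbf w}$; $|A\otimes B|^{\mathbf x,\mathbf v}_{\mathbf y,\mathbf w}=|A|^{\mathbf x}_{\mathbf y}\otimes|B|^{\mathbf v}_{\mathbf w}$; $|\exists zA|=\exists z|A|$, $|\forall zA|=\forall z|A|$; $|!A|^{\mathbf x}_{\mathbf a}=\,!\forall\mathbf y\sqsubset_{\boldsymbol\tau^-_A}\mathbf a|A|^{\mathbf x}_{\mathbf y}$. With the $\bullet$-parameters above, $|\cdot|$ denotes the $\mathbf{AL}$-interpretation of $\mathcal I_s^*$ into $\mathcal I_t^*$, and $|A|_\bullet{}^{\mathbf x}_{\mathbf y}:\equiv(|A^*|^{\mathbf x}_{\mathbf y})^{\mathsf f}$ for formulas $A$ of $\mathcal I_s$. A sequent $\Gamma\vdash A$ of $\mathcal I_s$ is $|\cdot|_\bullet$-witnessable in $\mathcal I_t$ if there are closed terms $\boldsymbol\gamma,\mathbf a$ of $\mathcal I_t$ with $\vdash_{\mathcal I_t}\mathrm W_{\boldsymbol\tau^+_{\Gamma^*}\to\boldsymbol\tau^-_{A^*}\to\widehat{\boldsymbol\tau^-_{\Gamma^*}}}(\boldsymbol\gamma)$, $\vdash_{\mathcal I_t}\mathrm W_{\boldsymbol\tau^+_{\Gamma^*}\to\boldsymbol\tau^+_{A^*}}(\mathbf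 a)$ and $\mathrm W(\mathbf x,\mathbf w),\ \forall\mathbf y\sqsubset_{\boldsymbol\tau^-_{\Gamma^*}}\boldsymbol\gamma\mathbf x\mathbf w\,|\Gamma|_\bullet{}^{\mathbf x}_{\mathbf y}\vdash_{\mathcal I_t}|A|_\bullet{}^{\mathbf a\mathbf x}_{\mathbf w}$ (for $\Gamma=B_1,\dots,B_n$ the antecedent is the list of $\forall\mathbf y_i\sqsubset\gamma_i\mathbf x\mathbf w\,|B_i|_\bullet{}^{\mathbf x_i}_{\mathbf y_i}$).
   Formalization: (Q1) is assumed for sequents with several antecedent formulas, including !W(x) and side assumptions !W(z), not only for A ⊢ B; and every finite type is assumed to have a closed term provably in W. Without these the claim fails (multi-formula contexts, ex falso, weakening). *)

theory Defs
  imports "HOL-Library.Multiset"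
begin

section \<open>Finite types, symbols and terms\<close>

datatype ty = TyB | TyN | Arr ty ty  (infixr "\<rightarrow>\<^sub>t" 65)

text \<open>The curried type of functions taking a tuple, and its componentwise extension to tuples
  of result types.\<close>

definition arr :: "ty list \<Rightarrow> ty \<Rightarrow> ty" where
  "arr \<rho>s \<tau> = foldr (\<rightarrow>\<^sub>t) \<rho>s \<tau>"

definition arrs :: "ty list \<Rightarrow> ty list \<Rightarrow> ty list" where
  "arrs \<rho>s \<tau>s = map (arr \<rho>s) \<tau>s"

text \<open>The symbols of the theory of finite types are available in every signature; whether they
  belong to a given theory is decided by its language. \<open>FK\<close> and \<open>FS\<close> are the (untyped)
  combinators, \<open>FAp\<close> is the binary application symbol, \<open>PTy \<sigma>\<close> is the typing predicate of \<open>\<sigma>\<close>.\<close>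

datatype 'f fsym = FT | FF | FIf | FK | FS | FAp | FOther 'f
datatype 'p psym = PEq | PTy ty | POther 'p

text \<open>Variables are de Bruijn indices.\<close>

datatype 'f tm = Var nat | Fun "'f fsym" "'f tm list"

abbreviation cT :: "'f tm" where "cT \<equiv> Fun FT []"
abbreviation cF :: "'f tm" where "cF \<equiv> Fun FF []"
abbreviation cIf :: "'f tm" where "cIf \<equiv> Fun FIf []"
abbreviation cK :: "'f tm" where "cK \<equiv> Fun FK []"
abbreviation cS :: "'f tm" where "cS \<equiv> Fun FS []"
abbreviation Ap :: "'f tm \<Rightarrow> 'f tm \<Rightarrow> 'f tm"  (infixl "\<cdot>" 90) where "t \<cdot> s \<equiv> Fun FAp [t, s]"

definition apps :: "'f tm \<Rightarrow> 'f tm list \<Rightarrow> 'f tm" where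
  "apps t ss = foldl Ap t ss"

definition appt :: "'f tm list \<Rightarrow> 'f tm list \<Rightarrow> 'f tm list" where
  "appt ts ss = map (\<lambda>t. apps t ss) ts"

primrec tsubst :: "(nat \<Rightarrow> 'f tm) \<Rightarrow> 'f tm \<Rightarrow> 'f tm" where
  "tsubst \<sigma> (Var i) = \<sigma> i"
| "tsubst \<sigma> (Fun f ts) = Fun f (map (tsubst \<sigma>) ts)"

primrec tfv :: "'f tm \<Rightarrow> nat set" where
  "tfv (Var i) = {i}"
| "tfv (Fun f ts) = \<Union> (set (map tfv ts))"

definition tshift :: "nat \<Rightarrow> 'f tm \<Rightarrow> 'f tm" where
  "tshift n = tsubst (\<lambda>i. Var (i + n))"

text \<open>\<open>ups n \<sigma>\<close> is \<open>\<sigma>\<close> pushed under \<open>n\<close> binders; \<open>inst ts\<close> replaces the \<open>length ts\<close> lowest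
  variables by \<open>ts\<close> and lowers the remaining ones.\<close>

definition ups :: "nat \<Rightarrow> (nat \<Rightarrow> 'f tm) \<Rightarrow> nat \<Rightarrow> 'f tm" where
  "ups n \<sigma> i = (if i < n then Var i else tshift n (\<sigma> (i - n)))"

definition inst :: "'f tm list \<Rightarrow> nat \<Rightarrow> 'f tm" where
  "inst ts i = (if i < length ts then ts ! i else Var (i - length ts))"

abbreviation vars :: "nat \<Rightarrow> 'f tm list" where
  "vars n \<equiv> map Var [0..<n]"

definition unbind :: "nat set \<Rightarrow> nat \<Rightarrow> nat set" where
  "unbind V n = {i. i + n \<in> V}"


section \<open>Formulas of IL and AL\<close>

datatype ('f, 'p) ifm =
    IPred "'p psym" "'f tm list"
  | IBot
  | IAnd "('f, 'p) ifm" "('f, 'p) ifm"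
  | IImp "('f, 'p) ifm" "('f, 'p) ifm"
  | IAll "('f, 'p) ifm"
  | IEx "('f, 'p) ifm"

datatype ('f, 'p) afm =
    APred "'p psym" "'f tm list"
  | ABot
  | Tens "('f, 'p) afm" "('f, 'p) afm"
  | Lolli "('f, 'p) afm" "('f, 'p) afm"
  | AAll "('f, 'p) afm"
  | AEx "('f, 'p) afm"
  | Bang "('f, 'p) afm"

primrec isubst :: "(nat \<Rightarrow> 'f tm) \<Rightarrow> ('f, 'p) ifm \<Rightarrow> ('f, 'p) ifm" where
  "isubst \<sigma> (IPred p ts) = IPred p (map (tsubst \<sigma>) ts)"
| "isubst \<sigma> IBot = IBot"
| "isubst \<sigma> (IAnd A B) = IAnd (isubst \<sigma> A) (isubst \<sigma> B)"
| "isubst \<sigma> (IImp A B) = IImp (isubst \<sigma> A) (isubst \<sigma> B)"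
| "isubst \<sigma> (IAll A) = IAll (isubst (ups 1 \<sigma>) A)"
| "isubst \<sigma> (IEx A) = IEx (isubst (ups 1 \<sigma>) A)"

primrec asubst :: "(nat \<Rightarrow> 'f tm) \<Rightarrow> ('f, 'p) afm \<Rightarrow> ('f, 'p) afm" where
  "asubst \<sigma> (APred p ts) = APred p (map (tsubst \<sigma>) ts)"
| "asubst \<sigma> ABot = ABot"
| "asubst \<sigma> (Tens A B) = Tens (asubst \<sigma> A) (asubst \<sigma> B)"
| "asubst \<sigma> (Lolli A B) = Lolli (asubst \<sigma> A) (asubst \<sigma> B)"
| "asubst \<sigma> (AAll A) = AAll (asubst (ups 1 \<sigma>) A)"
| "asubst \<sigma> (AEx A) = AEx (asubst (ups 1 \<sigma>) A)"
| "asubst \<sigma> (Bang A) = Bang (asubst \<sigma> A)"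

definition ishift :: "nat \<Rightarrow> ('f, 'p) ifm \<Rightarrow> ('f, 'p) ifm" where
  "ishift n = isubst (\<lambda>i. Var (i + n))"

definition ashift :: "nat \<Rightarrow> ('f, 'p) afm \<Rightarrow> ('f, 'p) afm" where
  "ashift n = asubst (\<lambda>i. Var (i + n))"

primrec ifv :: "('f, 'p) ifm \<Rightarrow> nat set" where
  "ifv (IPred p ts) = \<Union> (set (map tfv ts))"
| "ifv IBot = {}"
| "ifv (IAnd A B) = ifv A \<union> ifv B"
| "ifv (IImp A B) = ifv A \<union> ifv B"
| "ifv (IAll A) = unbind (ifv A) 1"
| "ifv (IEx A) = unbind (ifv A) 1"

primrec afv :: "('f, 'p) afm \<Rightarrow> nat set" where
  "afv (APred p ts) = \<Union> (set (map tfv ts))"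
| "afv ABot = {}"
| "afv (Tens A B) = afv A \<union> afv B"
| "afv (Lolli A B) = afv A \<union> afv B"
| "afv (AAll A) = unbind (afv A) 1"
| "afv (AEx A) = unbind (afv A) 1"
| "afv (Bang A) = afv A"


section \<open>Languages, theories and derivability\<close>

text \<open>A language assigns arities to its symbols; constants are function symbols of arity 0.\<close>

record ('f, 'p) lang =
  funs :: "'f fsym \<rightharpoonup> nat"
  preds :: "'p psym \<rightharpoonup> nat"

definition lang_le :: "('f, 'p) lang \<Rightarrow> ('f, 'p) lang \<Rightarrow> bool" where
  "lang_le L L' \<longleftrightarrow> funs L \<subseteq>\<^sub>m funs L' \<and> preds L \<subseteq>\<^sub>m preds L'"

primrec twf :: "('f, 'p) lang \<Rightarrow> 'f tm \<Rightarrow> bool" where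
  "twf L (Var i) = True"
| "twf L (Fun f ts) = (funs L f = Some (length ts) \<and> list_all id (map (twf L) ts))"

definition closed_term :: "('f, 'p) lang \<Rightarrow> 'f tm \<Rightarrow> bool" where
  "closed_term L t \<longleftrightarrow> twf L t \<and> tfv t = {}"

primrec iwf :: "('f, 'p) lang \<Rightarrow> ('f, 'p) ifm \<Rightarrow> bool" where
  "iwf L (IPred p ts) = (preds L p = Some (length ts) \<and> (\<forall>t\<in>set ts. twf L t))"
| "iwf L IBot = True"
| "iwf L (IAnd A B) = (iwf L A \<and> iwf L B)"
| "iwf L (IImp A B) = (iwf L A \<and> iwf L B)"
| "iwf L (IAll A) = iwf L A"
| "iwf L (IEx A) = iwf L A"

primrec awf :: "('f, 'p) lang \<Rightarrow> ('f, 'p) afm \<Rightarrow> bool" where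
  "awf L (APred p ts) = (preds L p = Some (length ts) \<and> (\<forall>t\<in>set ts. twf L t))"
| "awf L ABot = True"
| "awf L (Tens A B) = (awf L A \<and> awf L B)"
| "awf L (Lolli A B) = (awf L A \<and> awf L B)"
| "awf L (AAll A) = awf L A"
| "awf L (AEx A) = awf L A"
| "awf L (Bang A) = awf L A"

record ('f, 'p, 'm) fo_theory =
  lang :: "('f, 'p) lang"
  axs :: "('m list \<times> 'm) set"

type_synonym ('f, 'p) il_theory = "('f, 'p, ('f, 'p) ifm) fo_theory"
type_synonym ('f, 'p) al_theory = "('f, 'p, ('f, 'p) afm) fo_theory"

definition il_wf_theory :: "('f, 'p) il_theory \<Rightarrow> bool" where
  "il_wf_theory T \<longleftrightarrow>
     (\<forall>(\<Gamma>, A) \<in> axs T. (\<forall>B\<in>set \<Gamma>. iwf (lang T) B) \<and> iwf (lang T) A)"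

text \<open>Only formulas of the language of the theory occur in derivations: the side conditions cover
  every formula or term that a rule introduces without it being part of a premise. In the
  quantifier rules the eigenvariable is the index 0 of the premise.\<close>

inductive il_prov :: "('f, 'p) il_theory \<Rightarrow> ('f, 'p) ifm list \<Rightarrow> ('f, 'p) ifm \<Rightarrow> bool"
  for T :: "('f, 'p) il_theory" where
  il_ax: "(\<Gamma>, A) \<in> axs T \<Longrightarrow> il_prov T \<Gamma> A"
| il_id: "iwf (lang T) A \<Longrightarrow> il_prov T [A] A"
| il_cut: "il_prov T \<Gamma> A \<Longrightarrow> il_prov T (A # \<Delta>) B \<Longrightarrow> il_prov T (\<Gamma> @ \<Delta>) B"
| il_exch: "il_prov T \<Gamma> A \<Longrightarrow> mset \<Delta> = mset \<Gamma> \<Longrightarrow> il_prov T \<Delta> A"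
| il_weak: "il_prov T \<Gamma> B \<Longrightarrow> iwf (lang T) A \<Longrightarrow> il_prov T (A # \<Gamma>) B"
| il_contr: "il_prov T (A # A # \<Gamma>) B \<Longrightarrow> il_prov T (A # \<Gamma>) B"
| il_botL: "iwf (lang T) A \<Longrightarrow> il_prov T [IBot] A"
| il_andL: "il_prov T (A # B # \<Gamma>) C \<Longrightarrow> il_prov T (IAnd A B # \<Gamma>) C"
| il_andR: "il_prov T \<Gamma> A \<Longrightarrow> il_prov T \<Delta> B \<Longrightarrow> il_prov T (\<Gamma> @ \<Delta>) (IAnd A B)"
| il_impL: "il_prov T \<Gamma> A \<Longrightarrow> il_prov T (B # \<Delta>) C \<Longrightarrow> il_prov T (IImp A B # \<Gamma> @ \<Delta>) C"
| il_impR: "il_prov T (A # \<Gamma>) B \<Longrightarrow> il_prov T \<Gamma> (IImp A B)"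
| il_allL: "il_prov T (isubst (inst [t]) A # \<Gamma>) B \<Longrightarrow> iwf (lang T) A \<Longrightarrow> twf (lang T) t \<Longrightarrow>
    il_prov T (IAll A # \<Gamma>) B"
| il_allR: "il_prov T (map (ishift 1) \<Gamma>) A \<Longrightarrow> il_prov T \<Gamma> (IAll A)"
| il_exL: "il_prov T (A # map (ishift 1) \<Gamma>) (ishift 1 B) \<Longrightarrow> il_prov T (IEx A # \<Gamma>) B"
| il_exR: "il_prov T \<Gamma> (isubst (inst [t]) A) \<Longrightarrow> iwf (lang T) A \<Longrightarrow> twf (lang T) t \<Longrightarrow>
    il_prov T \<Gamma> (IEx A)"

inductive al_prov :: "('f, 'p) al_theory \<Rightarrow> ('f, 'p) afm list \<Rightarrow> ('f, 'p) afm \<Rightarrow> bool"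
  for T :: "('f, 'p) al_theory" where
  al_ax: "(\<Gamma>, A) \<in> axs T \<Longrightarrow> al_prov T \<Gamma> A"
| al_id: "awf (lang T) A \<Longrightarrow> al_prov T [A] A"
| al_cut: "al_prov T \<Gamma> A \<Longrightarrow> al_prov T (A # \<Delta>) B \<Longrightarrow> al_prov T (\<Gamma> @ \<Delta>) B"
| al_exch: "al_prov T \<Gamma> A \<Longrightarrow> mset \<Delta> = mset \<Gamma> \<Longrightarrow> al_prov T \<Delta> A"
| al_weak: "al_prov T \<Gamma> B \<Longrightarrow> awf (lang T) A \<Longrightarrow> al_prov T (A # \<Gamma>) B"
| al_botL: "awf (lang T) A \<Longrightarrow> al_prov T [ABot] A"
| al_tensL: "al_prov T (A # B # \<Gamma>) C \<Longrightarrow> al_prov T (Tens A B # \<Gamma>) C"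
| al_tensR: "al_prov T \<Gamma> A \<Longrightarrow> al_prov T \<Delta> B \<Longrightarrow> al_prov T (\<Gamma> @ \<Delta>) (Tens A B)"
| al_lolliL: "al_prov T \<Gamma> A \<Longrightarrow> al_prov T (B # \<Delta>) C \<Longrightarrow> al_prov T (Lolli A B # \<Gamma> @ \<Delta>) C"
| al_lolliR: "al_prov T (A # \<Gamma>) B \<Longrightarrow> al_prov T \<Gamma> (Lolli A B)"
| al_allL: "al_prov T (asubst (inst [t]) A # \<Gamma>) B \<Longrightarrow> awf (lang T) A \<Longrightarrow> twf (lang T) t \<Longrightarrow>
    al_prov T (AAll A # \<Gamma>) B"
| al_allR: "al_prov T (map (ashift 1) \<Gamma>) A \<Longrightarrow> al_prov T \<Gamma> (AAll A)"
| al_exL: "al_prov T (A # map (ashift 1) \<Gamma>) (ashift 1 B) \<Longrightarrow> al_prov T (AEx A # \<Gamma>) B"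
| al_exR: "al_prov T \<Gamma> (asubst (inst [t]) A) \<Longrightarrow> awf (lang T) A \<Longrightarrow> twf (lang T) t \<Longrightarrow>
    al_prov T \<Gamma> (AEx A)"
| al_bangL: "al_prov T (A # \<Gamma>) B \<Longrightarrow> al_prov T (Bang A # \<Gamma>) B"
| al_bangR: "al_prov T (map Bang \<Gamma>) A \<Longrightarrow> al_prov T (map Bang \<Gamma>) (Bang A)"
| al_bangC: "al_prov T (Bang A # Bang A # \<Gamma>) B \<Longrightarrow> al_prov T (Bang A # \<Gamma>) B"


section \<open>Girard translation and forgetful translation\<close>

primrec star :: "('f, 'p) ifm \<Rightarrow> ('f, 'p) afm" where
  "star (IPred p ts) = APred p ts"
| "star IBot = ABot"
| "star (IAnd A B) = Tens (star A) (star B)"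
| "star (IImp A B) = Lolli (Bang (star A)) (star B)"
| "star (IAll A) = AAll (star A)"
| "star (IEx A) = AEx (Bang (star A))"

primrec forget :: "('f, 'p) afm \<Rightarrow> ('f, 'p) ifm" where
  "forget (APred p ts) = IPred p ts"
| "forget ABot = IBot"
| "forget (Tens A B) = IAnd (forget A) (forget B)"
| "forget (Lolli A B) = IImp (forget A) (forget B)"
| "forget (AAll A) = IAll (forget A)"
| "forget (AEx A) = IEx (forget A)"
| "forget (Bang A) = forget A"

definition star_theory :: "('f, 'p) il_theory \<Rightarrow> ('f, 'p) al_theory" where
  "star_theory T =
     \<lparr>lang = lang T, axs = (\<lambda>(\<Gamma>, A). (map (Bang \<circ> star) \<Gamma>, star A)) ` axs T\<rparr>"


section \<open>The theory of finite types\<close>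

abbreviation ieq :: "'f tm \<Rightarrow> 'f tm \<Rightarrow> ('f, 'p) ifm" where
  "ieq s t \<equiv> IPred PEq [s, t]"

abbreviation ityp :: "ty \<Rightarrow> 'f tm \<Rightarrow> ('f, 'p) ifm" where
  "ityp \<sigma> t \<equiv> IPred (PTy \<sigma>) [t]"

definition omega_lang :: "('f, 'p) lang" where
  "omega_lang =
     \<lparr>funs = (\<lambda>f. case f of FAp \<Rightarrow> Some 2 | FOther _ \<Rightarrow> None | _ \<Rightarrow> Some 0),
      preds = (\<lambda>p. case p of PEq \<Rightarrow> Some 2 | PTy _ \<Rightarrow> Some 1 | POther _ \<Rightarrow> None)\<rparr>"

text \<open>The parameter \<open>L\<close> is the language of the theory in which the schemata (replacement of equals,
  case distinction on booleans) are read. The formal theory of finite types itself is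
  \<open>IL_omega omega_lang\<close>; an extension of it in a larger language has the schemata for its own
  formulas. Disjunction is not primitive; the boolean axioms make it definable.\<close>

inductive_set omega_axs :: "('f, 'p) lang \<Rightarrow> (('f, 'p) ifm list \<times> ('f, 'p) ifm) set"
  for L :: "('f, 'p) lang" where
  eq_refl: "([], ieq (Var 0) (Var 0)) \<in> omega_axs L"
| eq_repl: "iwf L A \<Longrightarrow> twf L s \<Longrightarrow> twf L t \<Longrightarrow>
    ([ieq s t, isubst (inst [s]) A], isubst (inst [t]) A) \<in> omega_axs L"
| typ_T: "([], ityp TyB cT) \<in> omega_axs L"
| typ_F: "([], ityp TyB cF) \<in> omega_axs L"
| bool_distinct: "([ieq cT cF], IBot) \<in> omega_axs L"
| bool_cases: "iwf L A \<Longrightarrow> twf L t \<Longrightarrow>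
    ([ityp TyB t, isubst (inst [cT]) A, isubst (inst [cF]) A], isubst (inst [t]) A) \<in> omega_axs L"
| typ_if: "([], ityp (TyB \<rightarrow>\<^sub>t \<sigma> \<rightarrow>\<^sub>t \<sigma> \<rightarrow>\<^sub>t \<sigma>) cIf) \<in> omega_axs L"
| if_T: "([], ieq (cIf \<cdot> cT \<cdot> Var 0 \<cdot> Var 1) (Var 0)) \<in> omega_axs L"
| if_F: "([], ieq (cIf \<cdot> cF \<cdot> Var 0 \<cdot> Var 1) (Var 1)) \<in> omega_axs L"
| typ_K: "([], ityp (\<sigma> \<rightarrow>\<^sub>t \<tau> \<rightarrow>\<^sub>t \<sigma>) cK) \<in> omega_axs L"
| def_K: "([], ieq (cK \<cdot> Var 0 \<cdot> Var 1) (Var 0)) \<in> omega_axs L"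
| typ_S: "([], ityp ((\<rho> \<rightarrow>\<^sub>t \<sigma> \<rightarrow>\<^sub>t \<tau>) \<rightarrow>\<^sub>t (\<rho> \<rightarrow>\<^sub>t \<sigma>) \<rightarrow>\<^sub>t \<rho> \<rightarrow>\<^sub>t \<tau>) cS) \<in> omega_axs L"
| def_S: "([], ieq (cS \<cdot> Var 0 \<cdot> Var 1 \<cdot> Var 2) (Var 0 \<cdot> Var 2 \<cdot> (Var 1 \<cdot> Var 2))) \<in> omega_axs L"
| typ_ap: "([ityp (\<sigma> \<rightarrow>\<^sub>t \<tau>) (Var 0), ityp \<sigma> (Var 1)], ityp \<tau> (Var 0 \<cdot> Var 1)) \<in> omega_axs L"

definition IL_omega :: "('f, 'p) lang \<Rightarrow> ('f, 'p) il_theory" where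
  "IL_omega L = \<lparr>lang = L, axs = omega_axs L\<rparr>"

definition AL_omega :: "('f, 'p) lang \<Rightarrow> ('f, 'p) al_theory" where
  "AL_omega L = star_theory (IL_omega L)"


section \<open>Parameters of the interpretation\<close>

text \<open>\<open>'m\<close> is the type of formulas (of IL or of AL). \<open>comp\<close> is the set of computational predicate
  symbols and \<open>tau\<close> gives their witnessing types. \<open>Pt p\<close> is the formula with the variables
  \<open>0, \<dots>, n-1\<close> in place of the arguments of the \<open>n\<close>-ary symbol \<open>p\<close> and \<open>n\<close> in place of the
  witness. \<open>W \<tau>\<close> is a formula in the variable 0. \<open>hat\<close> gives the bounding types of a tuple.
  \<open>BQ \<tau>s as A\<close> is the formula written \<open>\<forall>x \<sqsubset> a. A\<close>; it binds the variables \<open>0, \<dots>, length \<tau>s - 1\<close>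
  of \<open>A\<close>, so that outside of the quantifier the other variables of \<open>A\<close> are lowered by
  \<open>length \<tau>s\<close>.\<close>

record ('f, 'p, 'm) params =
  comp :: "'p psym set"
  tau :: "'p psym \<Rightarrow> ty"
  Pt :: "'p psym \<Rightarrow> 'm"
  W :: "ty \<Rightarrow> 'm"
  hat :: "ty list \<Rightarrow> ty list"
  BQ :: "ty list \<Rightarrow> 'f tm list \<Rightarrow> 'm \<Rightarrow> 'm"

type_synonym ('f, 'p) il_params = "('f, 'p, ('f, 'p) ifm) params"
type_synonym ('f, 'p) al_params = "('f, 'p, ('f, 'p) afm) params"

text \<open>\<open>Q\<close> consists of formulas of the target theory with no free variables besides the displayed
  ones. The last clause is the usual notational convention that a substitution in
  \<open>\<forall>x \<sqsubset> a. A\<close> acts on \<open>a\<close> and, avoiding capture, on \<open>A\<close>.\<close>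

definition il_params_in :: "('f, 'p) il_theory \<Rightarrow> ('f, 'p) il_theory \<Rightarrow> ('f, 'p) il_params \<Rightarrow> bool"
  where
  "il_params_in Is It Q \<longleftrightarrow>
     (\<forall>p\<in>comp Q. \<forall>n. preds (lang Is) p = Some n \<longrightarrow>
        iwf (lang It) (Pt Q p) \<and> ifv (Pt Q p) \<subseteq> {..n}) \<and>
     (\<forall>\<tau>. iwf (lang It) (W Q \<tau>) \<and> ifv (W Q \<tau>) \<subseteq> {0}) \<and>
     (\<forall>\<tau>s as A. length as = length (hat Q \<tau>s) \<longrightarrow> (\<forall>a\<in>set as. twf (lang It) a) \<longrightarrow>
        iwf (lang It) A \<longrightarrow>
          iwf (lang It) (BQ Q \<tau>s as A) \<and>
          (\<forall>\<sigma>. (\<forall>i. twf (lang It) (\<sigma> i)) \<longrightarrow>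
             isubst \<sigma> (BQ Q \<tau>s as A) =
               BQ Q \<tau>s (map (tsubst \<sigma>) as) (isubst (ups (length \<tau>s) \<sigma>) A)))"

definition bullet :: "('f, 'p) il_params \<Rightarrow> ('f, 'p) al_params" where
  "bullet Q =
     \<lparr>comp = comp Q, tau = tau Q, Pt = star \<circ> Pt Q, W = star \<circ> W Q, hat = hat Q,
      BQ = (\<lambda>\<tau>s as A. star (BQ Q \<tau>s as (forget A)))\<rparr>"

definition iW :: "('f, 'p) il_params \<Rightarrow> ty \<Rightarrow> 'f tm \<Rightarrow> ('f, 'p) ifm" where
  "iW Q \<tau> t = isubst (inst [t]) (W Q \<tau>)"

definition aW :: "('f, 'p) al_params \<Rightarrow> ty \<Rightarrow> 'f tm \<Rightarrow> ('f, 'p) afm" where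
  "aW Q \<tau> t = asubst (inst [t]) (W Q \<tau>)"

text \<open>Conjunctions of lists. There is no unit in the language, so the empty conjunction is the
  provable formula \<open>\<bottom> \<rightarrow> \<bottom>\<close>.\<close>

definition iconj :: "('f, 'p) ifm list \<Rightarrow> ('f, 'p) ifm" where
  "iconj As = foldr IAnd As (IImp IBot IBot)"

definition aconj :: "('f, 'p) afm list \<Rightarrow> ('f, 'p) afm" where
  "aconj As = foldr Tens As (Lolli ABot ABot)"

text \<open>\<open>W\<close> of a tuple in a succedent, and \<open>!W\<close> of a tuple in an antecedent.\<close>

definition iWs :: "('f, 'p) il_params \<Rightarrow> ty list \<Rightarrow> 'f tm list \<Rightarrow> ('f, 'p) ifm" where
  "iWs Q \<tau>s ts = iconj (map2 (iW Q) \<tau>s ts)"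

definition aWs :: "('f, 'p) al_params \<Rightarrow> ty list \<Rightarrow> 'f tm list \<Rightarrow> ('f, 'p) afm" where
  "aWs Q \<tau>s ts = aconj (map2 (aW Q) \<tau>s ts)"

definition bangW :: "('f, 'p) al_params \<Rightarrow> ty list \<Rightarrow> 'f tm list \<Rightarrow> ('f, 'p) afm list" where
  "bangW Q \<tau>s ts = map2 (\<lambda>\<tau> t. Bang (aW Q \<tau> t)) \<tau>s ts"


section \<open>The AL-interpretation\<close>

fun tpos :: "('f, 'p, 'm) params \<Rightarrow> ('f, 'p) afm \<Rightarrow> ty list"
  and tneg :: "('f, 'p, 'm) params \<Rightarrow> ('f, 'p) afm \<Rightarrow> ty list" where
  "tpos Q (APred p ts) = (if p \<in> comp Q then [tau Q p] else [])"
| "tpos Q ABot = []"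
| "tpos Q (Tens A B) = tpos Q A @ tpos Q B"
| "tpos Q (Lolli A B) =
     arrs (tpos Q A) (tpos Q B) @ arrs (tpos Q A) (arrs (tneg Q B) (tneg Q A))"
| "tpos Q (AAll A) = tpos Q A"
| "tpos Q (AEx A) = tpos Q A"
| "tpos Q (Bang A) = tpos Q A"
| "tneg Q (APred p ts) = []"
| "tneg Q ABot = []"
| "tneg Q (Tens A B) = tneg Q A @ tneg Q B"
| "tneg Q (Lolli A B) = tpos Q A @ tneg Q B"
| "tneg Q (AAll A) = tneg Q A"
| "tneg Q (AEx A) = tneg Q A"
| "tneg Q (Bang A) = hat Q (tneg Q A)"

primrec depth :: "('f, 'p) afm \<Rightarrow> nat" where
  "depth (APred p ts) = 0"
| "depth ABot = 0"
| "depth (Tens A B) = Suc (depth A + depth B)"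
| "depth (Lolli A B) = Suc (depth A + depth B)"
| "depth (AAll A) = Suc (depth A)"
| "depth (AEx A) = Suc (depth A)"
| "depth (Bang A) = Suc (depth A)"

lemma depth_asubst [simp]: "depth (asubst \<sigma> A) = depth A"
  by (induction A arbitrary: \<sigma>) auto

lemma depth_ashift [simp]: "depth (ashift n A) = depth A"
  by (simp add: ashift_def)

text \<open>\<open>interp Q A xs ys\<close> is \<open>|A|\<close> with the tuple \<open>xs\<close> (of types \<open>tpos Q A\<close>) as superscript and
  \<open>ys\<close> (of types \<open>tneg Q A\<close>) as subscript. Under a binder the surrounding terms are shifted.\<close>

function interp ::
    "('f, 'p) al_params \<Rightarrow> ('f, 'p) afm \<Rightarrow> 'f tm list \<Rightarrow> 'f tm list \<Rightarrow> ('f, 'p) afm" where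
  "interp Q (APred p ts) xs ys =
     (if p \<in> comp Q then asubst (inst (ts @ xs)) (Pt Q p) else APred p ts)"
| "interp Q ABot xs ys = ABot"
| "interp Q (Tens A B) xs ys =
     (let m = length (tpos Q A); n = length (tneg Q A) in
      Tens (interp Q A (take m xs) (take n ys)) (interp Q B (drop m xs) (drop n ys)))"
| "interp Q (Lolli A B) fgs xws =
     (let m = length (tpos Q A);
          fs = take (length (tpos Q B)) fgs; gs = drop (length (tpos Q B)) fgs;
          xs = take m xws; ws = drop m xws
      in Lolli (interp Q A xs (appt gs (xs @ ws))) (interp Q B (appt fs xs) ws))"
| "interp Q (AAll A) xs ys = AAll (interp Q A (map (tshift 1) xs) (map (tshift 1) ys))"
| "interp Q (AEx A) xs ys = AEx (interp Q A (map (tshift 1) xs) (map (tshift 1) ys))"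
| "interp Q (Bang A) xs as =
     (let n = length (tneg Q A) in
      Bang (BQ Q (tneg Q A) as (interp Q (ashift n A) (map (tshift n) xs) (vars n))))"
  by pat_completeness auto
termination
  by (relation "measure (\<lambda>(Q, A, xs, ys). depth A)") auto

text \<open>The class of formulas \<open>|A|\<close> of the target theory, for \<open>A\<close> a formula of the source theory.\<close>

definition interp_fms ::
    "('f, 'p) al_theory \<Rightarrow> ('f, 'p) al_theory \<Rightarrow> ('f, 'p) al_params \<Rightarrow> ('f, 'p) afm set" where
  "interp_fms As At Q =
     {interp Q A xs ys | A xs ys.
        awf (lang As) A \<and> length xs = length (tpos Q A) \<and> length ys = length (tneg Q A) \<and>
        (\<forall>t\<in>set (xs @ ys). twf (lang At) t)}"


section \<open>Assumptions on the parameters\<close>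

definition A1 :: "('f, 'p) al_theory \<Rightarrow> bool" where
  "A1 At \<longleftrightarrow> lang_le omega_lang (lang At) \<and>
     (\<forall>(\<Gamma>, A) \<in> axs (AL_omega (lang At)). al_prov At \<Gamma> A)"

text \<open>That the function symbols of the source are also symbols of the target is needed for \<open>|A|\<close>
  to be a formula of the target at all.\<close>

definition A2 :: "('f, 'p) al_theory \<Rightarrow> ('f, 'p) al_theory \<Rightarrow> ('f, 'p) al_params \<Rightarrow> bool" where
  "A2 As At Q \<longleftrightarrow> comp Q \<subseteq> dom (preds (lang As)) \<and> lang_le (lang As) (lang At)"

definition A3 :: "('f, 'p) al_theory \<Rightarrow> ('f, 'p) al_theory \<Rightarrow> ('f, 'p) al_params \<Rightarrow> bool" where
  "A3 As At Q \<longleftrightarrow>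
     (\<forall>p\<in>comp Q. \<forall>n. preds (lang As) p = Some n \<longrightarrow> al_prov At [Pt Q p] (APred p (vars n)))"

definition A4 :: "('f, 'p) al_theory \<Rightarrow> ('f, 'p) al_theory \<Rightarrow> ('f, 'p) al_params \<Rightarrow> bool" where
  "A4 As At Q \<longleftrightarrow>
     (\<forall>p\<in>comp Q. \<forall>n. preds (lang As) p = Some n \<longrightarrow>
        al_prov At [Pt Q p] (aW Q (tau Q p) (Var n))) \<and>
     (\<forall>\<sigma> \<tau>. al_prov At [] (aW Q (\<sigma> \<rightarrow>\<^sub>t \<tau> \<rightarrow>\<^sub>t \<sigma>) cK)) \<and>
     (\<forall>\<rho> \<sigma> \<tau>. al_prov At []
        (aW Q ((\<rho> \<rightarrow>\<^sub>t \<sigma> \<rightarrow>\<^sub>t \<tau>) \<rightarrow>\<^sub>t (\<rho> \<rightarrow>\<^sub>t \<sigma>) \<rightarrow>\<^sub>t \<rho> \<rightarrow>\<^sub>t \<tau>) cS)) \<and>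
     (\<forall>\<tau> \<rho>. al_prov At [aW Q \<tau> (Var 0), aW Q (\<tau> \<rightarrow>\<^sub>t \<rho>) (Var 1)] (aW Q \<rho> (Var 1 \<cdot> Var 0)))"

text \<open>\<open>terms_of L ts n\<close>: \<open>ts\<close> is an \<open>n\<close>-tuple of terms; \<open>W_terms At Q \<tau>s ts\<close>: \<open>ts\<close> is a tuple of
  closed terms provably in \<open>W\<close> at types \<open>\<tau>s\<close>.\<close>

definition terms_of :: "('f, 'p) lang \<Rightarrow> 'f tm list \<Rightarrow> nat \<Rightarrow> bool" where
  "terms_of L ts n \<longleftrightarrow> length ts = n \<and> (\<forall>t\<in>set ts. twf L t)"

definition W_terms :: "('f, 'p) al_theory \<Rightarrow> ('f, 'p) al_params \<Rightarrow> ty list \<Rightarrow> 'f tm list \<Rightarrow> bool" where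
  "W_terms At Q \<tau>s ts \<longleftrightarrow> length ts = length \<tau>s \<and> (\<forall>t\<in>set ts. closed_term (lang At) t) \<and>
     al_prov At [] (aWs Q \<tau>s ts)"

definition not_free :: "('f, 'p) al_theory \<Rightarrow> ('f, 'p) al_params \<Rightarrow> ty list \<Rightarrow> ('f, 'p) afm \<Rightarrow> bool"
  where
  "not_free At Q \<tau>s A \<longleftrightarrow>
     (\<forall>as. terms_of (lang At) as (length (hat Q \<tau>s)) \<longrightarrow>
        afv (BQ Q \<tau>s as A) \<subseteq> \<Union> (tfv ` set as) \<union> unbind (afv A) (length \<tau>s))"

text \<open>Monotonicity of the bounded quantifier is a rule for sequents: the quantifier is introduced on both sides, for
  an antecedent that is a list of formulas, in the presence of assumptions \<open>!W(z)\<close> not containing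
  the bound variables. The antecedent may contain the formula \<open>!W(x)\<close> that occurs in \<open>Q2\<close>. With
  single formulas only, the rule would not suffice for contexts of length greater than 1, since
  distribution of the quantifier over \<open>\<otimes>\<close> is not assumed.\<close>

definition Q1 :: "('f, 'p) al_theory \<Rightarrow> ('f, 'p) al_params \<Rightarrow> ('f, 'p) afm set \<Rightarrow> ty list \<Rightarrow> bool"
  where
  "Q1 At Q \<C> \<tau>s \<longleftrightarrow>
     (\<forall>as \<sigma>s zs As B. terms_of (lang At) as (length (hat Q \<tau>s)) \<longrightarrow>
        terms_of (lang At) zs (length \<sigma>s) \<longrightarrow>
        set As \<subseteq> insert (Bang (aWs Q \<tau>s (vars (length \<tau>s)))) \<C> \<longrightarrow> B \<in> \<C> \<longrightarrow>
        al_prov At (map (ashift (length \<tau>s)) (bangW Q \<sigma>s zs) @ As) B \<longrightarrow>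
        al_prov At (bangW Q \<sigma>s zs @ map (BQ Q \<tau>s as) As) (BQ Q \<tau>s as B))"

definition Q2 :: "('f, 'p) al_theory \<Rightarrow> ('f, 'p) al_params \<Rightarrow> ty list \<Rightarrow> bool" where
  "Q2 At Q \<tau>s \<longleftrightarrow>
     (\<forall>as. terms_of (lang At) as (length (hat Q \<tau>s)) \<longrightarrow>
        al_prov At [] (BQ Q \<tau>s as (Bang (aWs Q \<tau>s (vars (length \<tau>s))))))"

definition C_eta :: "('f, 'p) al_theory \<Rightarrow> ('f, 'p) al_params \<Rightarrow> ty list \<Rightarrow> ('f, 'p) afm \<Rightarrow> bool"
  where
  "C_eta At Q \<tau>s A \<longleftrightarrow>
     (\<exists>\<eta>. W_terms At Q (arrs \<tau>s (hat Q \<tau>s)) \<eta> \<and>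
        (\<forall>zs. terms_of (lang At) zs (length \<tau>s) \<longrightarrow>
           al_prov At (bangW Q \<tau>s zs @ [Bang (BQ Q \<tau>s (appt \<eta> zs) A)]) (asubst (inst zs) A)))"

definition C_join :: "('f, 'p) al_theory \<Rightarrow> ('f, 'p) al_params \<Rightarrow> ty list \<Rightarrow> ('f, 'p) afm \<Rightarrow> bool"
  where
  "C_join At Q \<tau>s A \<longleftrightarrow>
     (\<exists>j. W_terms At Q (arrs (hat Q \<tau>s) (arrs (hat Q \<tau>s) (hat Q \<tau>s))) j \<and>
        (\<forall>xs xs'. terms_of (lang At) xs (length (hat Q \<tau>s)) \<longrightarrow>
           terms_of (lang At) xs' (length (hat Q \<tau>s)) \<longrightarrow>
           al_prov At
             (bangW Q (hat Q \<tau>s @ hat Q \<tau>s) (xs @ xs') @ [Bang (BQ Q \<tau>s (appt j (xs @ xs')) A)])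
             (Tens (BQ Q \<tau>s xs A) (BQ Q \<tau>s xs' A))))"

text \<open>In the succedent the quantifier over \<open>\<rho>s\<close> is outermost and its variables do not occur in \<open>A\<close>;
  hence \<open>fs\<close> is shifted and in \<open>A\<close> the variables not bound by the inner quantifier are shifted.\<close>

definition C_circ ::
    "('f, 'p) al_theory \<Rightarrow> ('f, 'p) al_params \<Rightarrow> ty list \<Rightarrow> ty list \<Rightarrow> ('f, 'p) afm \<Rightarrow> bool" where
  "C_circ At Q \<rho>s \<tau>s A \<longleftrightarrow>
     (\<exists>c. W_terms At Q (arrs (arrs \<rho>s (hat Q \<tau>s)) (arrs (hat Q \<rho>s) (hat Q \<tau>s))) c \<and>
        (\<forall>fs zs. terms_of (lang At) fs (length (hat Q \<tau>s)) \<longrightarrow>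
           terms_of (lang At) zs (length (hat Q \<rho>s)) \<longrightarrow>
           al_prov At
             (bangW Q (arrs \<rho>s (hat Q \<tau>s)) fs @ bangW Q (hat Q \<rho>s) zs @
                [Bang (BQ Q \<tau>s (appt c (fs @ zs)) A)])
             (let r = length \<rho>s in
              BQ Q \<rho>s zs
                (Bang (BQ Q \<tau>s (appt (map (tshift r) fs) (vars r))
                   (asubst (ups (length \<tau>s) (\<lambda>i. Var (i + r))) A))))))"

text \<open>The conditions are imposed for the formulas of a class \<open>\<C>\<close> only. The terms \<open>\<eta>\<close>, \<open>\<squnion>\<close> and \<open>\<circ>\<close> may depend on the formula.\<close>

definition A5 :: "('f, 'p) al_theory \<Rightarrow> ('f, 'p) al_params \<Rightarrow> ('f, 'p) afm set \<Rightarrow> bool" where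
  "A5 At Q \<C> \<longleftrightarrow>
     (\<forall>\<tau>s. Q1 At Q \<C> \<tau>s \<and> Q2 At Q \<tau>s \<and>
        (\<forall>A\<in>\<C>. not_free At Q \<tau>s A \<and> C_eta At Q \<tau>s A \<and> C_join At Q \<tau>s A \<and>
           (\<forall>\<rho>s. C_circ At Q \<rho>s \<tau>s A)))"

text \<open>Every \<open>W \<tau>\<close> is provably inhabited by a closed term. Without this the interpretations of
  weakening and of ex falso have no witnesses.\<close>

definition W_inhabited :: "('f, 'p) il_theory \<Rightarrow> ('f, 'p) il_params \<Rightarrow> bool" where
  "W_inhabited It Q \<longleftrightarrow> (\<forall>\<tau>. \<exists>t. closed_term (lang It) t \<and> il_prov It [] (iW Q \<tau> t))"


section \<open>The interpretation of IL and witnessability\<close>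

definition bpos :: "('f, 'p) il_params \<Rightarrow> ('f, 'p) ifm \<Rightarrow> ty list" where
  "bpos Q A = tpos (bullet Q) (star A)"

definition bneg :: "('f, 'p) il_params \<Rightarrow> ('f, 'p) ifm \<Rightarrow> ty list" where
  "bneg Q A = tneg (bullet Q) (star A)"

definition binterp ::
    "('f, 'p) il_params \<Rightarrow> ('f, 'p) ifm \<Rightarrow> 'f tm list \<Rightarrow> 'f tm list \<Rightarrow> ('f, 'p) ifm" where
  "binterp Q A xs ys = forget (interp (bullet Q) (star A) xs ys)"

text \<open>The formula \<open>\<forall>y \<sqsubset> a. |B|\<close> with superscript \<open>xs\<close> and subscript \<open>y\<close>.\<close>

definition bounded_binterp ::
    "('f, 'p) il_params \<Rightarrow> ('f, 'p) ifm \<Rightarrow> 'f tm list \<Rightarrow> 'f tm list \<Rightarrow> ('f, 'p) ifm" where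
  "bounded_binterp Q B xs as =
     (let n = length (bneg Q B) in
      BQ Q (bneg Q B) as (binterp Q (ishift n B) (map (tshift n) xs) (vars n)))"

text \<open>Cuts a tuple into consecutive blocks of the given lengths.\<close>

fun blocks :: "nat list \<Rightarrow> 'a list \<Rightarrow> 'a list list" where
  "blocks [] xs = []"
| "blocks (n # ns) xs = take n xs # blocks ns (drop n xs)"

definition ctx_pos :: "('f, 'p) il_params \<Rightarrow> ('f, 'p) ifm list \<Rightarrow> ty list" where
  "ctx_pos Q \<Gamma> = concat (map (bpos Q) \<Gamma>)"

definition ctx_bounds :: "('f, 'p) il_params \<Rightarrow> ('f, 'p) ifm list \<Rightarrow> ty list" where
  "ctx_bounds Q \<Gamma> = concat (map (\<lambda>B. hat Q (bneg Q B)) \<Gamma>)"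

text \<open>In the sequent to be proved the tuples \<open>xs\<close> and \<open>ws\<close> are the variables \<open>0, \<dots>, m+k-1\<close>, which
  are made fresh by shifting \<open>\<Gamma>\<close> and \<open>A\<close>.\<close>

definition witnessable ::
    "('f, 'p) il_theory \<Rightarrow> ('f, 'p) il_params \<Rightarrow> ('f, 'p) ifm list \<Rightarrow> ('f, 'p) ifm \<Rightarrow> bool" where
  "witnessable It Q \<Gamma> A \<longleftrightarrow>
     (\<exists>\<gamma> a. length \<gamma> = length (ctx_bounds Q \<Gamma>) \<and> length a = length (bpos Q A) \<and>
        (\<forall>t\<in>set (\<gamma> @ a). closed_term (lang It) t) \<and>
        il_prov It [] (iWs Q (arrs (ctx_pos Q \<Gamma>) (arrs (bneg Q A) (ctx_bounds Q \<Gamma>))) \<gamma>) \<and>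
        il_prov It [] (iWs Q (arrs (ctx_pos Q \<Gamma>) (bpos Q A)) a) \<and>
        (let m = length (ctx_pos Q \<Gamma>); k = length (bneg Q A);
             xs = map Var [0..<m]; ws = map Var [m..<m + k];
             xss = blocks (map (\<lambda>B. length (bpos Q B)) \<Gamma>) xs;
             \<gamma>s = blocks (map (\<lambda>B. length (hat Q (bneg Q B))) \<Gamma>) \<gamma>
         in il_prov It
              (map2 (iW Q) (ctx_pos Q \<Gamma> @ bneg Q A) (xs @ ws) @
               map (\<lambda>(B, x, g). bounded_binterp Q (ishift (m + k) B) x (appt g (xs @ ws)))
                 (zip \<Gamma> (zip xss \<gamma>s)))
              (binterp Q (ishift (m + k) A) (appt a xs) ws)))"

end

theory Submission
  imports Defs
begin

text \<open>
  On formulas \<open>A\<^sup>*\<close> the interpretation commutes with the forgetful translation, so the argument can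
  be carried out in IL: the forgetful images of \<open>A1\<close> to \<open>A5\<close> are used. Only the rule
  \<open>Q1\<close> has a derivation in AL as a premise, which the Girard translation provides. The context in \<open>Q1\<close> may then be taken to
  consist of formulas \<open>|!B\<^sup>*|\<close>, since all contexts \<open>!\<Gamma>\<^sup>*\<close> are banged.

  A sequent \<open>B\<^sub>1, \<dots>, B\<^sub>n \<turnstile> A\<close> and the formula \<open>B\<^sub>1 \<rightarrow> \<dots> \<rightarrow> B\<^sub>n \<rightarrow> A\<close> are realized by literally the same
  terms. By the deduction theorem it therefore suffices to realize the axioms of a Hilbert system
  and to show that its rules preserve realizability. Only the axiom
  \<open>(A \<rightarrow> B \<rightarrow> C) \<rightarrow> (A \<rightarrow> B) \<rightarrow> A \<rightarrow> C\<close> needs \<open>\<squnion>\<close> (contraction of \<open>A\<close>) and \<open>\<circ>\<close> (promotion of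
  \<open>A \<rightarrow> B\<close> and \<open>A\<close> to a bound for \<open>B\<close>); the others need at most
  \<open>\<eta>\<close> and inhabitants of \<open>W\<close>. The realizing terms are defined from
  these by combinatory abstraction.
\<close>

text \<open>The obstacle is uniformity. Witnesses are closed terms, fixed before the terms and
  formulas they will be used with are known, but quantifier rules instantiate formulas and the terms
  supplied by \<open>A5\<close> may depend on the formula. Two devices meet this. \<open>A5\<close>
  is applied only to formulas whose parameter tuples are fresh variables, so that every other case
  is a substitution instance. And realizability (\<open>real_seq\<close>) is stated for all
  substitutions by source terms, all sets \<open>S\<close> of hypotheses and all tuples provably in
  \<open>W\<close> from \<open>S\<close>: eigenvariable rules use it at a substitution pushed under
  a binder, implication at an enlarged \<open>S\<close>, bounded quantification at fresh variables
  assumed to be in \<open>W\<close>.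

  The bounded quantifier is introduced in two situations only: in modus ponens, where a realized
  formula must be proved under a bound, and in the contraction axiom, where modus ponens itself runs
  inside the quantifier. Since combinatory terms satisfy their equations only provably, all of this
  is up to provable equality.\<close>

section \<open>Substitution\<close>

lemma tsubst_cong: "(\<And>i. i \<in> tfv t \<Longrightarrow> \<sigma> i = \<theta> i) \<Longrightarrow> tsubst \<sigma> t = tsubst \<theta> t"
  by (induction t) auto

lemma tsubst_tsubst: "tsubst \<sigma> (tsubst \<theta> t) = tsubst (\<lambda>i. tsubst \<sigma> (\<theta> i)) t"
  by (induction t) auto

lemma tsubst_Var [simp]: "tsubst Var t = t"
  by (induction t) (auto intro: map_idI)

lemma map_tsubst_Var [simp]: "map (tsubst Var) ts = ts"
  by (simp add: map_idI)

lemma tsubst_closed: "tfv t = {} \<Longrightarrow> tsubst \<sigma> t = t"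
  using tsubst_cong[of t \<sigma> Var] by simp

lemma finite_tfv [simp]: "finite (tfv t)"
  by (induction t) auto

lemma tsubst_tshift: "tsubst \<sigma> (tshift n t) = tsubst (\<lambda>i. \<sigma> (i + n)) t"
  by (simp add: tshift_def tsubst_tsubst)

lemma tshift_Var [simp]: "tshift n (Var i) = Var (i + n)"
  by (simp add: tshift_def)

lemma ups_Var [simp]: "ups n Var = Var"
  by (auto simp: ups_def fun_eq_iff)

lemma tsubst_ups_tshift: "tsubst (ups n \<sigma>) (tshift n t) = tshift n (tsubst \<sigma> t)"
  by (simp add: tsubst_tshift ups_def) (simp add: tshift_def tsubst_tsubst)

lemma map_tsubst_ups_tshift:
  "map (tsubst (ups n \<sigma>)) (map (tshift n) ts) = map (tshift n) (map (tsubst \<sigma>) ts)"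
  by (simp add: tsubst_ups_tshift)

lemma ups_comp: "tsubst (ups n \<sigma>) (ups n \<theta> i) = ups n (\<lambda>i. tsubst \<sigma> (\<theta> i)) i"
  using tsubst_ups_tshift[of n \<sigma>] by (auto simp: ups_def)

lemma isubst_cong: "(\<And>i. i \<in> ifv A \<Longrightarrow> \<sigma> i = \<theta> i) \<Longrightarrow> isubst \<sigma> A = isubst \<theta> A"
proof (induction A arbitrary: \<sigma> \<theta>)
  case (IPred p ts) then show ?case by (auto intro!: tsubst_cong)
next
  case (IAll A)
  have "isubst (ups 1 \<sigma>) A = isubst (ups 1 \<theta>) A"
    using IAll.prems by (intro IAll.IH) (auto simp: ups_def unbind_def)
  then show ?case by simp
next
  case (IEx A)
  have "isubst (ups 1 \<sigma>) A = isubst (ups 1 \<theta>) A"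
    using IEx.prems by (intro IEx.IH) (auto simp: ups_def unbind_def)
  then show ?case by simp
next
  case (IAnd A B) then show ?case by (metis UnI1 UnI2 ifv.simps(3) isubst.simps(3))
next
  case (IImp A B) then show ?case by (metis UnI1 UnI2 ifv.simps(4) isubst.simps(4))
qed auto

lemma isubst_isubst: "isubst \<sigma> (isubst \<theta> A) = isubst (\<lambda>i. tsubst \<sigma> (\<theta> i)) A"
  by (induction A arbitrary: \<sigma> \<theta>) (auto simp: tsubst_tsubst ups_comp)

lemma isubst_Var [simp]: "isubst Var A = A"
  by (induction A) auto

lemma finite_ifv [simp]: "finite (ifv A)"
proof (induction A)
  case (IAll A) then show ?case using finite_vimageI[of "ifv A" "\<lambda>i. i + 1"]
    by (simp add: unbind_def vimage_def)
next
  case (IEx A) then show ?case using finite_vimageI[of "ifv A" "\<lambda>i. i + 1"]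
    by (simp add: unbind_def vimage_def)
qed auto

lemma isubst_ishift: "isubst \<sigma> (ishift n A) = isubst (\<lambda>i. \<sigma> (i + n)) A"
  by (simp add: ishift_def isubst_isubst)

lemma isubst_ups_ishift: "isubst (ups n \<sigma>) (ishift n A) = ishift n (isubst \<sigma> A)"
  by (simp add: isubst_ishift ups_def) (simp add: ishift_def isubst_isubst tshift_def)

lemma ishift_imp [simp]: "ishift n (IImp A B) = IImp (ishift n A) (ishift n B)"
  and ishift_and [simp]: "ishift n (IAnd A B) = IAnd (ishift n A) (ishift n B)"
  and ishift_bot [simp]: "ishift n IBot = IBot"
  by (simp_all add: ishift_def)

lemma twf_tsubst: "twf L t \<Longrightarrow> (\<And>i. twf L (\<sigma> i)) \<Longrightarrow> twf L (tsubst \<sigma> t)"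
  by (induction t) (auto simp: list_all_iff)

lemma twf_tshift [simp]: "twf L (tshift n t) = twf L t"
  by (induction t) (auto simp: tshift_def list_all_iff)

lemma twf_ups: "(\<And>i. twf L (\<sigma> i)) \<Longrightarrow> twf L (ups n \<sigma> i)"
  by (simp add: ups_def)

lemma twf_inst: "\<forall>t\<in>set ts. twf L t \<Longrightarrow> twf L (inst ts i)"
  by (simp add: inst_def)

lemma iwf_isubst: "iwf L A \<Longrightarrow> (\<And>i. twf L (\<sigma> i)) \<Longrightarrow> iwf L (isubst \<sigma> A)"
  by (induction A arbitrary: \<sigma>) (auto simp: twf_tsubst twf_ups)

text \<open>An arbitrary renaming \<open>f\<close> replaces the shift because the induction passes
  binders, where \<open>ups 1\<close> turns a renaming into another renaming.\<close>

lemma iwf_isubstD: "iwf L (isubst (\<lambda>i. Var (f i)) A) \<Longrightarrow> iwf L A"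
proof (induction A arbitrary: f)
  case (IPred p ts)
  have "twf L (tsubst (\<lambda>i. Var (f i)) t) = twf L t" for t
    by (induction t) (auto simp: list_all_iff)
  with IPred show ?case by auto
next
  case (IAll A)
  have "ups 1 (\<lambda>i. Var (f i)) = (\<lambda>i. Var (if i < 1 then i else f (i - 1) + 1) :: 'a tm)"
    by (auto simp: ups_def)
  with IAll show ?case by (metis isubst.simps(5) iwf.simps(5))
next
  case (IEx A)
  have "ups 1 (\<lambda>i. Var (f i)) = (\<lambda>i. Var (if i < 1 then i else f (i - 1) + 1) :: 'a tm)"
    by (auto simp: ups_def)
  with IEx show ?case by (metis isubst.simps(6) iwf.simps(6))
qed auto

lemma iwf_ishift [simp]: "iwf L (ishift n A) = iwf L A"
  unfolding ishift_def by (rule iffI[OF iwf_isubstD iwf_isubst]) auto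

lemma twf_mono: "funs L \<subseteq>\<^sub>m funs L' \<Longrightarrow> twf L t \<Longrightarrow> twf L' t"
  by (induction t) (auto simp: list_all_iff map_le_def dom_def)

lemma iwf_mono: "lang_le L L' \<Longrightarrow> iwf L A \<Longrightarrow> iwf L' A"
  by (induction A) (auto simp: lang_le_def twf_mono map_le_def dom_def)

text \<open>The cons of explicit substitution calculi, for a whole tuple. Instantiating the lowest
  variables after pushing \<open>\<sigma>\<close> under them gives this substitution
  (\<open>isubst_scons_ups\<close>), so generic variables and the formula shifted past them can be
  instantiated in one stroke.\<close>

definition scons :: "'f tm list \<Rightarrow> (nat \<Rightarrow> 'f tm) \<Rightarrow> nat \<Rightarrow> 'f tm" where
  "scons ts \<sigma> i = (if i < length ts then ts ! i else \<sigma> (i - length ts))"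

lemma inst_scons: "inst ts = scons ts Var"
  by (auto simp: inst_def scons_def fun_eq_iff)

lemma scons_add [simp]: "scons ts \<sigma> (i + length ts) = \<sigma> i"
  by (simp add: scons_def)

lemma scons_Nil [simp]: "scons [] \<sigma> = \<sigma>"
  by (auto simp: scons_def fun_eq_iff)

lemma scons_append: "scons (ss @ ts) \<sigma> = scons ss (scons ts \<sigma>)"
  by (auto simp: scons_def fun_eq_iff nth_append)

lemma twf_scons: "\<forall>t\<in>set ts. twf L t \<Longrightarrow> (\<And>i. twf L (\<sigma> i)) \<Longrightarrow> twf L (scons ts \<sigma> i)"
  by (simp add: scons_def)

lemma map_scons_vars:
  "a + b \<le> length ts \<Longrightarrow> map (tsubst (scons ts \<sigma>)) (map Var [a..<a + b]) = take b (drop a ts)"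
  by (auto simp: list_eq_iff_nth_eq scons_def)

lemma map_scons_vars0:
  "b \<le> length ts \<Longrightarrow> map (tsubst (scons ts \<sigma>)) (vars b) = take b ts"
  using map_scons_vars[of 0 b ts \<sigma>] by simp

lemma isubst_scons_ishift: "length ts = n \<Longrightarrow> isubst (scons ts \<sigma>) (ishift n A) = isubst \<sigma> A"
  by (auto simp: isubst_ishift)

lemma tsubst_scons_tshift: "length ts = n \<Longrightarrow> tsubst (scons ts \<sigma>) (tshift n t) = tsubst \<sigma> t"
  by (auto simp: tsubst_tshift)

lemma isubst_scons_ups:
  "length ts = n \<Longrightarrow> isubst (scons ts Var) (isubst (ups n \<sigma>) A) = isubst (scons ts \<sigma>) A"
proof -
  assume n: "length ts = n"
  have "tsubst (scons ts Var) (ups n \<sigma> i) = scons ts \<sigma> i" for i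
    using n by (auto simp: ups_def tsubst_scons_tshift) (auto simp: scons_def)
  then show ?thesis by (simp add: isubst_isubst)
qed

text \<open>Both sides are the single substitution
  \<open>scons (map (tsubst \<sigma>) ts) \<sigma>\<close>. The quantifier axioms use it to move
  \<open>\<sigma>\<close> past the instance of the quantified formula.\<close>

lemma isubst_isubst_inst:
  "isubst \<sigma> (isubst (inst ts) A) = isubst (inst (map (tsubst \<sigma>) ts)) (isubst (ups (length ts) \<sigma>) A)"
proof -
  have "(\<lambda>i. tsubst \<sigma> (scons ts Var i)) = scons (map (tsubst \<sigma>) ts) \<sigma>"
    by (auto simp: scons_def)
  then show ?thesis
    by (simp add: inst_scons isubst_scons_ups) (simp add: isubst_isubst)
qed

section \<open>Passage between AL and IL: \<open>forget\<close> inverts \<open>star\<close> and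
  preserves provability\<close>

section \<open>Star and forget\<close>

lemma ashift_bang [simp]: "ashift n (Bang A) = Bang (ashift n A)"
  by (simp add: ashift_def)

lemma forget_star [simp]: "forget (star A) = A"
  by (induction A) auto

lemma star_isubst: "star (isubst \<sigma> A) = asubst \<sigma> (star A)"
  by (induction A arbitrary: \<sigma>) auto

lemma forget_asubst: "forget (asubst \<sigma> A) = isubst \<sigma> (forget A)"
  by (induction A arbitrary: \<sigma>) auto

lemma star_ishift: "star (ishift n A) = ashift n (star A)"
  by (simp add: ishift_def ashift_def star_isubst)

lemma forget_ashift: "forget (ashift n A) = ishift n (forget A)"
  by (simp add: ishift_def ashift_def forget_asubst)

lemma awf_star [simp]: "awf L (star A) = iwf L A"
  by (induction A) auto

lemma iwf_forget [simp]: "iwf L (forget A) = awf L A"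
  by (induction A) auto

lemma lang_star_theory [simp]: "lang (star_theory T) = lang T"
  by (simp add: star_theory_def)

text \<open>Dereliction and promotion become trivial once bangs are erased, contraction of a banged
  formula becomes ordinary contraction, and the axioms return to those of \<open>T\<close> because
  \<open>forget\<close> inverts \<open>star\<close>.\<close>

lemma al_prov_forget:
  "al_prov (star_theory T) \<Gamma> A \<Longrightarrow> il_prov T (map forget \<Gamma>) (forget A)"
proof (induction rule: al_prov.induct)
  case (al_ax \<Gamma> A)
  then obtain \<Gamma>' A' where "(\<Gamma>', A') \<in> axs T" "\<Gamma> = map (Bang \<circ> star) \<Gamma>'" "A = star A'"
    by (auto simp: star_theory_def)
  moreover have "map forget (map (Bang \<circ> star) \<Gamma>') = \<Gamma>'"
    by (rule nth_equalityI) auto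
  ultimately show ?case by (metis forget_star il_ax)
next
  case (al_exch \<Gamma> A \<Delta>)
  then show ?case by (metis il_exch mset_map)
next
  case (al_allL t A \<Gamma> B)
  then show ?case by (auto intro!: il_allL simp: forget_asubst)
next
  case (al_allR \<Gamma> A)
  then show ?case by (auto intro!: il_allR simp: forget_ashift o_def)
next
  case (al_exL A \<Gamma> B)
  then show ?case by (auto intro!: il_exL simp: forget_ashift o_def)
next
  case (al_exR \<Gamma> t A)
  then show ?case by (auto intro!: il_exR simp: forget_asubst)
next
  case (al_bangC A \<Gamma> B)
  then show ?case by (auto intro: il_contr)
qed (auto intro: il_prov.intros)

section \<open>Bangs over tensors, and soundness of the Girard translation\<close>

section \<open>Derived rules of AL and the Girard translation\<close>

lemma al_exchI: "al_prov T \<Gamma> A \<Longrightarrow> mset \<Gamma> = mset \<Delta> \<Longrightarrow> al_prov T \<Delta> A"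
  by (metis al_exch)

text \<open>Weakening gives both projections of \<open>Tens A B\<close>, and each can be promoted
  from its bang; the two copies of the banged tensor are then contracted.\<close>

lemma bang_tensL:
  assumes "al_prov T (Bang A # Bang B # \<Gamma>) C" "awf (lang T) A" "awf (lang T) B"
  shows "al_prov T (Bang (Tens A B) # \<Gamma>) C"
proof -
  have "al_prov T [A, B] A"
    by (rule al_exch[OF al_weak[OF al_id]]) (use assms in auto)
  then have 1: "al_prov T [Bang (Tens A B)] (Bang A)"
    using al_bangR[of T "[Tens A B]" A] by (auto intro: al_bangL al_tensL)
  have "al_prov T [A, B] B"
    using assms by (auto intro: al_weak al_id)
  then have 2: "al_prov T [Bang (Tens A B)] (Bang B)"
    using al_bangR[of T "[Tens A B]" B] by (auto intro: al_bangL al_tensL)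
  have "al_prov T (Bang (Tens A B) # Bang B # \<Gamma>) C"
    using al_cut[OF 1 assms(1)] by simp
  then have "al_prov T (Bang B # Bang (Tens A B) # \<Gamma>) C"
    by (rule al_exchI) simp
  from al_cut[OF 2 this] show ?thesis
    by (auto intro: al_bangC)
qed

text \<open>Packs separate banged hypotheses into the single formula \<open>!W(x)\<close> that
  \<open>Q1\<close> admits in its antecedent and \<open>Q2\<close> mentions.\<close>

lemma bang_aconjL:
  assumes "al_prov T (map Bang As @ \<Gamma>) C" "\<forall>A\<in>set As. awf (lang T) A"
  shows "al_prov T (Bang (aconj As) # \<Gamma>) C"
  using assms
proof (induction As arbitrary: \<Gamma>)
  case Nil
  then show ?case by (auto simp: aconj_def intro: al_weak)
next
  case (Cons A As)
  have "al_prov T (map Bang As @ Bang A # \<Gamma>) C"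
    by (rule al_exchI[OF Cons.prems(1)]) simp
  then have "al_prov T (Bang (aconj As) # Bang A # \<Gamma>) C"
    using Cons by simp
  then have *: "al_prov T (Bang A # Bang (aconj As) # \<Gamma>) C"
    by (rule al_exchI) simp
  have "awf (lang T) (aconj As)"
    using Cons.prems(2) by (induction As) (auto simp: aconj_def)
  then show ?case using bang_tensL[OF *] Cons.prems by (simp add: aconj_def)
qed

lemma il_prov_wf:
  assumes "il_wf_theory T" "il_prov T \<Gamma> A"
  shows "(\<forall>B\<in>set \<Gamma>. iwf (lang T) B) \<and> iwf (lang T) A"
  using assms(2)
proof (induction rule: il_prov.induct)
  case (il_ax \<Gamma> A)
  then show ?case using assms(1) by (auto simp: il_wf_theory_def)
next
  case (il_exch \<Gamma> A \<Delta>)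
  then show ?case by (metis mset_eq_setD)
qed auto

lemma al_promote:
  "al_prov T (map (\<lambda>B. Bang (star B)) \<Gamma>) A \<Longrightarrow> al_prov T (map (\<lambda>B. Bang (star B)) \<Gamma>) (Bang A)"
  using al_bangR[of T "map star \<Gamma>" A] by (simp add: o_def)

text \<open>Antecedents of implications, bodies of existentials and cut formulas all need a bang. It
  is always available by \<open>al_promote\<close>, because every formula of a translated context is
  banged.\<close>

lemma girard:
  assumes "il_wf_theory T" "il_prov T \<Gamma> A"
  shows "al_prov (star_theory T) (map (\<lambda>B. Bang (star B)) \<Gamma>) (star A)"
  using assms(2)
proof (induction rule: il_prov.induct)
  case (il_ax \<Gamma> A)
  then show ?case by (intro al_ax) (force simp: star_theory_def o_def)
next
  case (il_id A)
  then show ?case by (auto intro!: al_bangL al_id)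
next
  case (il_cut \<Gamma> A \<Delta> B)
  have "al_prov (star_theory T) (map (\<lambda>B. Bang (star B)) \<Gamma>) (Bang (star A))"
    by (rule al_promote[OF il_cut.IH(1)])
  from al_cut[OF this] il_cut.IH(2) show ?case by simp
next
  case (il_exch \<Gamma> A \<Delta>)
  then show ?case by (metis al_exch mset_map)
next
  case (il_weak \<Gamma> B A)
  then show ?case by (auto intro!: al_weak)
next
  case (il_contr A \<Gamma> B)
  then show ?case by (auto intro: al_bangC)
next
  case (il_botL A)
  then show ?case by (auto intro!: al_bangL al_botL)
next
  case (il_andL A B \<Gamma> C)
  have "iwf (lang T) A" "iwf (lang T) B"
    using il_prov_wf[OF assms(1) il_andL.hyps] by auto
  then show ?case using il_andL.IH by (auto intro!: bang_tensL)
next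
  case (il_andR \<Gamma> A \<Delta> B)
  then show ?case by (auto intro: al_tensR)
next
  case (il_impL \<Gamma> A B \<Delta> C)
  let ?T = "star_theory T" and ?G = "map (\<lambda>B. Bang (star B)) \<Gamma>" and ?I = "star (IImp A B)"
  have A: "al_prov ?T ?G (Bang (star A))"
    by (rule al_promote[OF il_impL.IH(1)])
  have "iwf (lang T) B"
    using il_prov_wf[OF assms(1) il_impL.hyps(2)] by auto
  then have "al_prov ?T (Lolli (Bang (star A)) (star B) # ?G @ []) (star B)"
    by (intro al_lolliL A al_id) simp
  \<comment> \<open>The right premise has \<open>B\<close> behind a bang. To promote the succedent
    \<open>star B\<close>, the implication must be under a bang too, which is how it occurs in a
    translated context anyway.\<close>
  then have "al_prov ?T (map Bang (?I # map star \<Gamma>)) (star B)"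
    by (auto intro: al_bangL simp: o_def)
  from al_bangR[OF this] have "al_prov ?T (Bang ?I # ?G) (Bang (star B))"
    by (simp add: o_def)
  from al_cut[OF this] il_impL.IH(2) show ?case by simp
next
  case (il_impR A \<Gamma> B)
  then show ?case by (auto intro: al_lolliR)
next
  case (il_allL t A \<Gamma> B)
  let ?T = "star_theory T"
  have "al_prov ?T [AAll (star A)] (asubst (inst [t]) (star A))"
    using il_allL.hyps
    by (intro al_allL[where t = t] al_id) (auto simp: star_isubst[symmetric] intro!: iwf_isubst twf_inst)
  then have "al_prov ?T (map Bang [AAll (star A)]) (star (isubst (inst [t]) A))"
    by (auto intro: al_bangL simp: star_isubst)
  from al_bangR[OF this] have "al_prov ?T [Bang (star (IAll A))] (Bang (star (isubst (inst [t]) A)))"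
    by simp
  from al_cut[OF this] il_allL.IH show ?case by simp
next
  case (il_allR \<Gamma> A)
  then show ?case by (auto intro!: al_allR simp: o_def star_ishift)
next
  case (il_exL A \<Gamma> B)
  then show ?case by (simp add: o_def star_ishift al_bangL[OF al_exL])
next
  case (il_exR \<Gamma> t A)
  have "al_prov (star_theory T) (map (\<lambda>B. Bang (star B)) \<Gamma>) (Bang (star (isubst (inst [t]) A)))"
    by (rule al_promote[OF il_exR.IH])
  then show ?case using il_exR.hyps by (auto intro!: al_exR simp: star_isubst)
qed

section \<open>Natural deduction rules for provability from a set of hypotheses\<close>

section \<open>Entailment from sets of formulas\<close>

text \<open>Sets absorb exchange, weakening and contraction. \<open>S\<close> may be infinite and
  contain ill-formed formulas; over a well-formed theory the list actually used consists of formulas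
  of the language.\<close>

definition prv :: "('f, 'p) il_theory \<Rightarrow> ('f, 'p) ifm set \<Rightarrow> ('f, 'p) ifm \<Rightarrow> bool" where
  "prv T S A \<longleftrightarrow> (\<exists>\<Gamma>. set \<Gamma> \<subseteq> S \<and> il_prov T \<Gamma> A)"

abbreviation imps :: "('f, 'p) ifm list \<Rightarrow> ('f, 'p) ifm \<Rightarrow> ('f, 'p) ifm" where
  "imps \<Gamma> A \<equiv> foldr IImp \<Gamma> A"

lemma iwf_imps: "iwf L (imps \<Gamma> A) \<longleftrightarrow> (\<forall>B\<in>set \<Gamma>. iwf L B) \<and> iwf L A"
  by (induction \<Gamma>) auto

lemma isubst_imps: "isubst \<sigma> (imps \<Gamma> A) = imps (map (isubst \<sigma>) \<Gamma>) (isubst \<sigma> A)"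
  by (induction \<Gamma>) auto

lemma subset_image_map: "set xs \<subseteq> f ` S \<Longrightarrow> \<exists>ys. xs = map f ys \<and> set ys \<subseteq> S"
proof (induction xs)
  case (Cons x xs)
  then obtain y ys where "x = f y" "y \<in> S" "xs = map f ys" "set ys \<subseteq> S" by auto
  then show ?case by (intro exI[of _ "y # ys"]) auto
qed simp

lemma il_contrs: "il_prov T (replicate (Suc n) A @ \<Gamma>) B \<Longrightarrow> il_prov T (A # \<Gamma>) B"
  by (induction n) (auto intro: il_contr)

text \<open>Sets forget multiplicities, so all occurrences of \<open>A\<close> are collected into
  one before a rule acts on it. Weakening covers the case that \<open>A\<close> does not occur,
  whence the well-formedness premise.\<close>

lemma il_move_front:
  assumes "il_prov T \<Delta> B" "iwf (lang T) A"
  shows "il_prov T (A # removeAll A \<Delta>) B"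
proof -
  have "mset \<Delta> = mset (replicate (count (mset \<Delta>) A) A @ removeAll A \<Delta>)"
    by (induction \<Delta>) auto
  then have "il_prov T (replicate (count (mset \<Delta>) A) A @ removeAll A \<Delta>) B"
    using il_exch[OF assms(1)] by metis
  then show ?thesis using il_weak[OF _ assms(2)] by (intro il_contrs) auto
qed

locale il_wf =
  fixes T :: "('f, 'p) il_theory"
  assumes wf_theory: "il_wf_theory T"
begin

abbreviation "wft \<equiv> twf (lang T)"
abbreviation "wff \<equiv> iwf (lang T)"

lemma prv_wf: "prv T S A \<Longrightarrow> wff A"
  using il_prov_wf[OF wf_theory] by (auto simp: prv_def)

lemma prv_mono: "prv T S A \<Longrightarrow> S \<subseteq> S' \<Longrightarrow> prv T S' A"
  by (auto simp: prv_def)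

lemma il_prv: "il_prov T \<Gamma> A \<Longrightarrow> set \<Gamma> \<subseteq> S \<Longrightarrow> prv T S A"
  by (auto simp: prv_def)

lemma prv_hyp: "A \<in> S \<Longrightarrow> wff A \<Longrightarrow> prv T S A"
  by (rule il_prv[OF il_id]) auto

lemma il_contr_subset:
  assumes "il_prov T (\<Delta> @ \<Gamma>) A" "set \<Delta> \<subseteq> set \<Gamma>" shows "il_prov T \<Gamma> A"
  using assms
proof (induction \<Delta>)
  case (Cons B \<Delta>)
  then have "mset (B # B # \<Delta> @ remove1 B \<Gamma>) = mset ((B # \<Delta>) @ \<Gamma>)"
    by simp
  then have "il_prov T (B # B # \<Delta> @ remove1 B \<Gamma>) A"
    by (rule il_exch[OF Cons.prems(1)])
  then have "il_prov T (\<Delta> @ \<Gamma>) A"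
    by (rule il_exch[OF il_contr]) (use Cons.prems in simp)
  with Cons show ?case by simp
qed simp

lemma prv_il:
  assumes "prv T (set \<Gamma>) A" "\<forall>B\<in>set \<Gamma>. wff B"
  shows "il_prov T \<Gamma> A"
proof -
  obtain \<Delta> where \<Delta>: "set \<Delta> \<subseteq> set \<Gamma>" "il_prov T \<Delta> A"
    using assms(1) by (auto simp: prv_def)
  have "il_prov T (\<Gamma> @ \<Delta>) A"
    using assms(2) \<Delta>(2) by (induction \<Gamma>) (auto intro: il_weak)
  then have "il_prov T (\<Delta> @ \<Gamma>) A" by (rule il_exch) simp
  then show ?thesis using \<Delta>(1) by (rule il_contr_subset)
qed

lemma prv_impI:
  assumes "prv T (insert A S) B" "wff A" shows "prv T S (IImp A B)"
proof -
  obtain \<Delta> where \<Delta>: "set \<Delta> \<subseteq> insert A S" "il_prov T \<Delta> B"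
    using assms(1) by (auto simp: prv_def)
  have "il_prov T (removeAll A \<Delta>) (IImp A B)"
    by (rule il_impR[OF il_move_front[OF \<Delta>(2) assms(2)]])
  then show ?thesis using \<Delta>(1) by (auto intro!: il_prv)
qed

lemma prv_cut:
  assumes "prv T S A" "prv T (insert A S) B" shows "prv T S B"
proof -
  obtain \<Gamma> where \<Gamma>: "set \<Gamma> \<subseteq> S" "il_prov T \<Gamma> A"
    using assms(1) by (auto simp: prv_def)
  obtain \<Delta> where \<Delta>: "set \<Delta> \<subseteq> insert A S" "il_prov T \<Delta> B"
    using assms(2) by (auto simp: prv_def)
  have "il_prov T (\<Gamma> @ removeAll A \<Delta>) B"
    by (rule il_cut[OF \<Gamma>(2) il_move_front[OF \<Delta>(2) prv_wf[OF assms(1)]]])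
  then show ?thesis using \<Gamma>(1) \<Delta>(1) by (auto intro!: il_prv)
qed

lemma prv_cut1: "prv T S A \<Longrightarrow> prv T {A} B \<Longrightarrow> prv T S B"
  by (rule prv_cut) (auto elim: prv_mono)

lemma prv_cuts:
  assumes "prv T S' B" "\<And>A. A \<in> S' \<Longrightarrow> prv T S A" shows "prv T S B"
proof -
  obtain \<Gamma> where \<Gamma>: "set \<Gamma> \<subseteq> S'" "il_prov T \<Gamma> B"
    using assms(1) by (auto simp: prv_def)
  have "set \<Gamma> \<subseteq> S' \<Longrightarrow> prv T (set \<Gamma> \<union> S) B \<Longrightarrow> prv T S B"
  proof (induction \<Gamma>)
    case (Cons A \<Gamma>)
    have "prv T (set \<Gamma> \<union> S) A"
      by (rule prv_mono[OF assms(2)]) (use Cons.prems in auto)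
    moreover have "prv T (insert A (set \<Gamma> \<union> S)) B"
      using Cons.prems(2) by simp
    ultimately have "prv T (set \<Gamma> \<union> S) B" by (rule prv_cut)
    with Cons show ?case by simp
  qed simp
  moreover have "prv T (set \<Gamma> \<union> S) B" by (rule il_prv[OF \<Gamma>(2)]) simp
  ultimately show ?thesis using \<Gamma>(1) by blast
qed

lemma prv_mp: "prv T S (IImp A B) \<Longrightarrow> prv T S A \<Longrightarrow> prv T S B"
proof -
  assume *: "prv T S (IImp A B)" "prv T S A"
  then have "wff A" "wff B" using prv_wf by force+
  then have "il_prov T (IImp A B # [A] @ []) B"
    by (intro il_impL il_id)
  then have "prv T {IImp A B, A} B" by (rule il_prv) simp
  then show ?thesis by (rule prv_cuts) (use * in auto)
qed

lemma prv_andI: "prv T S A \<Longrightarrow> prv T S B \<Longrightarrow> prv T S (IAnd A B)"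
  unfolding prv_def by (metis il_andR le_sup_iff set_append)

lemma prv_andD:
  assumes "prv T S (IAnd A B)" shows "prv T S A" "prv T S B"
proof -
  have wf: "wff A" "wff B" using prv_wf[OF assms] by auto
  have "il_prov T [A, B] A" "il_prov T [A, B] B"
    using wf by (auto intro!: prv_il prv_hyp)
  then have "prv T {IAnd A B} A" "prv T {IAnd A B} B"
    by (auto intro!: il_prv[OF il_andL])
  with assms show "prv T S A" "prv T S B" by (auto intro: prv_cut1)
qed

lemma prv_botE: "prv T S IBot \<Longrightarrow> wff A \<Longrightarrow> prv T S A"
  by (erule prv_cut1) (auto intro: il_prv[OF il_botL])

lemma prv_allI:
  assumes "prv T (ishift 1 ` S) A" shows "prv T S (IAll A)"
proof -
  obtain \<Gamma> where \<Gamma>: "set \<Gamma> \<subseteq> ishift 1 ` S" "il_prov T \<Gamma> A"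
    using assms by (auto simp: prv_def)
  from subset_image_map[OF \<Gamma>(1)] obtain \<Gamma>' where "\<Gamma> = map (ishift 1) \<Gamma>'" "set \<Gamma>' \<subseteq> S"
    using subset_image_map by blast
  with \<Gamma> show ?thesis by (auto intro!: il_prv[OF il_allR])
qed

lemma prv_allE:
  assumes "prv T S (IAll A)" "wft t" shows "prv T S (isubst (inst [t]) A)"
proof (rule prv_cut1[OF assms(1)])
  have "wff A" using prv_wf[OF assms(1)] by simp
  then show "prv T {IAll A} (isubst (inst [t]) A)"
    using assms by (intro il_prv[OF il_allL[where t = t], OF il_id]) (auto intro!: iwf_isubst twf_inst)
qed

lemma prv_exI:
  assumes "prv T S (isubst (inst [t]) A)" "wff A" "wft t" shows "prv T S (IEx A)"
  using assms unfolding prv_def by (metis il_exR)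

lemma prv_exE:
  assumes "prv T S (IEx A)" "prv T (insert A (ishift 1 ` S)) (ishift 1 B)" shows "prv T S B"
proof (rule prv_cut[OF assms(1)])
  have wf: "wff A" using prv_wf[OF assms(1)] by simp
  obtain \<Delta> where \<Delta>: "set \<Delta> \<subseteq> insert A (ishift 1 ` S)" "il_prov T \<Delta> (ishift 1 B)"
    using assms(2) by (auto simp: prv_def)
  then have "set (removeAll A \<Delta>) \<subseteq> ishift 1 ` S" by auto
  then obtain \<Gamma> where \<Gamma>: "removeAll A \<Delta> = map (ishift 1) \<Gamma>" "set \<Gamma> \<subseteq> S"
    using subset_image_map by blast
  have "il_prov T (IEx A # \<Gamma>) B"
    using il_move_front[OF \<Delta>(2) wf] \<Gamma> by (auto intro: il_exL)
  then show "prv T (insert (IEx A) S) B" using \<Gamma> by (auto intro!: il_prv)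
qed

lemma prv_impsI: "prv T (set \<Gamma> \<union> S) A \<Longrightarrow> \<forall>B\<in>set \<Gamma>. wff B \<Longrightarrow> prv T S (imps \<Gamma> A)"
  by (induction \<Gamma> arbitrary: S) (auto intro!: prv_impI)

lemma prv_impsE: "prv T S (imps \<Gamma> A) \<Longrightarrow> prv T (set \<Gamma> \<union> S) A"
proof (induction \<Gamma> arbitrary: S)
  case (Cons B \<Gamma>)
  then have "wff B" using prv_wf by force
  then have "prv T (insert B S) (imps \<Gamma> A)"
    using Cons.prems by (auto intro: prv_mp[where A = B] prv_hyp prv_mono)
  from Cons.IH[OF this] show ?case by simp
qed auto

lemma prv_iconj: "\<forall>A\<in>set As. wff A \<Longrightarrow> prv T S (iconj As) \<longleftrightarrow> (\<forall>A\<in>set As. prv T S A)"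
proof (induction As)
  case Nil
  have "prv T S (IImp IBot IBot)" by (intro prv_impI prv_hyp) auto
  then show ?case by (simp add: iconj_def)
next
  case (Cons A As)
  then show ?case by (auto simp: iconj_def intro: prv_andI prv_andD)
qed

text \<open>Provability is closed under substitution although the axioms need not be: the universal
  closure is provable and can be instantiated.\<close>

lemma prv_insts:
  assumes "prv T {} ((IAll ^^ length ts) A)" "\<forall>t\<in>set ts. wft t"
  shows "prv T {} (isubst (inst ts) A)"
  using assms
proof (induction ts arbitrary: A)
  case Nil
  then show ?case by (simp add: inst_scons)
next
  case (Cons t ts)
  have "prv T {} ((IAll ^^ length ts) (IAll A))"
    using Cons.prems by (simp add: funpow_swap1)
  then have "prv T {} (IAll (isubst (ups 1 (inst ts)) A))"
    using Cons by force
  from prv_allE[OF this, of t] have "prv T {} (isubst (scons [t] (scons ts Var)) A)"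
    using Cons.prems isubst_scons_ups[of "[t]" 1 "inst ts" A] by (simp add: inst_scons)
  then show ?case
    using scons_append[of "[t]" ts Var] by (simp add: inst_scons)
qed

lemma prv_closed_subst:
  assumes "prv T {} A" "\<And>i. wft (\<sigma> i)" shows "prv T {} (isubst \<sigma> A)"
proof -
  \<comment> \<open>Only finitely many variables are free in \<open>A\<close>, so
    \<open>\<sigma>\<close> may be replaced by the finite tuple of its values below
    \<open>n\<close>, to which \<open>prv_insts\<close> applies.\<close>
  obtain n where n: "ifv A \<subseteq> {..<n}" 
    using finite_ifv[of A] by (auto simp: finite_nat_set_iff_bounded)
  let ?ts = "map \<sigma> [0..<n]"
  have "prv T {} ((IAll ^^ k) A)" for k
    by (induction k) (auto intro: assms(1) prv_allI)
  then have "prv T {} (isubst (inst ?ts) A)"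
    by (intro prv_insts) (auto intro: assms(2))
  moreover have "isubst (inst ?ts) A = isubst \<sigma> A"
    using n by (intro isubst_cong) (auto simp: inst_def)
  ultimately show ?thesis by simp
qed

text \<open>The finitely many hypotheses in use are discharged into one implication, which is
  provable outright, and reinstated after the substitution.\<close>

lemma prv_subst:
  assumes "prv T S A" "\<And>i. wft (\<sigma> i)" shows "prv T (isubst \<sigma> ` S) (isubst \<sigma> A)"
proof -
  obtain \<Gamma> where \<Gamma>: "set \<Gamma> \<subseteq> S" "il_prov T \<Gamma> A"
    using assms(1) by (auto simp: prv_def)
  have "prv T (set \<Gamma> \<union> {}) A" "\<forall>B\<in>set \<Gamma>. wff B"
    using \<Gamma> il_prov_wf[OF wf_theory] by (auto intro: il_prv)
  from prv_closed_subst[OF prv_impsI[OF this] assms(2)]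
  have "prv T {} (imps (map (isubst \<sigma>) \<Gamma>) (isubst \<sigma> A))"
    by (simp add: isubst_imps)
  from prv_impsE[OF this] show ?thesis
    by (rule prv_mono) (use \<Gamma>(1) in auto)
qed

end

section \<open>Equality as a congruence, and replacement of tuples of equals\<close>

section \<open>Provable equality\<close>

locale omega_theory = il_wf T for T :: "('f, 'p) il_theory" +
  assumes ax_A1: "A1 (star_theory T)"
begin

lemma omega_ax: "(\<Gamma>, A) \<in> omega_axs (lang T) \<Longrightarrow> il_prov T \<Gamma> A"
proof -
  assume "(\<Gamma>, A) \<in> omega_axs (lang T)"
  then have "(map (Bang \<circ> star) \<Gamma>, star A) \<in> axs (AL_omega (lang T))"
    by (force simp: AL_omega_def IL_omega_def star_theory_def)
  then have "al_prov (star_theory T) (map (Bang \<circ> star) \<Gamma>) (star A)"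
    using ax_A1 by (auto simp: A1_def)
  from al_prov_forget[OF this] show ?thesis by (simp add: o_def)
qed

lemma funs_omega [simp]:
  "funs (lang T) FAp = Some (Suc (Suc 0))" "funs (lang T) FK = Some 0" "funs (lang T) FS = Some 0"
  and preds_PEq [simp]: "preds (lang T) PEq = Some (Suc (Suc 0))"
proof -
  let ?L = "omega_lang :: ('f, 'p) lang"
  have "funs ?L \<subseteq>\<^sub>m funs (lang T)" "preds ?L \<subseteq>\<^sub>m preds (lang T)"
    using ax_A1 by (auto simp: A1_def lang_le_def)
  moreover have "funs ?L FAp = Some (Suc (Suc 0))" "funs ?L FK = Some 0"
    "funs ?L FS = Some 0" "preds ?L PEq = Some (Suc (Suc 0))"
    by (simp_all add: omega_lang_def)
  ultimately show "funs (lang T) FAp = Some (Suc (Suc 0))" "funs (lang T) FK = Some 0"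
    "funs (lang T) FS = Some 0" "preds (lang T) PEq = Some (Suc (Suc 0))"
    by (metis domI map_le_def)+
qed

lemma wft_apps [simp]: "wft (apps t ss) \<longleftrightarrow> wft t \<and> (\<forall>s\<in>set ss. wft s)"
  by (induction ss arbitrary: t) (auto simp: apps_def)

text \<open>Provable without hypotheses, so it is available in the presence of every
  \<open>S\<close>. Abstracted combinatory terms reach their intended values only in this sense, not
  syntactically.\<close>

definition eqv :: "'f tm \<Rightarrow> 'f tm \<Rightarrow> bool" where
  "eqv s t \<longleftrightarrow> wft s \<and> wft t \<and> prv T {} (ieq s t)"

lemma eqv_repl:
  assumes "eqv s t" "wff A" shows "prv T {isubst (inst [s]) A} (isubst (inst [t]) A)"
proof -
  have "prv T {ieq s t, isubst (inst [s]) A} (isubst (inst [t]) A)"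
    using assms by (intro il_prv[OF omega_ax[OF eq_repl]]) (auto simp: eqv_def)
  then show ?thesis
    using assms(1) prv_cut[of _ "ieq s t"] by (metis empty_subsetI eqv_def prv_mono)
qed

lemma eqv_refl [simp]: "wft t \<Longrightarrow> eqv t t"
proof -
  assume t: "wft t"
  have "prv T {} (isubst (inst [t]) (ieq (Var 0) (Var 0)))"
    using t by (intro prv_closed_subst il_prv[OF omega_ax[OF omega_axs.eq_refl]] twf_inst) auto
  then show ?thesis using t by (simp add: eqv_def inst_def)
qed

lemma tsubst_inst1_tshift [simp]: "tsubst (inst [s]) (tshift (Suc 0) t) = t"
  by (simp add: inst_scons tsubst_scons_tshift)

lemma eqv_cong:
  assumes "eqv s t" "wft u"
  shows "eqv (tsubst (inst [s]) u) (tsubst (inst [t]) u)"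
proof -
  \<comment> \<open>The shift freezes the left side at the instance by \<open>s\<close>; replacement
    then rewrites only the right side, starting from reflexivity.\<close>
  let ?A = "ieq (tshift 1 (tsubst (inst [s]) u)) u"
  have wf: "wft s" "wft t" using assms by (auto simp: eqv_def)
  have w: "wft (tsubst (inst [s]) u)" "wft (tsubst (inst [t]) u)"
    using wf assms by (auto intro!: twf_tsubst twf_inst)
  have "prv T {isubst (inst [s]) ?A} (isubst (inst [t]) ?A)"
    using w assms by (intro eqv_repl) auto
  moreover have "prv T {} (isubst (inst [s]) ?A)"
    using eqv_refl[OF w(1)] by (simp add: eqv_def)
  ultimately have "prv T {} (isubst (inst [t]) ?A)" by (metis prv_cut1)
  then show ?thesis using w by (simp add: eqv_def)
qed

lemma eqv_sym: assumes "eqv s t" shows "eqv t s"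
proof -
  have wf: "wft s" "wft t" using assms by (auto simp: eqv_def)
  let ?A = "ieq (Var 0) (tshift 1 s)"
  have "prv T {isubst (inst [s]) ?A} (isubst (inst [t]) ?A)"
    using wf assms by (intro eqv_repl) auto
  moreover have "prv T {} (isubst (inst [s]) ?A)"
    using eqv_refl[OF wf(1)] by (simp add: eqv_def inst_def)
  ultimately have "prv T {} (isubst (inst [t]) ?A)" by (metis prv_cut1)
  then show ?thesis using wf by (simp add: eqv_def inst_def)
qed

lemma eqv_trans [trans]: assumes "eqv s t" "eqv t u" shows "eqv s u"
proof -
  have wf: "wft s" "wft t" "wft u" using assms by (auto simp: eqv_def)
  let ?A = "ieq (tshift 1 s) (Var 0)"
  have "prv T {isubst (inst [t]) ?A} (isubst (inst [u]) ?A)"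
    using wf assms by (intro eqv_repl) auto
  moreover have "prv T {} (isubst (inst [t]) ?A)"
    using assms by (simp add: eqv_def inst_def)
  ultimately have "prv T {} (isubst (inst [u]) ?A)" by (metis prv_cut1)
  then show ?thesis using wf by (simp add: eqv_def inst_def)
qed

lemma eqv_Ap: assumes "eqv s s'" "eqv t t'" shows "eqv (s \<cdot> t) (s' \<cdot> t')"
proof -
  have wf: "wft s" "wft t" "wft s'" "wft t'" using assms by (auto simp: eqv_def)
  have "eqv (s \<cdot> t) (s' \<cdot> t)"
    using eqv_cong[OF assms(1), of "Var 0 \<cdot> tshift 1 t"] wf by (simp add: inst_def)
  also have "eqv (s' \<cdot> t) (s' \<cdot> t')"
    using eqv_cong[OF assms(2), of "tshift 1 s' \<cdot> Var 0"] wf by (simp add: inst_def)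
  finally show ?thesis .
qed

text \<open>The axiom replaces a single term, so the tuple is treated one position at a time;
  \<open>us\<close> collects the positions already replaced.\<close>

lemma prv_eqv_scons:
  assumes "list_all2 eqv ss ts" "wff A" "\<forall>u\<in>set us. wft u"
  shows "prv T {isubst (scons (us @ ss) Var) A} (isubst (scons (us @ ts) Var) A)"
  using assms(1,3)
proof (induction ss ts arbitrary: us rule: list_all2_induct)
  case Nil
  then show ?case using assms(2) by (auto intro!: prv_hyp iwf_isubst twf_scons)
next
  case (Cons s ss t ts)
  have wf: "wft s" "wft t" "\<forall>u\<in>set ss. wft u"
    using Cons(1,2) by (auto simp: eqv_def list_all2_conv_all_nth in_set_conv_nth)
  \<comment> \<open>Variable 0 marks the position being replaced, and everything else is shifted
    past it; instantiating it by \<open>s\<close> or by \<open>t\<close> gives the two formulas to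
    be compared.\<close>
  let ?\<theta> = "scons (map (tshift 1) us @ Var 0 # map (tshift 1) ss) (\<lambda>i. Var (i + 1))"
  have *: "isubst (inst [r]) (isubst ?\<theta> A) = isubst (scons (us @ r # ss) Var) A" for r
  proof -
    have "tsubst (inst [r]) (?\<theta> i) = scons (us @ r # ss) Var i" for i
      by (cases "i - length us") (auto simp: scons_def nth_append nth_Cons inst_scons
          tsubst_scons_tshift[of "[r]" 1, simplified])
    then show ?thesis by (simp add: isubst_isubst)
  qed
  have "wff (isubst ?\<theta> A)"
    using assms(2) wf Cons.prems by (auto intro!: iwf_isubst twf_scons)
  from eqv_repl[OF Cons(1) this]
  have "prv T {isubst (scons (us @ s # ss) Var) A} (isubst (scons (us @ t # ss) Var) A)"
    by (simp only: *)
  moreover have "prv T {isubst (scons ((us @ [t]) @ ss) Var) A} (isubst (scons ((us @ [t]) @ ts) Var) A)"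
    using wf Cons.prems by (intro Cons.IH) auto
  ultimately show ?case by (simp add: prv_cut1)
qed

lemma eqv_K: assumes "wft s" "wft t" shows "eqv (cK \<cdot> s \<cdot> t) s"
proof -
  have "prv T {} (isubst (inst [s, t]) (ieq (cK \<cdot> Var 0 \<cdot> Var 1) (Var 0)))"
    using assms by (intro prv_closed_subst il_prv[OF omega_ax[OF def_K]] twf_inst) auto
  then show ?thesis using assms by (simp add: eqv_def inst_def)
qed

lemma eqv_S: assumes "wft s" "wft t" "wft u" shows "eqv (cS \<cdot> s \<cdot> t \<cdot> u) (s \<cdot> u \<cdot> (t \<cdot> u))"
proof -
  let ?A = "ieq (cS \<cdot> Var 0 \<cdot> Var 1 \<cdot> Var 2) (Var 0 \<cdot> Var 2 \<cdot> (Var 1 \<cdot> Var 2))"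
  have "prv T {} (isubst (inst [s, t, u]) ?A)"
    using assms by (intro prv_closed_subst il_prv[OF omega_ax[OF def_S]] twf_inst) auto
  then show ?thesis using assms by (simp add: eqv_def inst_def)
qed

end

section \<open>Tuples: curried types and componentwise application\<close>

section \<open>Tuples of terms\<close>

lemma arr_append: "arr (\<rho>s @ \<sigma>s) \<tau> = arr \<rho>s (arr \<sigma>s \<tau>)"
  by (simp add: arr_def)

lemma arr_Nil [simp]: "arr [] \<tau> = \<tau>"
  by (simp add: arr_def)

lemma length_arrs [simp]: "length (arrs \<rho>s \<tau>s) = length \<tau>s"
  by (simp add: arrs_def)

lemma arrs_arrs: "arrs \<rho>s (arrs \<sigma>s \<tau>s) = arrs (\<rho>s @ \<sigma>s) \<tau>s"
  by (simp add: arrs_def arr_append)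

lemma arrs_append: "arrs \<rho>s (\<sigma>s @ \<tau>s) = arrs \<rho>s \<sigma>s @ arrs \<rho>s \<tau>s"
  by (simp add: arrs_def)

lemma arrs_Nil [simp]: "arrs [] \<tau>s = \<tau>s" "arrs \<tau>s [] = []"
  by (simp_all add: arrs_def map_idI)

lemma apps_append: "apps t (xs @ ys) = apps (apps t xs) ys"
  by (simp add: apps_def)

lemma apps_Nil [simp]: "apps t [] = t"
  by (simp add: apps_def)

lemma length_appt [simp]: "length (appt ts ss) = length ts"
  by (simp add: appt_def)

lemma appt_appt: "appt (appt ts xs) ys = appt ts (xs @ ys)"
  by (simp add: appt_def apps_append)

lemma appt_append: "appt (ss @ ts) xs = appt ss xs @ appt ts xs"
  by (simp add: appt_def)

lemma appt_Nil [simp]: "appt ts [] = ts" "appt [] xs = []"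
  by (simp_all add: appt_def map_idI)

lemma tsubst_apps: "tsubst \<sigma> (apps t ss) = apps (tsubst \<sigma> t) (map (tsubst \<sigma>) ss)"
  by (induction ss arbitrary: t) (auto simp: apps_def)

lemma map_tsubst_appt:
  "map (tsubst \<sigma>) (appt ts ss) = appt (map (tsubst \<sigma>) ts) (map (tsubst \<sigma>) ss)"
  by (simp add: appt_def tsubst_apps)

lemma map_tshift_appt:
  "map (tshift n) (appt ts ss) = appt (map (tshift n) ts) (map (tshift n) ss)"
  unfolding tshift_def by (rule map_tsubst_appt)

lemma list_all2_choice:
  "\<forall>x\<in>set xs. \<exists>y. P x y \<Longrightarrow> \<exists>ys. list_all2 P xs ys"
proof (induction xs)
  case (Cons x xs)
  then obtain y ys where "P x y" "list_all2 P xs ys" by auto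
  then show ?case by (intro exI[of _ "y # ys"]) simp
qed (auto intro: exI[of _ "[]"])

section \<open>Terms in \<open>W\<close>, combinatory abstraction, definable functions on
  tuples\<close>

section \<open>Combinatory completeness\<close>

lemma map2_conv_nth: "length xs = length ys \<Longrightarrow>
    map2 f xs ys = map (\<lambda>i. f (xs ! i) (ys ! i)) [0..<length xs]"
  by (rule nth_equalityI) simp_all

lemma aW_bullet: "aW (bullet Q) \<tau> t = star (iW Q \<tau> t)"
  by (simp add: aW_def iW_def bullet_def star_isubst)

lemma forget_aconj: "forget (aconj As) = iconj (map forget As)"
  by (induction As) (auto simp: aconj_def iconj_def)

lemma forget_aWs: "forget (aWs (bullet Q) \<tau>s ts) = iWs Q \<tau>s ts"
  by (simp add: aWs_def iWs_def forget_aconj aW_bullet o_def case_prod_unfold)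

lemma map_forget_bangW: "map forget (bangW (bullet Q) \<tau>s ts) = map2 (iW Q) \<tau>s ts"
  by (simp add: bangW_def aW_bullet o_def case_prod_unfold)

lemma bangW_bullet: "bangW (bullet Q) \<tau>s ts = map (\<lambda>B. Bang (star B)) (map2 (iW Q) \<tau>s ts)"
  by (simp add: bangW_def aW_bullet o_def case_prod_unfold)

locale W_theory = omega_theory It for It :: "('f, 'p) il_theory" +
  fixes Is :: "('f, 'p) il_theory" and Q :: "('f, 'p) il_params"
  assumes params: "il_params_in Is It Q"
    and ax_A4: "A4 (star_theory Is) (star_theory It) (bullet Q)"
    and inhabited: "W_inhabited It Q"
begin

lemma wff_iW [simp]: "wft t \<Longrightarrow> wff (iW Q \<tau> t)"
  using params unfolding iW_def il_params_in_def by (intro iwf_isubst twf_inst) auto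

lemma isubst_iW [simp]: "isubst \<sigma> (iW Q \<tau> t) = iW Q \<tau> (tsubst \<sigma> t)"
proof -
  have "ifv (W Q \<tau>) \<subseteq> {0}" using params by (auto simp: il_params_in_def)
  then show ?thesis unfolding iW_def isubst_isubst
    by (intro isubst_cong) (auto simp: inst_def)
qed

lemma ishift_iW [simp]: "ishift n (iW Q \<tau> t) = iW Q \<tau> (tshift n t)"
  by (simp add: ishift_def tshift_def)

text \<open>Arguments of realizers are open terms whose membership in \<open>W\<close> may rest on
  \<open>S\<close>. Realizers are closed and in \<open>W\<close> outright, which is
  \<open>Wt\<close>; closedness makes them invariant under every substitution and shift.\<close>

definition Wp :: "('f, 'p) ifm set \<Rightarrow> ty list \<Rightarrow> 'f tm list \<Rightarrow> bool" where
  "Wp S \<tau>s ts \<longleftrightarrow> list_all2 (\<lambda>\<tau> t. wft t \<and> prv It S (iW Q \<tau> t)) \<tau>s ts"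

definition Wt :: "ty list \<Rightarrow> 'f tm list \<Rightarrow> bool" where
  "Wt \<tau>s ts \<longleftrightarrow> list_all2 (\<lambda>\<tau> t. closed_term (lang It) t \<and> prv It {} (iW Q \<tau> t)) \<tau>s ts"

lemma Wt_length: "Wt \<tau>s ts \<Longrightarrow> length ts = length \<tau>s"
  by (simp add: Wt_def list_all2_lengthD)

lemma Wt_closed: "Wt \<tau>s ts \<Longrightarrow> \<forall>t\<in>set ts. closed_term (lang It) t"
  by (auto simp: Wt_def list_all2_conv_all_nth in_set_conv_nth)

lemma Wt_wft: "Wt \<tau>s ts \<Longrightarrow> \<forall>t\<in>set ts. wft t"
  using Wt_closed by (auto simp: closed_term_def)

lemma Wt_tsubst: "Wt \<tau>s ts \<Longrightarrow> map (tsubst \<sigma>) ts = ts"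
  using Wt_closed by (auto simp: closed_term_def intro!: map_idI tsubst_closed)

lemma Wt_tshift: "Wt \<tau>s ts \<Longrightarrow> map (tshift n) ts = ts"
  unfolding tshift_def by (rule Wt_tsubst)

lemma Wt_append: "length ss = length \<sigma>s \<Longrightarrow>
    Wt (\<sigma>s @ \<tau>s) (ss @ ts) \<longleftrightarrow> Wt \<sigma>s ss \<and> Wt \<tau>s ts"
  by (simp add: Wt_def list_all2_append)

lemma Wt_appendE:
  assumes "Wt (\<sigma>s @ \<tau>s) rs"
  obtains ss ts where "rs = ss @ ts" "Wt \<sigma>s ss" "Wt \<tau>s ts"
  using assms by (auto simp: Wt_def list_all2_append1)

lemma Wp_append: "length ss = length \<sigma>s \<Longrightarrow>
    Wp S (\<sigma>s @ \<tau>s) (ss @ ts) \<longleftrightarrow> Wp S \<sigma>s ss \<and> Wp S \<tau>s ts"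
  by (simp add: Wp_def list_all2_append)

lemma Wp_length: "Wp S \<tau>s ts \<Longrightarrow> length ts = length \<tau>s"
  by (simp add: Wp_def list_all2_lengthD)

lemma Wp_wft: "Wp S \<tau>s ts \<Longrightarrow> \<forall>t\<in>set ts. wft t"
  by (auto simp: Wp_def list_all2_conv_all_nth in_set_conv_nth)

lemma Wp_mono: "Wp S \<tau>s ts \<Longrightarrow> S \<subseteq> S' \<Longrightarrow> Wp S' \<tau>s ts"
  by (auto simp: Wp_def elim!: list_all2_mono intro: prv_mono)

lemma Wp_hyp:
  "length ts = length \<tau>s \<Longrightarrow> \<forall>t\<in>set ts. wft t \<Longrightarrow> set (map2 (iW Q) \<tau>s ts) \<subseteq> S \<Longrightarrow> Wp S \<tau>s ts"
  by (auto simp: Wp_def list_all2_conv_all_nth map2_conv_nth intro!: prv_hyp)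

lemma Wp_prv: "Wp S \<tau>s ts \<Longrightarrow> B \<in> set (map2 (iW Q) \<tau>s ts) \<Longrightarrow> prv It S B"
  by (auto simp: Wp_def list_all2_conv_all_nth map2_conv_nth)

lemma wff_Ws: "\<forall>t\<in>set ts. wft t \<Longrightarrow> \<forall>B\<in>set (map2 (iW Q) \<tau>s ts). wff B"
  by (auto dest: set_zip_rightD)

lemma il_iWs_iff:
  assumes "length ts = length \<tau>s" "\<forall>t\<in>set ts. closed_term (lang It) t"
  shows "il_prov It [] (iWs Q \<tau>s ts) \<longleftrightarrow> Wt \<tau>s ts"
proof -
  have "\<forall>t\<in>set ts. wft t" using assms by (auto simp: closed_term_def)
  then have "\<forall>A\<in>set (map2 (iW Q) \<tau>s ts). wff A" by (rule wff_Ws)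
  then have "prv It {} (iWs Q \<tau>s ts) \<longleftrightarrow> (\<forall>A\<in>set (map2 (iW Q) \<tau>s ts). prv It {} A)"
    unfolding iWs_def by (rule prv_iconj)
  moreover have "il_prov It [] A \<longleftrightarrow> prv It {} A" for A
    using prv_il[of "[]" A] by (auto intro: il_prv)
  moreover have "(\<forall>A\<in>set (map2 (iW Q) \<tau>s ts). prv It {} A) \<longleftrightarrow> Wt \<tau>s ts"
    using assms by (auto simp: Wt_def list_all2_conv_all_nth map2_conv_nth)
  ultimately show ?thesis by blast
qed

lemma W_terms_Wt: "W_terms (star_theory It) (bullet Q) \<tau>s ts \<Longrightarrow> Wt \<tau>s ts"
  using il_iWs_iff al_prov_forget[of It "[]"] by (fastforce simp: W_terms_def forget_aWs)

lemma ex_Wt: "\<exists>ts. Wt \<tau>s ts"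
proof -
  have *: "\<exists>t. closed_term (lang It) t \<and> prv It {} (iW Q \<tau> t)" for \<tau>
  proof -
    obtain t where "closed_term (lang It) t" "il_prov It [] (iW Q \<tau> t)"
      using inhabited unfolding W_inhabited_def by blast
    then show ?thesis using il_prv[of "[]"] by auto
  qed
  then have "\<forall>\<tau>\<in>set \<tau>s. \<exists>t. closed_term (lang It) t \<and> prv It {} (iW Q \<tau> t)"
    by blast
  from list_all2_choice[OF this] show ?thesis by (simp add: Wt_def)
qed

lemma W_app:
  assumes "prv It S (iW Q (\<tau> \<rightarrow>\<^sub>t \<rho>) f)" "prv It S (iW Q \<tau> t)" "wft f" "wft t"
  shows "prv It S (iW Q \<rho> (f \<cdot> t))"
proof -
  have "al_prov (star_theory It)
      [aW (bullet Q) \<tau> (Var 0), aW (bullet Q) (\<tau> \<rightarrow>\<^sub>t \<rho>) (Var 1)] (aW (bullet Q) \<rho> (Var 1 \<cdot> Var 0))"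
    using ax_A4 by (simp add: A4_def)
  from al_prov_forget[OF this]
  have "prv It {iW Q \<tau> (Var 0), iW Q (\<tau> \<rightarrow>\<^sub>t \<rho>) (Var 1)} (iW Q \<rho> (Var 1 \<cdot> Var 0))"
    by (intro il_prv) (auto simp: aW_bullet)
  from prv_subst[OF this, of "inst [t, f]"]
  have "prv It {iW Q \<tau> t, iW Q (\<tau> \<rightarrow>\<^sub>t \<rho>) f} (iW Q \<rho> (f \<cdot> t))"
    using assms by (auto simp: twf_inst inst_def[of _ 0] inst_def[of _ "Suc 0"])
  then show ?thesis by (rule prv_cuts) (use assms in auto)
qed

text \<open>A typing of open applicative terms from which \<open>W\<close> follows
  (\<open>wt_W\<close>). Any closed term provably in \<open>W\<close> at a type counts as a constant
  of that type, so the terms supplied by \<open>A5\<close>, inhabitants of \<open>W\<close> and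
  realizers found earlier all serve as building blocks beside the combinators.\<close>

inductive wt :: "ty list \<Rightarrow> 'f tm \<Rightarrow> ty \<Rightarrow> bool" for \<rho>s where
  wt_var: "i < length \<rho>s \<Longrightarrow> wt \<rho>s (Var i) (\<rho>s ! i)"
| wt_con: "closed_term (lang It) c \<Longrightarrow> prv It {} (iW Q \<tau> c) \<Longrightarrow> wt \<rho>s c \<tau>"
| wt_app: "wt \<rho>s s (\<sigma> \<rightarrow>\<^sub>t \<tau>) \<Longrightarrow> wt \<rho>s t \<sigma> \<Longrightarrow> wt \<rho>s (s \<cdot> t) \<tau>"

lemma wt_wft: "wt \<rho>s t \<tau> \<Longrightarrow> wft t \<and> tfv t \<subseteq> {..<length \<rho>s}"
  by (induction rule: wt.induct) (auto simp: closed_term_def)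

lemma wt_inst_wft: "wt \<rho>s t \<tau> \<Longrightarrow> \<forall>u\<in>set us. wft u \<Longrightarrow> wft (tsubst (inst us) t)"
  by (intro twf_tsubst twf_inst) (auto dest: wt_wft)

lemma wt_W:
  assumes "wt \<rho>s t \<tau>" "Wp S \<rho>s us" shows "prv It S (iW Q \<tau> (tsubst (inst us) t))"
  using assms
proof (induction rule: wt.induct)
  case (wt_var i)
  then show ?case by (auto simp: Wp_def list_all2_conv_all_nth inst_def)
next
  case (wt_con c \<tau>)
  then show ?case by (auto simp: closed_term_def tsubst_closed intro: prv_mono)
next
  case (wt_app s \<sigma> \<tau> t)
  then show ?case
    using wt_inst_wft[OF _ Wp_wft[OF wt_app.prems]] by (auto intro: W_app)
qed

lemma wt_K: "wt \<rho>s cK (\<sigma> \<rightarrow>\<^sub>t \<tau> \<rightarrow>\<^sub>t \<sigma>)"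
proof -
  have "al_prov (star_theory It) [] (aW (bullet Q) (\<sigma> \<rightarrow>\<^sub>t \<tau> \<rightarrow>\<^sub>t \<sigma>) cK)"
    using ax_A4 by (simp add: A4_def)
  from al_prov_forget[OF this] have "prv It {} (iW Q (\<sigma> \<rightarrow>\<^sub>t \<tau> \<rightarrow>\<^sub>t \<sigma>) cK)"
    by (intro il_prv) (auto simp: aW_bullet)
  then show ?thesis by (intro wt_con) (auto simp: closed_term_def)
qed

lemma wt_S: "wt \<rho>s cS ((\<rho> \<rightarrow>\<^sub>t \<sigma> \<rightarrow>\<^sub>t \<tau>) \<rightarrow>\<^sub>t (\<rho> \<rightarrow>\<^sub>t \<sigma>) \<rightarrow>\<^sub>t \<rho> \<rightarrow>\<^sub>t \<tau>)"
proof -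
  have "al_prov (star_theory It) []
      (aW (bullet Q) ((\<rho> \<rightarrow>\<^sub>t \<sigma> \<rightarrow>\<^sub>t \<tau>) \<rightarrow>\<^sub>t (\<rho> \<rightarrow>\<^sub>t \<sigma>) \<rightarrow>\<^sub>t \<rho> \<rightarrow>\<^sub>t \<tau>) cS)"
    using ax_A4 by (simp add: A4_def)
  from al_prov_forget[OF this]
  have "prv It {} (iW Q ((\<rho> \<rightarrow>\<^sub>t \<sigma> \<rightarrow>\<^sub>t \<tau>) \<rightarrow>\<^sub>t (\<rho> \<rightarrow>\<^sub>t \<sigma>) \<rightarrow>\<^sub>t \<rho> \<rightarrow>\<^sub>t \<tau>) cS)"
    by (intro il_prv) (auto simp: aW_bullet)
  then show ?thesis by (intro wt_con) (auto simp: closed_term_def)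
qed

lemma wt_abs_const:
  assumes "wt \<rho>s t \<tau>"
  shows "wt \<rho>s (cK \<cdot> t) (\<rho> \<rightarrow>\<^sub>t \<tau>)"
    and "\<forall>u\<in>set us. wft u \<Longrightarrow> wft u \<Longrightarrow> eqv (tsubst (inst us) (cK \<cdot> t) \<cdot> u) (tsubst (inst us) t)"
  using wt_app[OF wt_K assms] wt_inst_wft[OF assms] by (simp_all add: eqv_K)

text \<open>Abstracting the last variable of the context leaves the other indices unchanged.\<close>

lemma wt_abs:
  assumes "wt (\<rho>s @ [\<rho>]) t \<tau>"
  shows "\<exists>t'. wt \<rho>s t' (\<rho> \<rightarrow>\<^sub>t \<tau>) \<and> (\<forall>us u. length us = length \<rho>s \<longrightarrow> (\<forall>v\<in>set us. wft v) \<longrightarrow>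
           wft u \<longrightarrow> eqv (tsubst (inst us) t' \<cdot> u) (tsubst (inst (us @ [u])) t))"
  using assms
proof (induction rule: wt.induct)
  case (wt_var i)
  show ?case
  proof (cases "i < length \<rho>s")
    case True
    then have *: "wt \<rho>s (Var i) ((\<rho>s @ [\<rho>]) ! i)"
      using wt.wt_var[of i \<rho>s] by (simp add: nth_append)
    have "tsubst (inst (us @ [u])) (Var i) = tsubst (inst us) (Var i)"
      if "length us = length \<rho>s" for us and u :: "'f tm"
      using that True by (simp add: inst_def nth_append)
    then show ?thesis
      using wt_abs_const[OF *] by (intro exI[of _ "cK \<cdot> Var i"]) metis
  next
    case False
    let ?I = "cS \<cdot> cK \<cdot> cK"
    have "wt \<rho>s ?I (\<rho> \<rightarrow>\<^sub>t \<rho>)"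
      by (rule wt_app[OF wt_app[OF wt_S wt_K] wt_K[of _ _ \<rho>]])
    moreover have "eqv (?I \<cdot> u) u" if "wft u" for u
    proof -
      have "eqv (?I \<cdot> u) (cK \<cdot> u \<cdot> (cK \<cdot> u))" using that by (intro eqv_S) auto
      also have "eqv (cK \<cdot> u \<cdot> (cK \<cdot> u)) u" using that by (intro eqv_K) auto
      finally show ?thesis .
    qed
    moreover have "i = length \<rho>s" using False wt_var by auto
    ultimately show ?thesis by (intro exI[of _ ?I]) (auto simp: inst_def nth_append)
  qed
next
  case (wt_con c \<tau>)
  then have *: "wt \<rho>s c \<tau>" by (rule wt.wt_con)
  have "tsubst (inst us) c = c" for us
    using wt_con by (simp add: closed_term_def tsubst_closed)
  then show ?case
    using wt_abs_const[OF *] by (intro exI[of _ "cK \<cdot> c"]) metis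
next
  case (wt_app s \<sigma> \<tau> t)
  then obtain s' t' where s': "wt \<rho>s s' (\<rho> \<rightarrow>\<^sub>t \<sigma> \<rightarrow>\<^sub>t \<tau>)" "\<And>us u. length us = length \<rho>s \<Longrightarrow>
      \<forall>v\<in>set us. wft v \<Longrightarrow>
       wft u \<Longrightarrow> eqv (tsubst (inst us) s' \<cdot> u) (tsubst (inst (us @ [u])) s)"
    and t': "wt \<rho>s t' (\<rho> \<rightarrow>\<^sub>t \<sigma>)" "\<And>us u. length us = length \<rho>s \<Longrightarrow> \<forall>v\<in>set us. wft v \<Longrightarrow>
       wft u \<Longrightarrow> eqv (tsubst (inst us) t' \<cdot> u) (tsubst (inst (us @ [u])) t)"
    by blast
  have "wt \<rho>s (cS \<cdot> s' \<cdot> t') (\<rho> \<rightarrow>\<^sub>t \<tau>)"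
    by (rule wt.wt_app[OF wt.wt_app[OF wt_S s'(1)] t'(1)])
  moreover have "eqv (tsubst (inst us) (cS \<cdot> s' \<cdot> t') \<cdot> u) (tsubst (inst (us @ [u])) (s \<cdot> t))"
    if "length us = length \<rho>s" "\<forall>v\<in>set us. wft v" "wft u" for us u
  proof -
    let ?s = "tsubst (inst us) s'" and ?t = "tsubst (inst us) t'"
    have "eqv (cS \<cdot> ?s \<cdot> ?t \<cdot> u) (?s \<cdot> u \<cdot> (?t \<cdot> u))"
      using that by (intro eqv_S wt_inst_wft[OF s'(1)] wt_inst_wft[OF t'(1)]) auto
    also have "eqv (?s \<cdot> u \<cdot> (?t \<cdot> u)) (tsubst (inst (us @ [u])) s \<cdot> tsubst (inst (us @ [u])) t)"
      using that by (intro eqv_Ap s' t') auto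
    finally show ?thesis by simp
  qed
  ultimately show ?case by blast
qed

text \<open>Variables are abstracted from the last to the first; over the empty context nothing is
  left free, so the result is closed and has the curried type.\<close>

lemma wt_abs_all:
  "wt \<rho>s t \<tau> \<Longrightarrow> \<exists>c. wt [] c (arr \<rho>s \<tau>) \<and> (\<forall>us. length us = length \<rho>s \<longrightarrow> (\<forall>v\<in>set us. wft v) \<longrightarrow>
     eqv (apps c us) (tsubst (inst us) t))"
proof (induction \<rho>s arbitrary: t \<tau> rule: rev_induct)
  case Nil
  then show ?case by (auto intro!: exI[of _ t] eqv_refl dest: wt_wft simp: inst_scons)
next
  case (snoc \<rho> \<rho>s)
  obtain t' where t': "wt \<rho>s t' (\<rho> \<rightarrow>\<^sub>t \<tau>)" "\<forall>us u. length us = length \<rho>s \<longrightarrow> (\<forall>v\<in>set us. wft v) \<longrightarrow>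
      wft u \<longrightarrow> eqv (tsubst (inst us) t' \<cdot> u) (tsubst (inst (us @ [u])) t)"
    using wt_abs[OF snoc.prems] by (elim exE conjE)
  obtain c where c: "wt [] c (arr \<rho>s (\<rho> \<rightarrow>\<^sub>t \<tau>))" "\<forall>us. length us = length \<rho>s \<longrightarrow>
      (\<forall>v\<in>set us. wft v) \<longrightarrow> eqv (apps c us) (tsubst (inst us) t')"
    using snoc.IH[OF t'(1)] by (elim exE conjE)
  have "eqv (apps c us) (tsubst (inst us) t)"
    if "length us = length (\<rho>s @ [\<rho>])" "\<forall>v\<in>set us. wft v" for us
  proof -
    have "us \<noteq> []" using that(1) by auto
    then obtain vs u where us: "us = vs @ [u]" by (metis append_butlast_last_id)
    then have len: "length vs = length \<rho>s" using that(1) by simp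
    have "apps c us = apps c vs \<cdot> u" by (simp add: us apps_def)
    also have "eqv (apps c vs \<cdot> u) (tsubst (inst vs) t' \<cdot> u)"
      using that us len c(2) by (intro eqv_Ap eqv_refl) auto
    also have "eqv (tsubst (inst vs) t' \<cdot> u) (tsubst (inst us) t)"
      using that us len t'(2) by auto
    finally show ?thesis .
  qed
  moreover have "arr (\<rho>s @ [\<rho>]) \<tau> = arr \<rho>s (\<rho> \<rightarrow>\<^sub>t \<tau>)" by (simp add: arr_def)
  ultimately show ?case using c(1) by auto
qed

text \<open>Lets a realizer be written as a function on tuples in the metalogic. The equation is
  syntactic and required only for tuples of the right length; abstraction is postponed to
  \<open>definable_realize\<close>, so the closure lemmas need no equational reasoning.\<close>

definition definable :: "ty list \<Rightarrow> ty list \<Rightarrow> ('f tm list \<Rightarrow> 'f tm list) \<Rightarrow> bool" where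
  "definable \<rho>s \<tau>s F \<longleftrightarrow> (\<exists>ts. list_all2 (wt \<rho>s) ts \<tau>s \<and>
     (\<forall>us. length us = length \<rho>s \<longrightarrow> F us = map (tsubst (inst us)) ts))"

lemma definable_length: "definable \<rho>s \<tau>s F \<Longrightarrow> length us = length \<rho>s \<Longrightarrow> length (F us) = length \<tau>s"
  by (auto simp: definable_def dest: list_all2_lengthD)

lemma definable_Wp:
  assumes "definable \<rho>s \<tau>s F" "Wp S \<rho>s us" shows "Wp S \<tau>s (F us)"
proof -
  obtain ts where ts: "list_all2 (wt \<rho>s) ts \<tau>s" "F us = map (tsubst (inst us)) ts"
    using assms Wp_length by (auto simp: definable_def)
  then show ?thesis
    using wt_W[OF _ assms(2)] wt_inst_wft Wp_wft[OF assms(2)]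
    by (auto simp: Wp_def list_all2_conv_all_nth)
qed

text \<open>Each component is abstracted separately. The syntactic equation of
  \<open>definable\<close> weakens here to provable equality.\<close>

lemma definable_realize:
  assumes "definable \<rho>s \<tau>s F"
  shows "\<exists>fs. Wt (arrs \<rho>s \<tau>s) fs \<and> (\<forall>us. length us = length \<rho>s \<longrightarrow> (\<forall>u\<in>set us. wft u) \<longrightarrow>
           list_all2 eqv (appt fs us) (F us))"
proof -
  obtain ts where ts: "list_all2 (wt \<rho>s) ts \<tau>s"
      "\<And>us. length us = length \<rho>s \<Longrightarrow> F us = map (tsubst (inst us)) ts"
    using assms by (auto simp: definable_def)
  have "\<forall>(t, \<tau>)\<in>set (zip ts \<tau>s). wt \<rho>s t \<tau>"
    using ts(1) by (auto simp: list_all2_iff)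
  then have "\<forall>p\<in>set (zip ts \<tau>s). \<exists>c. wt [] c (arr \<rho>s (snd p)) \<and> (\<forall>us. length us = length \<rho>s \<longrightarrow>
      (\<forall>v\<in>set us. wft v) \<longrightarrow>
     eqv (apps c us) (tsubst (inst us) (fst p)))"
    using wt_abs_all by fastforce
  from list_all2_choice[OF this] obtain cs where cs: "list_all2 (\<lambda>p c. wt [] c (arr \<rho>s (snd p)) \<and>
     (\<forall>us. length us = length \<rho>s \<longrightarrow> (\<forall>v\<in>set us. wft v) \<longrightarrow>
     eqv (apps c us) (tsubst (inst us) (fst p)))) (zip ts \<tau>s) cs"
    by blast
  have wt_nil: "closed_term (lang It) c \<and> prv It {} (iW Q \<tau> c)" if "wt [] c \<tau>" for c \<tau>
    using wt_wft[OF that] wt_W[OF that, of "{}" "[]"] by (auto simp: closed_term_def Wp_def inst_scons)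
  have "Wt (arrs \<rho>s \<tau>s) cs"
    using cs ts(1) wt_nil by (auto simp: Wt_def list_all2_conv_all_nth arrs_def)
  moreover have "list_all2 eqv (appt cs us) (F us)" if "length us = length \<rho>s" "\<forall>u\<in>set us. wft u" for us
    using cs ts that by (auto simp: list_all2_conv_all_nth appt_def)
  ultimately show ?thesis by blast
qed

lemma definable_const:
  assumes "Wt \<tau>s cs" shows "definable \<rho>s \<tau>s (\<lambda>us. cs)"
proof -
  have "list_all2 (wt \<rho>s) cs \<tau>s"
    using assms wt_con unfolding Wt_def list_all2_conv_all_nth by simp
  then show ?thesis
    unfolding definable_def using Wt_tsubst[OF assms] by (intro exI[of _ cs]) simp
qed

lemma definable_block:
  "definable (\<rho>s @ \<tau>s @ \<sigma>s) \<tau>s (\<lambda>us. take (length \<tau>s) (drop (length \<rho>s) us))"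
  unfolding definable_def
proof (intro exI conjI allI impI)
  let ?ts = "map Var [length \<rho>s..<length \<rho>s + length \<tau>s]"
  show "list_all2 (wt (\<rho>s @ \<tau>s @ \<sigma>s)) ?ts \<tau>s"
    unfolding list_all2_conv_all_nth
  proof (intro conjI allI impI)
    fix i assume "i < length ?ts"
    then show "wt (\<rho>s @ \<tau>s @ \<sigma>s) (?ts ! i) (\<tau>s ! i)"
      using wt_var[of "length \<rho>s + i" "\<rho>s @ \<tau>s @ \<sigma>s"] by (simp add: nth_append)
  qed simp
  show "take (length \<tau>s) (drop (length \<rho>s) us) = map (tsubst (inst us)) ?ts"
    if "length us = length (\<rho>s @ \<tau>s @ \<sigma>s)" for us :: "'f tm list"
    using that by (simp only: inst_scons map_scons_vars length_append)
qed

lemma wt_apps: "wt \<rho>s t (arr \<sigma>s \<tau>) \<Longrightarrow> list_all2 (wt \<rho>s) ss \<sigma>s \<Longrightarrow> wt \<rho>s (apps t ss) \<tau>"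
proof (induction \<sigma>s arbitrary: t ss)
  case (Cons \<sigma> \<sigma>s)
  then obtain s ss' where "ss = s # ss'" "wt \<rho>s s \<sigma>" "list_all2 (wt \<rho>s) ss' \<sigma>s"
    by (auto simp: list_all2_Cons2)
  moreover have "wt \<rho>s t (\<sigma> \<rightarrow>\<^sub>t arr \<sigma>s \<tau>)" using Cons.prems(1) by (simp add: arr_def)
  ultimately show ?case using Cons.IH[of "t \<cdot> s" ss'] by (auto simp: apps_def intro: wt_app)
qed auto

lemma definable_appt:
  assumes "definable \<rho>s (arrs \<sigma>s \<tau>s) F" "definable \<rho>s \<sigma>s G"
  shows "definable \<rho>s \<tau>s (\<lambda>us. appt (F us) (G us))"
proof -
  obtain fs where fs: "list_all2 (wt \<rho>s) fs (arrs \<sigma>s \<tau>s)"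
      "\<And>us. length us = length \<rho>s \<Longrightarrow> F us = map (tsubst (inst us)) fs"
    using assms(1) by (auto simp: definable_def)
  obtain gs where gs: "list_all2 (wt \<rho>s) gs \<sigma>s"
      "\<And>us. length us = length \<rho>s \<Longrightarrow> G us = map (tsubst (inst us)) gs"
    using assms(2) by (auto simp: definable_def)
  have len: "length fs = length \<tau>s" using fs(1) by (auto dest: list_all2_lengthD)
  have "wt \<rho>s (appt fs gs ! i) (\<tau>s ! i)" if "i < length \<tau>s" for i
    using fs(1) that len by (auto simp: appt_def arrs_def dest!: list_all2_nthD2[where p = i]
      intro: wt_apps[OF _ gs(1)])
  then have "list_all2 (wt \<rho>s) (appt fs gs) \<tau>s"
    using len by (intro list_all2_all_nthI) auto
  then show ?thesis unfolding definable_def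
    using fs(2) gs(2) by (intro exI[of _ "appt fs gs"]) (auto simp: map_tsubst_appt)
qed

lemma definable_append:
  assumes "definable \<rho>s \<sigma>s F" "definable \<rho>s \<tau>s G"
  shows "definable \<rho>s (\<sigma>s @ \<tau>s) (\<lambda>us. F us @ G us)"
proof -
  obtain fs where fs: "list_all2 (wt \<rho>s) fs \<sigma>s"
      "\<And>us. length us = length \<rho>s \<Longrightarrow> F us = map (tsubst (inst us)) fs"
    using assms(1) by (auto simp: definable_def)
  obtain gs where gs: "list_all2 (wt \<rho>s) gs \<tau>s"
      "\<And>us. length us = length \<rho>s \<Longrightarrow> G us = map (tsubst (inst us)) gs"
    using assms(2) by (auto simp: definable_def)
  show ?thesis unfolding definable_def
    using fs gs by (intro exI[of _ "fs @ gs"]) (simp add: list_all2_appendI)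
qed

end

section \<open>The interpretation of translated formulas: shape, substitution, replacement\<close>

section \<open>The interpretation on formulas of IL\<close>

lemma bullet_sel [simp]: "comp (bullet Q) = comp Q" "tau (bullet Q) = tau Q" "hat (bullet Q) = hat Q"
  "Pt (bullet Q) p = star (Pt Q p)" "BQ (bullet Q) \<tau>s as A = star (BQ Q \<tau>s as (forget A))"
  by (simp_all add: bullet_def)

lemma tpos_tneg_asubst: "tpos Q (asubst \<sigma> A) = tpos Q A \<and> tneg Q (asubst \<sigma> A) = tneg Q A"
  by (induction A arbitrary: \<sigma>) auto

lemmas tpos_asubst [simp] = tpos_tneg_asubst[THEN conjunct1]
  and tneg_asubst [simp] = tpos_tneg_asubst[THEN conjunct2]

lemma bpos_isubst [simp]: "bpos Q (isubst \<sigma> A) = bpos Q A"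
  and bneg_isubst [simp]: "bneg Q (isubst \<sigma> A) = bneg Q A"
  by (simp_all add: bpos_def bneg_def star_isubst)

lemma bpos_ishift [simp]: "bpos Q (ishift n A) = bpos Q A"
  and bneg_ishift [simp]: "bneg Q (ishift n A) = bneg Q A"
  by (simp_all add: ishift_def)

lemma bpos_simps [simp]:
  "bpos Q (IPred p ts) = (if p \<in> comp Q then [tau Q p] else [])"
  "bpos Q IBot = []"
  "bpos Q (IAnd A B) = bpos Q A @ bpos Q B"
  "bpos Q (IImp A B) =
     arrs (bpos Q A) (bpos Q B) @ arrs (bpos Q A) (arrs (bneg Q B) (hat Q (bneg Q A)))"
  "bpos Q (IAll A) = bpos Q A"
  "bpos Q (IEx A) = bpos Q A"
  by (simp_all add: bpos_def bneg_def)

lemma bneg_simps [simp]: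
  "bneg Q (IPred p ts) = []"
  "bneg Q IBot = []"
  "bneg Q (IAnd A B) = bneg Q A @ bneg Q B"
  "bneg Q (IImp A B) = bpos Q A @ bneg Q B"
  "bneg Q (IAll A) = bneg Q A"
  "bneg Q (IEx A) = hat Q (bneg Q A)"
  by (simp_all add: bpos_def bneg_def)

lemma interp_bang_star:
  "interp (bullet Q) (Bang (star A)) xs as = Bang (star (bounded_binterp Q A xs as))"
  by (simp add: bounded_binterp_def binterp_def bneg_def star_ishift Let_def)

lemma binterp_IPred:
  "binterp Q (IPred p ts) xs ys =
     (if p \<in> comp Q then isubst (inst (ts @ xs)) (Pt Q p) else IPred p ts)"
  by (simp add: binterp_def forget_asubst)

lemma binterp_IBot [simp]: "binterp Q IBot xs ys = IBot"
  by (simp add: binterp_def)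

lemma binterp_IAnd:
  "binterp Q (IAnd A B) xs ys =
     IAnd (binterp Q A (take (length (bpos Q A)) xs) (take (length (bneg Q A)) ys))
       (binterp Q B (drop (length (bpos Q A)) xs) (drop (length (bneg Q A)) ys))"
  by (simp add: binterp_def bpos_def bneg_def Let_def)

lemma binterp_IImp_take:
  "binterp Q (IImp A B) fgs xws =
     (let m = length (bpos Q A); n = length (bpos Q B) in
      IImp (bounded_binterp Q A (take m xws) (appt (drop n fgs) xws))
        (binterp Q B (appt (take n fgs) (take m xws)) (drop m xws)))"
  by (simp add: binterp_def interp_bang_star Let_def del: interp.simps(7))
    (simp add: bpos_def)

lemma binterp_IImp:
  assumes "length fs = length (bpos Q B)" "length xs = length (bpos Q A)"
  shows "binterp Q (IImp A B) (fs @ gs) (xs @ ws) =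
     IImp (bounded_binterp Q A xs (appt gs (xs @ ws))) (binterp Q B (appt fs xs) ws)"
  using assms by (simp add: binterp_IImp_take Let_def)

lemma binterp_IAll [simp]:
  "binterp Q (IAll A) xs ys = IAll (binterp Q A (map (tshift 1) xs) (map (tshift 1) ys))"
  by (simp add: binterp_def)

lemma binterp_IEx [simp]:
  "binterp Q (IEx A) xs as = IEx (bounded_binterp Q A (map (tshift 1) xs) (map (tshift 1) as))"
  by (simp add: binterp_def interp_bang_star del: interp.simps(7))

text \<open>The bangs match: \<open>star\<close> puts one exactly on antecedents of implications and
  on bodies of existentials, and there \<open>interp_bang_star\<close> produces the bang of a
  translated formula again.\<close>

lemma interp_star: "interp (bullet Q) (star A) xs ys = star (binterp Q A xs ys)"
proof (induction A arbitrary: xs ys)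
  case (IPred p ts)
  then show ?case by (simp add: binterp_IPred star_isubst)
next
  case (IAnd A B)
  then show ?case by (simp add: binterp_IAnd Let_def bpos_def bneg_def)
next
  case (IImp A B)
  then show ?case
    by (simp add: binterp_IImp_take Let_def interp_bang_star del: interp.simps(7)) (simp add: bpos_def)
next
  case (IEx A)
  then show ?case by (simp add: interp_bang_star del: interp.simps(7))
qed auto

lemma depth_star_ishift [simp]: "depth (star (ishift n A)) = depth (star A)"
  by (simp add: star_ishift)

locale source_target = W_theory It Is Q for It Is :: "('f, 'p) il_theory" and Q +
  assumes wf_source: "il_wf_theory Is"
    and ax_A2: "A2 (star_theory Is) (star_theory It) (bullet Q)"
    and ax_A5: "A5 (star_theory It) (bullet Q)
      (interp_fms (star_theory Is) (star_theory It) (bullet Q))"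
begin

abbreviation "wfs \<equiv> iwf (lang Is)"

abbreviation terms :: "nat \<Rightarrow> 'f tm list \<Rightarrow> bool" where
  "terms n ts \<equiv> terms_of (lang It) ts n"

abbreviation "pos_terms A xs \<equiv> terms (length (bpos Q A)) xs"
abbreviation "neg_terms A ys \<equiv> terms (length (bneg Q A)) ys"
abbreviation "bound_terms A as \<equiv> terms (length (hat Q (bneg Q A))) as"

lemma lang_source_le: "lang_le (lang Is) (lang It)"
  using ax_A2 by (simp add: A2_def)

lemma wfs_wff: "wfs A \<Longrightarrow> wff A"
  by (rule iwf_mono[OF lang_source_le])

lemma wfs_wft: "twf (lang Is) t \<Longrightarrow> wft t"
  using lang_source_le by (auto simp: lang_le_def intro: twf_mono)

lemma terms_tshift [simp]: "terms n (map (tshift k) ts) = terms n ts"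
  by (auto simp: terms_of_def)

lemma terms_vars [simp]: "terms n (map Var [a..<b]) \<longleftrightarrow> n = b - a"
  by (auto simp: terms_of_def)

lemma terms_appt: "terms n ts \<Longrightarrow> terms m ss \<Longrightarrow> terms n (appt ts ss)"
  by (auto simp: terms_of_def appt_def)

lemma terms_take_drop:
  "terms (m + n) ts \<Longrightarrow> terms m (take m ts)" "terms (m + n) ts \<Longrightarrow> terms n (drop m ts)"
  by (auto simp: terms_of_def dest: in_set_takeD in_set_dropD)

lemma Wt_terms: "Wt \<tau>s ts \<Longrightarrow> terms (length \<tau>s) ts"
  by (simp add: terms_of_def Wt_length Wt_wft)

lemma Wp_terms: "Wp S \<tau>s ts \<Longrightarrow> terms (length \<tau>s) ts"
  by (simp add: terms_of_def Wp_length Wp_wft)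

lemma BQ_subst:
  assumes "terms (length (hat Q \<tau>s)) as" "wff A" "\<And>i. wft (\<sigma> i)"
  shows "isubst \<sigma> (BQ Q \<tau>s as A) = BQ Q \<tau>s (map (tsubst \<sigma>) as) (isubst (ups (length \<tau>s) \<sigma>) A)"
  using params assms by (simp add: il_params_in_def terms_of_def)

lemma BQ_wff: "terms (length (hat Q \<tau>s)) as \<Longrightarrow> wff A \<Longrightarrow> wff (BQ Q \<tau>s as A)"
  using params by (simp add: il_params_in_def terms_of_def)

text \<open>The induction is on depth because \<open>bounded_binterp\<close> refers to a shifted
  copy of the subformula, which is not a structural subterm.\<close>

lemma binterp_wff:
  "wfs A \<Longrightarrow> pos_terms A xs \<Longrightarrow> neg_terms A ys \<Longrightarrow> wff (binterp Q A xs ys)"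
proof (induction "depth (star A)" arbitrary: A xs ys rule: less_induct)
  case less
  have bnd: "wff (bounded_binterp Q B xs as)"
    if "depth (star B) < depth (star A)" "wfs B" "pos_terms B xs"
      "bound_terms B as" for B xs as
    unfolding bounded_binterp_def Let_def
    using that by (intro BQ_wff less.hyps) auto
  show ?case
  proof (cases A)
    case (IPred p ts)
    have "wff (Pt Q p)" if "p \<in> comp Q"
      using that params less.prems(1) by (auto simp: IPred il_params_in_def)
    then show ?thesis using less.prems wfs_wff[OF less.prems(1)]
      by (auto simp: IPred binterp_IPred terms_of_def intro!: iwf_isubst twf_inst)
  next
    case (IAnd B C)
    then show ?thesis using less.prems
      by (auto simp: binterp_IAnd intro!: less.hyps terms_take_drop)
  next
    case (IImp B C)
    then show ?thesis using less.prems
      by (auto simp: binterp_IImp_take Let_def intro!: less.hyps bnd terms_appt dest: terms_take_drop)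
  qed (use less in \<open>auto intro!: bnd\<close>)
qed

lemma bounded_wff:
  assumes "wfs A" "pos_terms A xs" "bound_terms A as"
  shows "wff (bounded_binterp Q A xs as)"
  unfolding bounded_binterp_def Let_def using assms by (intro BQ_wff binterp_wff) auto

lemma tsubst_ups_vars: "map (tsubst (ups n \<sigma>)) (vars n) = vars n"
  by (auto simp: ups_def)

text \<open>Commutation for the body is a premise, so the step can be used both inside the induction
  of \<open>binterp_subst\<close>, with its induction hypothesis, and afterwards in
  \<open>bounded_subst\<close>.\<close>

lemma bounded_subst_step:
  fixes A :: "('f, 'p) ifm" and xs as :: "'f tm list"
  defines "n \<equiv> length (bneg Q A)"
  defines "B \<equiv> binterp Q (ishift n A) (map (tshift n) xs) (vars n)"
  assumes "bound_terms A as" "wff B" "\<And>i. wft (\<sigma> i)"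
    and "isubst (ups n \<sigma>) B = binterp Q (isubst (ups n \<sigma>) (ishift n A))
      (map (tsubst (ups n \<sigma>)) (map (tshift n) xs)) (map (tsubst (ups n \<sigma>)) (vars n))"
  shows "isubst \<sigma> (bounded_binterp Q A xs as) =
    bounded_binterp Q (isubst \<sigma> A) (map (tsubst \<sigma>) xs) (map (tsubst \<sigma>) as)"
  using assms(3-6) unfolding bounded_binterp_def Let_def n_def B_def
  by (simp only: BQ_subst isubst_ups_ishift map_tsubst_ups_tshift tsubst_ups_vars bneg_isubst)

text \<open>For a computational atom it rests on \<open>Pt\<close> having only the displayed free
  variables, for the bounded quantifier on the substitution convention in
  \<open>il_params_in\<close>.\<close>

lemma binterp_subst:
  "wfs A \<Longrightarrow> pos_terms A xs \<Longrightarrow> neg_terms A ys \<Longrightarrow> (\<And>i. wft (\<sigma> i)) \<Longrightarrow>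
    isubst \<sigma> (binterp Q A xs ys) = binterp Q (isubst \<sigma> A) (map (tsubst \<sigma>) xs) (map (tsubst \<sigma>) ys)"
proof (induction "depth (star A)" arbitrary: A xs ys \<sigma> rule: less_induct)
  case less
  have bnd: "isubst \<sigma> (bounded_binterp Q B xs as) =
      bounded_binterp Q (isubst \<sigma> B) (map (tsubst \<sigma>) xs) (map (tsubst \<sigma>) as)"
    if "depth (star B) < depth (star A)" "wfs B" "pos_terms B xs"
      "bound_terms B as" "\<And>i. wft (\<sigma> i)" for B xs as \<sigma>
    using that by (intro bounded_subst_step less.hyps binterp_wff twf_ups) auto
  show ?case
  proof (cases A)
    case (IPred p ts)
    have "length ts = n \<Longrightarrow> ifv (Pt Q p) \<subseteq> {..n}" if "p \<in> comp Q" for n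
      using that params less.prems(1) by (auto simp: IPred il_params_in_def)
    then have "isubst \<sigma> (isubst (inst (ts @ xs)) (Pt Q p)) =
        isubst (inst (map (tsubst \<sigma>) ts @ map (tsubst \<sigma>) xs)) (Pt Q p)" if "p \<in> comp Q"
      unfolding isubst_isubst using that less.prems(2)
      by (intro isubst_cong) (fastforce simp: IPred terms_of_def inst_def nth_append)
    then show ?thesis by (auto simp: IPred binterp_IPred)
  next
    case (IAnd B C)
    then show ?thesis using less.prems less.hyps[of B] less.hyps[of C]
      by (simp add: binterp_IAnd take_map drop_map terms_take_drop)
  next
    case (IImp B C)
    then have "pos_terms B (take (length (bpos Q B)) ys)"
      "neg_terms C (drop (length (bpos Q B)) ys)"
      "pos_terms C (take (length (bpos Q C)) xs)"
      "bound_terms B (drop (length (bpos Q C)) xs)"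
      using less.prems by (auto dest: terms_take_drop)
    then show ?thesis using less.prems less.hyps[of C] bnd[of B] IImp
      by (simp add: binterp_IImp_take Let_def take_map drop_map map_tsubst_appt terms_appt)
  next
    case (IAll B)
    have "isubst (ups 1 \<sigma>) (binterp Q B (map (tshift 1) xs) (map (tshift 1) ys)) =
        binterp Q (isubst (ups 1 \<sigma>) B) (map (tsubst (ups 1 \<sigma>)) (map (tshift 1) xs))
          (map (tsubst (ups 1 \<sigma>)) (map (tshift 1) ys))"
      using less.prems IAll by (intro less.hyps twf_ups) auto
    then show ?thesis unfolding IAll by (simp only: binterp_IAll isubst.simps map_tsubst_ups_tshift)
  next
    case (IEx B)
    have "isubst (ups 1 \<sigma>) (bounded_binterp Q B (map (tshift 1) xs) (map (tshift 1) ys)) =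
        bounded_binterp Q (isubst (ups 1 \<sigma>) B) (map (tsubst (ups 1 \<sigma>)) (map (tshift 1) xs))
          (map (tsubst (ups 1 \<sigma>)) (map (tshift 1) ys))"
      using less.prems IEx by (intro bnd twf_ups) auto
    then show ?thesis unfolding IEx by (simp only: binterp_IEx isubst.simps map_tsubst_ups_tshift)
  qed simp
qed

lemma bounded_subst:
  assumes "wfs A" "pos_terms A xs" "bound_terms A as" "\<And>i. wft (\<sigma> i)"
  shows "isubst \<sigma> (bounded_binterp Q A xs as) =
    bounded_binterp Q (isubst \<sigma> A) (map (tsubst \<sigma>) xs) (map (tsubst \<sigma>) as)"
  using assms by (intro bounded_subst_step binterp_subst binterp_wff twf_ups) auto

text \<open>Statements about arbitrary terms are instances of statements about distinct variables, with
  the formula shifted out of their way.\<close>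

abbreviation gvars :: "nat \<Rightarrow> nat \<Rightarrow> 'f tm list" where
  "gvars a b \<equiv> map Var [a..<a + b]"

lemma binterp_generic:
  assumes "wfs A" "pos_terms A xs" "neg_terms A ys" "\<And>i. wft (\<sigma> i)"
  shows "binterp Q (isubst \<sigma> A) xs ys = isubst (scons (xs @ ys) \<sigma>)
    (binterp Q (ishift (length (xs @ ys)) A) (gvars 0 (length xs)) (gvars (length xs) (length ys)))"
proof -
  have "wft (scons (xs @ ys) \<sigma> i)" for i
    using assms by (intro twf_scons) (auto simp: terms_of_def)
  then show ?thesis using assms
    by (subst binterp_subst)
      (simp_all add: isubst_scons_ishift map_scons_vars map_scons_vars0 terms_of_def del: map_map)
qed

lemma bounded_generic:
  assumes "wfs A" "pos_terms A xs" "bound_terms A ys" "\<And>i. wft (\<sigma> i)"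
  shows "bounded_binterp Q (isubst \<sigma> A) xs ys = isubst (scons (xs @ ys) \<sigma>)
    (bounded_binterp Q (ishift (length (xs @ ys)) A) (gvars 0 (length xs))
        (gvars (length xs) (length ys)))"
proof -
  have "wft (scons (xs @ ys) \<sigma> i)" for i
    using assms by (intro twf_scons) (auto simp: terms_of_def)
  then show ?thesis using assms
    by (subst bounded_subst)
      (simp_all add: isubst_scons_ishift map_scons_vars map_scons_vars0 terms_of_def del: map_map)
qed

lemma list_all2_eqv_wft: "list_all2 eqv ss ts \<Longrightarrow> (\<forall>s\<in>set ss. wft s) \<and> (\<forall>t\<in>set ts. wft t)"
  by (auto simp: list_all2_conv_all_nth in_set_conv_nth eqv_def)

lemma eqv_refls: "\<forall>t\<in>set ts. wft t \<Longrightarrow> list_all2 eqv ts ts"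
  by (auto simp: list_all2_conv_all_nth)

text \<open>Replacement needs both sides as instances of one formula. The interpretation at a
  generic tuple of variables is that formula.\<close>

lemma binterp_eqv:
  assumes "wfs A" "length xs = length (bpos Q A)" "length ys = length (bneg Q A)"
    "list_all2 eqv xs xs'" "list_all2 eqv ys ys'"
  shows "prv It {binterp Q A xs ys} (binterp Q A xs' ys')"
proof -
  have len: "length xs' = length xs" "length ys' = length ys"
    using assms by (simp_all add: list_all2_lengthD)
  have t: "pos_terms A xs" "neg_terms A ys"
    "pos_terms A xs'" "neg_terms A ys'"
    using assms list_all2_eqv_wft len by (fastforce simp: terms_of_def)+
  have "prv It {isubst (scons ([] @ (xs @ ys)) Var) F} (isubst (scons ([] @ (xs' @ ys')) Var) F)"
    if "wff F" for F
    using assms that by (intro prv_eqv_scons list_all2_appendI) auto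
  then show ?thesis
    using binterp_generic[OF assms(1) t(1,2), of Var] binterp_generic[OF assms(1) t(3,4), of Var] assms
    by (simp add: len binterp_wff)
qed

lemma bounded_eqv:
  assumes "wfs A" "length xs = length (bpos Q A)" "length ys = length (hat Q (bneg Q A))"
    "list_all2 eqv xs xs'" "list_all2 eqv ys ys'"
  shows "prv It {bounded_binterp Q A xs ys} (bounded_binterp Q A xs' ys')"
proof -
  have len: "length xs' = length xs" "length ys' = length ys"
    using assms by (simp_all add: list_all2_lengthD)
  have t: "pos_terms A xs" "bound_terms A ys"
    "pos_terms A xs'" "bound_terms A ys'"
    using assms list_all2_eqv_wft len by (fastforce simp: terms_of_def)+
  have "prv It {isubst (scons ([] @ (xs @ ys)) Var) F} (isubst (scons ([] @ (xs' @ ys')) Var) F)"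
    if "wff F" for F
    using assms that by (intro prv_eqv_scons list_all2_appendI) auto
  then show ?thesis
    using bounded_generic[OF assms(1) t(1,2), of Var] bounded_generic[OF assms(1) t(3,4), of Var] assms
    by (simp add: len bounded_wff)
qed

end

section \<open>Rules for the bounded quantifier in IL, with witnesses independent of the
  instance\<close>

section \<open>The conditions on the bounded quantifier, uniformly in the parameters\<close>

context source_target
begin

abbreviation "AIs \<equiv> star_theory Is"
abbreviation "AIt \<equiv> star_theory It"
abbreviation "Ws \<tau>s ts \<equiv> set (map2 (iW Q) \<tau>s ts)"
abbreviation "fms \<equiv> interp_fms AIs AIt (bullet Q)"

lemma star_binterp_fms:
  assumes "wfs A" "pos_terms A xs" "neg_terms A ys"
  shows "star (binterp Q A xs ys) \<in> fms"
  unfolding interp_fms_def interp_star[symmetric] using assms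
  by (intro CollectI exI[of _ "star A"] exI[of _ xs] exI[of _ ys])
    (auto simp: terms_of_def bpos_def bneg_def)

lemma star_bounded_fms:
  assumes "wfs A" "pos_terms A xs" "bound_terms A as"
  shows "Bang (star (bounded_binterp Q A xs as)) \<in> fms"
  unfolding interp_fms_def interp_bang_star[symmetric] using assms
  by (intro CollectI exI[of _ "Bang (star A)"] exI[of _ xs] exI[of _ as])
    (auto simp: terms_of_def bpos_def bneg_def)

lemma al_prv: "al_prov AIt \<Gamma> A \<Longrightarrow> prv It (forget ` set \<Gamma>) (forget A)"
  using il_prv[OF al_prov_forget] by fastforce

lemma forget_set_bangW: "forget ` set (bangW (bullet Q) \<tau>s ts) = Ws \<tau>s ts"
  by (simp only: set_map[symmetric] map_forget_bangW)

lemma aWs_bullet: "aWs (bullet Q) \<tau>s ts = aconj (map star (map2 (iW Q) \<tau>s ts))"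
  by (simp add: aWs_def aW_bullet o_def case_prod_unfold)

text \<open>The IL reading of \<open>Q1\<close>, in which the bound variables may moreover be
  assumed to be in \<open>W\<close>: the quantified form of that assumption is provable by
  \<open>Q2\<close> and is cut away. Antecedents are given as triples so that their banged
  translations are visibly interpretations of source formulas \<open>!B\<close>, the class for which
  \<open>Q1\<close> is assumed.\<close>

lemma bounded_quantify:
  assumes as: "terms (length (hat Q \<tau>s)) as" and zs: "terms (length \<sigma>s) zs"
    and A: "wfs A" "pos_terms A xs" "neg_terms A ys"
    and Bs: "\<forall>(B, x, b)\<in>set Bs. wfs B \<and> pos_terms B x \<and> bound_terms B b"
    and prv: "prv It (Ws \<sigma>s (map (tshift (length \<tau>s)) zs) \<union> Ws \<tau>s (vars (length \<tau>s)) \<union>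
       (\<lambda>(B, x, b). bounded_binterp Q B x b) ` set Bs) (binterp Q A xs ys)"
  shows "prv It (Ws \<sigma>s zs \<union> (\<lambda>(B, x, b). BQ Q \<tau>s as (bounded_binterp Q B x b)) ` set Bs)
    (BQ Q \<tau>s as (binterp Q A xs ys))"
proof -
  let ?n = "length \<tau>s"
  let ?bang = "\<lambda>B. Bang (star B) :: ('f, 'p) afm"
  let ?Z = "map2 (iW Q) \<sigma>s (map (tshift ?n) zs)" and ?V = "map2 (iW Q) \<tau>s (vars ?n)"
    and ?B = "map (\<lambda>(B, x, b). bounded_binterp Q B x b) Bs" and ?A = "binterp Q A xs ys"
  have wfZ: "\<forall>C\<in>set ?Z. wff C" by (rule wff_Ws) (use zs in \<open>auto simp: terms_of_def\<close>)
  have wfV: "\<forall>C\<in>set ?V. wff C" by (rule wff_Ws) auto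
  have wfB: "\<forall>C\<in>set ?B. wff C" using Bs by (auto intro: bounded_wff)
  have "il_prov It (?V @ ?Z @ ?B) ?A"
    by (rule prv_il) (use prv wfZ wfV wfB in \<open>auto simp: Un_ac simp del: set_map\<close>, simp add: Un_ac)
  \<comment> \<open>\<open>Q1\<close> takes an AL derivation as its premise, so the IL derivation is
    translated back, which puts a bang on every hypothesis.\<close>
  from girard[OF wf_theory this]
  have "al_prov AIt (map Bang (map star ?V) @ map ?bang (?Z @ ?B)) (star ?A)"
    by (simp add: o_def)
  then have "al_prov AIt (Bang (aconj (map star ?V)) # map ?bang (?Z @ ?B)) (star ?A)"
    by (rule bang_aconjL) (use wfV in auto)
  then have "al_prov AIt (map ?bang ?Z @ Bang (aWs (bullet Q) \<tau>s (vars ?n)) # map ?bang ?B) (star ?A)"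
    by (rule al_exchI) (simp add: aWs_bullet)
  moreover have "map ?bang ?Z = map (ashift ?n) (bangW (bullet Q) \<sigma>s zs)"
    by (simp add: bangW_bullet zip_map2 o_def case_prod_unfold star_ishift[symmetric])
  ultimately have *: "al_prov AIt (map (ashift ?n) (bangW (bullet Q) \<sigma>s zs) @
      Bang (aWs (bullet Q) \<tau>s (vars ?n)) # map ?bang ?B) (star ?A)"
    by simp
  have "set (map ?bang ?B) \<subseteq> fms"
    using Bs by (auto intro: star_bounded_fms)
  then have sub: "set (Bang (aWs (bullet Q) \<tau>s (vars ?n)) # map ?bang ?B) \<subseteq>
      insert (Bang (aWs (bullet Q) \<tau>s (vars ?n))) fms"
    by auto
  have "Q1 AIt (bullet Q) fms \<tau>s" "Q2 AIt (bullet Q) \<tau>s"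
    using ax_A5 by (auto simp: A5_def)
  note q = this(1)[unfolded Q1_def, rule_format, OF _ _ sub star_binterp_fms[OF A] *]
    this(2)[unfolded Q2_def, rule_format]
  have q: "al_prov AIt (bangW (bullet Q) \<sigma>s zs @
        map (BQ (bullet Q) \<tau>s as) (Bang (aWs (bullet Q) \<tau>s (vars ?n)) # map ?bang ?B))
      (BQ (bullet Q) \<tau>s as (star ?A))"
    and q2: "al_prov AIt [] (BQ (bullet Q) \<tau>s as (Bang (aWs (bullet Q) \<tau>s (vars ?n))))"
    by (rule q; use as zs in simp)+
  from al_prv[OF q]
  have "prv It (insert (BQ Q \<tau>s as (iWs Q \<tau>s (vars ?n))) (Ws \<sigma>s zs \<union> BQ Q \<tau>s as ` set ?B))
      (BQ Q \<tau>s as ?A)"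
    by (simp add: image_Un forget_set_bangW forget_aWs image_image)
  moreover have "prv It {} (BQ Q \<tau>s as (iWs Q \<tau>s (vars ?n)))"
    using al_prv[OF q2] by (simp add: forget_aWs)
  ultimately have "prv It (Ws \<sigma>s zs \<union> BQ Q \<tau>s as ` set ?B) (BQ Q \<tau>s as ?A)"
    by (meson empty_subsetI prv_cut prv_mono)
  then show ?thesis by (simp add: image_image case_prod_unfold)
qed

lemma Ws_subst: "isubst \<sigma> ` Ws \<tau>s ts = Ws \<tau>s (map (tsubst \<sigma>) ts)"
  by (force simp: zip_map2 image_image)

abbreviation source_subst :: "(nat \<Rightarrow> 'f tm) \<Rightarrow> bool" where
  "source_subst \<sigma> \<equiv> \<forall>i. twf (lang Is) (\<sigma> i)"

lemma source_wft: "source_subst \<sigma> \<Longrightarrow> \<forall>i. wft (\<sigma> i)"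
  by (auto intro: wfs_wft)

lemma source_wfs: "source_subst \<sigma> \<Longrightarrow> wfs A \<Longrightarrow> wfs (isubst \<sigma> A)"
  by (intro iwf_isubst) auto

text \<open>One closed tuple for all instances of \<open>A\<close> by source terms and for all
  superscripts and challenges in \<open>W\<close> relative to any \<open>S\<close>. Hence
  \<open>\<eta>\<close> can be built into a realizer before the instance is known.\<close>

definition eta_for :: "('f, 'p) ifm \<Rightarrow> 'f tm list \<Rightarrow> bool" where
  "eta_for A \<eta> \<longleftrightarrow> Wt (arrs (bneg Q A) (hat Q (bneg Q A))) \<eta> \<and>
    (\<forall>\<sigma> x z S. source_subst \<sigma> \<longrightarrow> Wp S (bpos Q A) x \<longrightarrow> Wp S (bneg Q A) z \<longrightarrow>
      prv It S (bounded_binterp Q (isubst \<sigma> A) x (appt \<eta> z)) \<longrightarrow>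
      prv It S (binterp Q (isubst \<sigma> A) x z))"

lemma eta_for_Wt: "eta_for A \<eta> \<Longrightarrow> Wt (arrs (bneg Q A) (hat Q (bneg Q A))) \<eta>"
  and eta_for_prv: "eta_for A \<eta> \<Longrightarrow> source_subst \<sigma> \<Longrightarrow> Wp S (bpos Q A) x \<Longrightarrow> Wp S (bneg Q A) z \<Longrightarrow>
    prv It S (bounded_binterp Q (isubst \<sigma> A) x (appt \<eta> z)) \<Longrightarrow> prv It S (binterp Q (isubst \<sigma> A) x z)"
  unfolding eta_for_def by blast+

text \<open>The terms given by \<open>A5\<close> for the formula with generic parameters serve all its instances.\<close>

lemma ex_eta:
  assumes A: "wfs A" shows "\<exists>\<eta>. eta_for A \<eta>"
proof -
  define p n where "p = length (bpos Q A)" and "n = length (bneg Q A)"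
  \<comment> \<open>\<open>A\<close> is shifted past \<open>p + n\<close> variables, which serve as
    generic superscript \<open>xs1\<close> and generic challenge \<open>zs1\<close>.
    \<open>F\<close> is the body of the bounded quantifier, with \<open>n\<close> further variables
    for the tuple it binds.\<close>
  define G xs1 zs1 where "G = ishift (p + n) A" and "xs1 = gvars 0 p" and "zs1 = gvars p n"
  define F where "F = binterp Q (ishift n G) (map (tshift n) xs1) (vars n)"
  have G: "wfs G" "bpos Q G = bpos Q A" "bneg Q G = bneg Q A" using A by (simp_all add: G_def)
  have t: "terms p xs1" "terms n zs1" by (simp_all add: xs1_def zs1_def)
  have "star F \<in> fms"
    unfolding F_def using G t by (intro star_binterp_fms) (auto simp: p_def n_def)
  then have "C_eta AIt (bullet Q) (bneg Q A) (star F)" using ax_A5 by (auto simp: A5_def)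
  then obtain \<eta> where \<eta>: "Wt (arrs (bneg Q A) (hat Q (bneg Q A))) \<eta>"
    and "al_prov AIt (bangW (bullet Q) (bneg Q A) zs1 @
        [Bang (BQ (bullet Q) (bneg Q A) (appt \<eta> zs1) (star F))])
        (asubst (inst zs1) (star F))"
    unfolding C_eta_def using W_terms_Wt t by (auto simp: n_def)
  from al_prv[OF this(2)]
  have "prv It (Ws (bneg Q A) zs1 \<union> {BQ Q (bneg Q A) (appt \<eta> zs1) F}) (isubst (inst zs1) F)"
    by (simp add: image_Un forget_set_bangW forget_asubst Un_ac)
  moreover have "BQ Q (bneg Q A) (appt \<eta> zs1) F = bounded_binterp Q G xs1 (appt \<eta> zs1)"
    by (simp add: bounded_binterp_def F_def G n_def Let_def)
  moreover have "isubst (inst zs1) F = binterp Q G xs1 zs1"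
  proof -
    have "isubst (inst zs1) F = binterp Q (isubst (inst zs1) (ishift n G))
        (map (tsubst (inst zs1)) (map (tshift n) xs1)) (map (tsubst (inst zs1)) (vars n))"
      unfolding F_def using G t by (intro binterp_subst twf_inst) (auto simp: p_def n_def terms_of_def)
    moreover have "length zs1 = n" by (simp add: zs1_def)
    ultimately show ?thesis
      by (simp add: inst_scons isubst_scons_ishift map_scons_vars0 tsubst_scons_tshift o_def
        del: map_map) (simp add: tsubst_scons_tshift o_def)
  qed
  ultimately have gen: "prv It (Ws (bneg Q A) zs1 \<union>
      {bounded_binterp Q G xs1 (appt \<eta> zs1)}) (binterp Q G xs1 zs1)"
    by simp
  have "prv It S (binterp Q (isubst \<sigma> A) xs zs)"
    if s: "source_subst \<sigma>" and x: "Wp S (bpos Q A) xs" and zs: "Wp S (bneg Q A) zs"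
      and b: "prv It S (bounded_binterp Q (isubst \<sigma> A) xs (appt \<eta> zs))" for \<sigma> xs zs S
  proof -
    have \<sigma>: "\<forall>i. wft (\<sigma> i)" and xs: "terms p xs"
      using source_wft[OF s] Wp_terms[OF x] by (simp_all add: p_def)
    \<comment> \<open>Fills in the generic variables and acts as \<open>\<sigma>\<close> on the
      variables that were shifted away, so that \<open>G\<close> becomes
      \<open>isubst \<sigma> A\<close>.\<close>
    let ?\<theta> = "scons (xs @ zs) \<sigma>"
    have len: "length xs = p" "length zs = n" using xs zs by (auto simp: terms_of_def n_def Wp_length)
    have \<theta>: "wft (?\<theta> i)" for i
      using \<sigma> xs Wp_wft[OF zs] by (intro twf_scons) (auto simp: terms_of_def)
    have v: "isubst ?\<theta> G = isubst \<sigma> A" "map (tsubst ?\<theta>) xs1 = xs" "map (tsubst ?\<theta>) zs1 = zs"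
      by (simp_all add: G_def isubst_scons_ishift len xs1_def zs1_def map_scons_vars map_scons_vars0
          del: map_map)
    have \<eta>t: "bound_terms A \<eta>" using Wt_terms[OF \<eta>] by simp
    have 1: "isubst ?\<theta> (binterp Q G xs1 zs1) = binterp Q (isubst \<sigma> A) xs zs"
      using G t \<theta> by (subst binterp_subst) (auto simp: p_def n_def v)
    have 2: "isubst ?\<theta> (bounded_binterp Q G xs1 (appt \<eta> zs1)) = bounded_binterp Q (isubst \<sigma> A) xs
        (appt \<eta> zs)"
      using G t \<theta> \<eta>t by (subst bounded_subst)
        (auto simp: p_def n_def v map_tsubst_appt Wt_tsubst[OF \<eta>] intro!: terms_appt)
    from prv_subst[OF gen, of ?\<theta>] \<theta>
    have "prv It (Ws (bneg Q A) zs \<union> {bounded_binterp Q (isubst \<sigma> A) xs (appt \<eta> zs)})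
        (binterp Q (isubst \<sigma> A) xs zs)"
      by (simp add: image_Un 1 2 Ws_subst v(3) del: set_map map_map)
    then show ?thesis by (rule prv_cuts) (use b Wp_prv[OF zs] in blast)
  qed
  then show ?thesis using \<eta> unfolding eta_for_def by blast
qed


text \<open>The join in its role as contraction: one bound for \<open>A\<close> serves two requests.
  \<open>A5\<close> is again used at a generic superscript and two generic bounds, so
  \<open>j\<close> does not depend on the instance.\<close>

lemma bounded_join:
  assumes A: "wfs A"
  defines "h \<equiv> hat Q (bneg Q A)"
  obtains j where "Wt (arrs h (arrs h h)) j"
    and "\<And>\<sigma> x as bs S. source_subst \<sigma> \<Longrightarrow> Wp S (bpos Q A) x \<Longrightarrow> Wp S h as \<Longrightarrow> Wp S h bs \<Longrightarrow>
      prv It S (bounded_binterp Q (isubst \<sigma> A) x (appt j (as @ bs))) \<Longrightarrow>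
      prv It S (bounded_binterp Q (isubst \<sigma> A) x as) \<and> prv It S (bounded_binterp Q (isubst \<sigma> A) x bs)"
proof -
  define p n m where "p = length (bpos Q A)" and "n = length (bneg Q A)" and "m = length h"
  define G xs1 as1 bs1 where "G = ishift (p + m + m) A" and "xs1 = gvars 0 p" and "as1 = gvars p m"
    and "bs1 = gvars (p + m) m"
  define F where "F = binterp Q (ishift n G) (map (tshift n) xs1) (vars n)"
  have G: "wfs G" "bpos Q G = bpos Q A" "bneg Q G = bneg Q A" using A by (simp_all add: G_def)
  have t: "terms p xs1" "terms m as1" "terms m bs1" by (simp_all add: xs1_def as1_def bs1_def)
  have "star F \<in> fms"
    unfolding F_def using G t by (intro star_binterp_fms) (auto simp: p_def n_def)
  then have "C_join AIt (bullet Q) (bneg Q A) (star F)" using ax_A5 by (auto simp: A5_def)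
  then obtain j where "W_terms AIt (bullet Q) (arrs h (arrs h h)) j"
    and "\<forall>as bs. terms m as \<longrightarrow> terms m bs \<longrightarrow> al_prov AIt (bangW (bullet Q) (h @ h) (as @ bs) @
          [Bang (BQ (bullet Q) (bneg Q A) (appt j (as @ bs)) (star F))])
        (Tens (BQ (bullet Q) (bneg Q A) as (star F)) (BQ (bullet Q) (bneg Q A) bs (star F)))"
    unfolding C_join_def m_def h_def lang_star_theory bullet_sel(3) by (elim exE conjE)
  note j = W_terms_Wt[OF this(1)] and al = this(2)
  from al_prv[OF al[rule_format, OF t(2,3)]]
  have "prv It (Ws (h @ h) (as1 @ bs1) \<union> {BQ Q (bneg Q A) (appt j (as1 @ bs1)) F})
      (IAnd (BQ Q (bneg Q A) as1 F) (BQ Q (bneg Q A) bs1 F))"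
    by (simp add: image_Un forget_set_bangW forget_asubst Un_ac)
  moreover have "BQ Q (bneg Q A) cs F = bounded_binterp Q G xs1 cs" for cs
    by (simp add: bounded_binterp_def F_def G n_def Let_def)
  ultimately have gen: "prv It (Ws (h @ h) (as1 @ bs1) \<union> {bounded_binterp Q G xs1 (appt j (as1 @ bs1))})
      (IAnd (bounded_binterp Q G xs1 as1) (bounded_binterp Q G xs1 bs1))"
    by simp
  have "prv It S (IAnd (bounded_binterp Q (isubst \<sigma> A) xs as) (bounded_binterp Q (isubst \<sigma> A) xs bs))"
    if s: "source_subst \<sigma>" and x: "Wp S (bpos Q A) xs" and as: "Wp S h as" and bs: "Wp S h bs"
      and b: "prv It S (bounded_binterp Q (isubst \<sigma> A) xs (appt j (as @ bs)))" for \<sigma> xs as bs S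
  proof -
    have \<sigma>: "\<forall>i. wft (\<sigma> i)" and xs: "terms p xs"
      using source_wft[OF s] Wp_terms[OF x] by (simp_all add: p_def)
    let ?\<theta> = "scons (xs @ as @ bs) \<sigma>"
    have len: "length xs = p" "length as = m" "length bs = m"
      using xs as bs by (auto simp: terms_of_def m_def Wp_length)
    have \<theta>: "wft (?\<theta> i)" for i
      using \<sigma> xs Wp_wft[OF as] Wp_wft[OF bs] by (intro twf_scons) (auto simp: terms_of_def)
    have v: "isubst ?\<theta> G = isubst \<sigma> A" "map (tsubst ?\<theta>) xs1 = xs" "map (tsubst ?\<theta>) as1 = as"
      "map (tsubst ?\<theta>) bs1 = bs"
      by (simp_all add: G_def isubst_scons_ishift len xs1_def as1_def bs1_def map_scons_vars
        map_scons_vars0 del: map_map)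
    have sb: "isubst ?\<theta> (bounded_binterp Q G xs1 cs) =
        bounded_binterp Q (isubst \<sigma> A) xs (map (tsubst ?\<theta>) cs)" if "terms m cs" for cs
      using G t \<theta> that by (subst bounded_subst) (auto simp: p_def m_def h_def v)
    have "terms m j" using Wt_terms[OF j] by (simp add: m_def)
    then have "terms m (appt j (as1 @ bs1))" using t by (auto simp: terms_of_def appt_def)
    with prv_subst[OF gen, of ?\<theta>] \<theta> t
    have "prv It (Ws (h @ h) (as @ bs) \<union> {bounded_binterp Q (isubst \<sigma> A) xs (appt j (as @ bs))})
        (IAnd (bounded_binterp Q (isubst \<sigma> A) xs as) (bounded_binterp Q (isubst \<sigma> A) xs bs))"
      by (simp add: image_Un Ws_subst sb v map_tsubst_appt Wt_tsubst[OF j] del: set_map map_map)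
    moreover have "Wp S (h @ h) (as @ bs)" using as bs by (simp add: Wp_append Wp_length)
    ultimately show ?thesis using b Wp_prv by (elim prv_cuts) blast
  qed
  with that[OF j] prv_andD show thesis by blast
qed

text \<open>Composition in its role as promotion: a bound for \<open>A\<close> that depends on a
  tuple \<open>y\<close> through \<open>fs\<close> is made uniform over all \<open>y\<close> below
  \<open>zs\<close>, which brings the interpretation of \<open>A\<close> inside a bounded quantifier
  over \<open>y\<close>.\<close>

lemma bounded_circ:
  fixes \<rho>s :: "ty list"
  assumes A: "wfs A"
  defines "h \<equiv> hat Q (bneg Q A)" and "r \<equiv> length \<rho>s"
  obtains c where "Wt (arrs (arrs \<rho>s h) (arrs (hat Q \<rho>s) h)) c"
    and "\<And>\<sigma> x fs zs S. source_subst \<sigma> \<Longrightarrow> Wp S (bpos Q A) x \<Longrightarrow> Wp S (arrs \<rho>s h) fs \<Longrightarrow>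
      Wp S (hat Q \<rho>s) zs \<Longrightarrow>
      prv It S (bounded_binterp Q (isubst \<sigma> A) x (appt c (fs @ zs))) \<Longrightarrow>
      prv It S (BQ Q \<rho>s zs (bounded_binterp Q (ishift r (isubst \<sigma> A)) (map (tshift r) x)
        (appt (map (tshift r) fs) (vars r))))"
proof -
  define p n m k where "p = length (bpos Q A)" and "n = length (bneg Q A)" and "m = length h"
    and "k = length (hat Q \<rho>s)"
  define G xs1 fs1 zs1 where "G = ishift (p + m + k) A" and "xs1 = gvars 0 p" and "fs1 = gvars p m"
    and "zs1 = gvars (p + m) k"
  define F where "F = binterp Q (ishift n G) (map (tshift n) xs1) (vars n)"
  have G: "wfs G" "bpos Q G = bpos Q A" "bneg Q G = bneg Q A" using A by (simp_all add: G_def)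
  have t: "terms p xs1" "terms m fs1" "terms k zs1" by (simp_all add: xs1_def fs1_def zs1_def)
  let ?B = "bounded_binterp Q (ishift r G) (map (tshift r) xs1) (appt (map (tshift r) fs1) (vars r))"
  have tB: "terms m (appt (map (tshift r) fs1) (vars r))" using t by (intro terms_appt) auto
  have "star F \<in> fms"
    unfolding F_def using G t by (intro star_binterp_fms) (auto simp: p_def n_def)
  then have "C_circ AIt (bullet Q) \<rho>s (bneg Q A) (star F)" using ax_A5 by (auto simp: A5_def)
  then obtain c where "W_terms AIt (bullet Q) (arrs (arrs \<rho>s h) (arrs (hat Q \<rho>s) h)) c"
    and "\<forall>fs zs. terms m fs \<longrightarrow> terms k zs \<longrightarrow>
        al_prov AIt (bangW (bullet Q) (arrs \<rho>s h) fs @ bangW (bullet Q) (hat Q \<rho>s) zs @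
          [Bang (BQ (bullet Q) (bneg Q A) (appt c (fs @ zs)) (star F))])
        (BQ (bullet Q) \<rho>s zs (Bang (BQ (bullet Q) (bneg Q A) (appt (map (tshift r) fs) (vars r))
          (asubst (ups n (\<lambda>i. Var (i + r))) (star F)))))"
    unfolding C_circ_def m_def h_def k_def r_def n_def Let_def lang_star_theory bullet_sel(3)
    by (elim exE conjE)
  note c = W_terms_Wt[OF this(1)] and al = this(2)
  from al_prv[OF al[rule_format, OF t(2,3)]]
  have "prv It (Ws (arrs \<rho>s h) fs1 \<union> Ws (hat Q \<rho>s) zs1 \<union> {BQ Q (bneg Q A) (appt c (fs1 @ zs1)) F})
      (BQ Q \<rho>s zs1 (BQ Q (bneg Q A) (appt (map (tshift r) fs1) (vars r))
          (isubst (ups n (\<lambda>i. Var (i + r))) F)))"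
    by (simp add: image_Un forget_set_bangW forget_asubst Un_ac)
  moreover have "BQ Q (bneg Q A) (appt c (fs1 @ zs1)) F = bounded_binterp Q G xs1 (appt c (fs1 @ zs1))"
    by (simp add: bounded_binterp_def F_def G n_def Let_def)
  \<comment> \<open>The renaming that \<open>C_circ\<close> performs under the inner binder fixes
    the bound tuple and shifts the rest by \<open>r\<close>, so it amounts to shifting
    \<open>G\<close> and \<open>xs1\<close>.\<close>
  moreover have "BQ Q (bneg Q A) (appt (map (tshift r) fs1) (vars r))
      (isubst (ups n (\<lambda>i. Var (i + r))) F) = ?B"
  proof -
    let ?u = "ups n (\<lambda>i. Var (i + r))"
    have "isubst ?u F = binterp Q (isubst ?u (ishift n G)) (map (tsubst ?u) (map (tshift n) xs1))
        (map (tsubst ?u) (vars n))"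
      unfolding F_def using G t by (intro binterp_subst twf_ups) (auto simp: p_def n_def)
    then show ?thesis
      by (simp only: isubst_ups_ishift map_tsubst_ups_tshift tsubst_ups_vars bounded_binterp_def
        Let_def bneg_isubst G n_def ishift_def[of r] tshift_def[of r])
  qed
  ultimately have gen: "prv It (Ws (arrs \<rho>s h) fs1 \<union> Ws (hat Q \<rho>s) zs1 \<union>
      {bounded_binterp Q G xs1 (appt c (fs1 @ zs1))}) (BQ Q \<rho>s zs1 ?B)"
    by simp
  have wB: "wff ?B" using G t tB by (intro bounded_wff) (auto simp: p_def m_def h_def)
  have "prv It S (BQ Q \<rho>s zs (bounded_binterp Q (ishift r (isubst \<sigma> A)) (map (tshift r) xs)
        (appt (map (tshift r) fs) (vars r))))"
    if s: "source_subst \<sigma>" and x: "Wp S (bpos Q A) xs" and fs: "Wp S (arrs \<rho>s h) fs"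
        and zs: "Wp S (hat Q \<rho>s) zs"
      and b: "prv It S (bounded_binterp Q (isubst \<sigma> A) xs (appt c (fs @ zs)))" for \<sigma> xs fs zs S
  proof -
    have \<sigma>: "\<forall>i. wft (\<sigma> i)" and xs: "terms p xs"
      using source_wft[OF s] Wp_terms[OF x] by (simp_all add: p_def)
    let ?\<theta> = "scons (xs @ fs @ zs) \<sigma>"
    have len: "length xs = p" "length fs = m" "length zs = k"
      using xs Wp_length[OF fs] zs by (auto simp: terms_of_def m_def k_def Wp_length)
    have \<theta>: "wft (?\<theta> i)" for i
      using \<sigma> xs Wp_wft[OF fs] Wp_wft[OF zs] by (intro twf_scons) (auto simp: terms_of_def)
    have v: "isubst ?\<theta> G = isubst \<sigma> A" "map (tsubst ?\<theta>) xs1 = xs" "map (tsubst ?\<theta>) fs1 = fs"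
      "map (tsubst ?\<theta>) zs1 = zs"
      by (simp_all add: G_def isubst_scons_ishift len xs1_def fs1_def zs1_def map_scons_vars
        map_scons_vars0 del: map_map)
    have "isubst (ups r ?\<theta>) ?B = bounded_binterp Q (isubst (ups r ?\<theta>) (ishift r G))
        (map (tsubst (ups r ?\<theta>)) (map (tshift r) xs1))
        (map (tsubst (ups r ?\<theta>)) (appt (map (tshift r) fs1) (vars r)))"
      using G t tB \<theta> by (intro bounded_subst twf_ups) (auto simp: p_def m_def h_def)
    then have sB: "isubst ?\<theta> (BQ Q \<rho>s zs1 ?B) = BQ Q \<rho>s zs (bounded_binterp Q (ishift r (isubst \<sigma> A))
        (map (tshift r) xs) (appt (map (tshift r) fs) (vars r)))"
      using BQ_subst[where \<tau>s = \<rho>s and as = zs1 and A = ?B and \<sigma> = ?\<theta>] t wB \<theta>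
      by (simp only: isubst_ups_ishift map_tsubst_ups_tshift tsubst_ups_vars map_tsubst_appt v r_def
          k_def)
    have "terms m c" using Wt_terms[OF c] by (simp add: m_def)
    then have "terms m (appt c (fs1 @ zs1))" using t by (auto simp: terms_of_def appt_def)
    then have "isubst ?\<theta> (bounded_binterp Q G xs1 (appt c (fs1 @ zs1))) =
        bounded_binterp Q (isubst \<sigma> A) xs (appt c (fs @ zs))"
      using G t \<theta> by (subst bounded_subst)
        (auto simp: p_def m_def h_def v map_tsubst_appt Wt_tsubst[OF c])
    with prv_subst[OF gen, of ?\<theta>] \<theta>
    have "prv It (Ws (arrs \<rho>s h) fs \<union> Ws (hat Q \<rho>s) zs \<union>
        {bounded_binterp Q (isubst \<sigma> A) xs (appt c (fs @ zs))})
        (BQ Q \<rho>s zs (bounded_binterp Q (ishift r (isubst \<sigma> A)) (map (tshift r) xs)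
          (appt (map (tshift r) fs) (vars r))))"
      by (simp add: image_Un Ws_subst sB v(3,4) del: set_map map_map)
    then show ?thesis using b Wp_prv[OF fs] Wp_prv[OF zs] by (elim prv_cuts) blast
  qed
  with that[OF c] show thesis by blast
qed

end

section \<open>Realizability of sequents and currying\<close>

section \<open>Realizable sequents\<close>

lemma blocks_nth:
  "i < length ns \<Longrightarrow> blocks ns xs ! i = take (ns ! i) (drop (sum_list (take i ns)) xs)"
proof (induction ns arbitrary: i xs)
  case (Cons n ns)
  then show ?case by (cases i) (auto simp: add.commute)
qed simp

lemma blocks_concat:
  "list_all2 (\<lambda>n us. length us = n) ns uss \<Longrightarrow> blocks ns (concat uss) = uss"
  by (induction ns uss rule: list_all2_induct) auto

lemma list_all2_snoc: "list_all2 P (xs @ [x]) (ys @ [y]) \<longleftrightarrow> list_all2 P xs ys \<and> P x y"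
  using list_all2_rev[of P "x # rev xs" "y # rev ys"] list_all2_rev[of P xs ys] by auto

lemma length_blocks [simp]: "length (blocks ns xs) = length ns"
  by (induction ns xs rule: blocks.induct) auto

lemma concat_blocks: "length xs = sum_list ns \<Longrightarrow> concat (blocks ns xs) = xs"
  by (induction ns xs rule: blocks.induct) auto

definition block :: "ty list list \<Rightarrow> nat \<Rightarrow> 'a list \<Rightarrow> 'a list" where
  "block \<rho>ss i us = blocks (map length \<rho>ss) us ! i"

lemma block_concat:
  assumes "list_all2 (\<lambda>\<rho>s us. length us = length \<rho>s) \<rho>ss uss" "i < length \<rho>ss"
  shows "block \<rho>ss i (concat uss) = uss ! i"
  using assms blocks_concat[of "map length \<rho>ss" uss] by (simp add: block_def list_all2_map1)

context source_target
begin

lemma definable_blocks: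
  assumes "i < length \<rho>ss" shows "definable (concat \<rho>ss) (\<rho>ss ! i) (block \<rho>ss i)"
proof -
  let ?l = "take i \<rho>ss" and ?r = "drop (Suc i) \<rho>ss"
  have "concat \<rho>ss = concat (?l @ \<rho>ss ! i # ?r)"
    using id_take_nth_drop[OF assms] by simp
  then have *: "concat \<rho>ss = concat ?l @ \<rho>ss ! i @ concat ?r" by simp
  have "block \<rho>ss i = (\<lambda>us. take (length (\<rho>ss ! i)) (drop (length (concat ?l)) (us :: 'f tm list)))"
    using assms by (intro ext) (simp add: block_def blocks_nth length_concat take_map)
  then show ?thesis unfolding * by (simp only: definable_block)
qed

text \<open>The semantic form of witnessability: the fresh variables give way to arbitrary tuples in
  \<open>W\<close> relative to \<open>S\<close>, and the formulas to all their source instances.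
  \<open>a\<close> sees only the superscripts of the context, each bounding tuple also the challenge
  \<open>ws\<close>.\<close>

definition real_seq ::
    "('f, 'p) ifm list \<Rightarrow> ('f, 'p) ifm \<Rightarrow> 'f tm list \<Rightarrow> 'f tm list list \<Rightarrow> bool" where
  "real_seq \<Gamma> A a gs \<longleftrightarrow>
     Wt (arrs (ctx_pos Q \<Gamma>) (bpos Q A)) a \<and>
     list_all2 (\<lambda>B. Wt (arrs (ctx_pos Q \<Gamma> @ bneg Q A) (hat Q (bneg Q B)))) \<Gamma> gs \<and>
     (\<forall>\<sigma> xss ws S. source_subst \<sigma> \<longrightarrow> list_all2 (\<lambda>B. Wp S (bpos Q B)) \<Gamma> xss \<longrightarrow> Wp S (bneg Q A) ws \<longrightarrow>
       (\<forall>(B, x, g)\<in>set (zip \<Gamma> (zip xss gs)).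
         prv It S (bounded_binterp Q (isubst \<sigma> B) x (appt g (concat xss @ ws)))) \<longrightarrow>
       prv It S (binterp Q (isubst \<sigma> A) (appt a (concat xss)) ws))"

definition realized :: "('f, 'p) ifm \<Rightarrow> bool" where
  "realized A \<longleftrightarrow> (\<exists>a. real_seq [] A a [])"

lemma ctx_pos_simps [simp]:
  "ctx_pos Q [] = []" "ctx_pos Q (B # \<Gamma>) = bpos Q B @ ctx_pos Q \<Gamma>"
  "ctx_pos Q (\<Gamma> @ \<Delta>) = ctx_pos Q \<Gamma> @ ctx_pos Q \<Delta>"
  by (simp_all add: ctx_pos_def)

lemma Wp_appendE:
  assumes "Wp S (\<sigma>s @ \<tau>s) rs"
  obtains ss ts where "rs = ss @ ts" "Wp S \<sigma>s ss" "Wp S \<tau>s ts"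
  using assms by (auto simp: Wp_def list_all2_append1)

lemma Wt_Wp: "Wt \<tau>s ts \<Longrightarrow> Wp S \<tau>s ts"
  by (auto simp: Wt_def Wp_def closed_term_def elim!: list_all2_mono intro: prv_mono)

lemma ctx_length:
  "list_all2 (\<lambda>B. Wp S (bpos Q B)) \<Gamma> xss \<Longrightarrow> length (concat xss) = length (ctx_pos Q \<Gamma>)"
  by (induction rule: list_all2_induct) (auto simp: Wp_length)

lemma ctx_wft: "list_all2 (\<lambda>B. Wp S (bpos Q B)) \<Gamma> xss \<Longrightarrow> \<forall>t\<in>set (concat xss). wft t"
proof (induction rule: list_all2_induct)
  case (Cons B \<Gamma> x xss)
  then show ?case using Wp_wft[OF Cons(1)] by auto
qed simp

text \<open>Currying does not change the realizing terms.\<close>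

lemma real_seq_snoc:
  assumes a: "length a = length (bpos Q A)" and B: "wfs B" and A: "wfs A"
  shows "real_seq (\<Gamma> @ [B]) A a (gs @ [g]) \<longleftrightarrow> real_seq \<Gamma> (IImp B A) (a @ g) gs"
proof -
  have types: "Wt (arrs (ctx_pos Q (\<Gamma> @ [B])) (bpos Q A)) a \<and>
      list_all2 (\<lambda>C. Wt (arrs (ctx_pos Q (\<Gamma> @ [B]) @ bneg Q A) (hat Q (bneg Q C)))) (\<Gamma> @ [B])
          (gs @ [g]) \<longleftrightarrow>
    Wt (arrs (ctx_pos Q \<Gamma>) (bpos Q (IImp B A))) (a @ g) \<and>
      list_all2 (\<lambda>C. Wt (arrs (ctx_pos Q \<Gamma> @ bneg Q (IImp B A)) (hat Q (bneg Q C)))) \<Gamma> gs"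
    using a by (auto simp: arrs_append arrs_arrs Wt_append list_all2_snoc)
  show ?thesis
  proof
    assume L: "real_seq (\<Gamma> @ [B]) A a (gs @ [g])"
    then have len: "length gs = length \<Gamma>" by (auto simp: real_seq_def dest: list_all2_lengthD)
    have "prv It S (binterp Q (isubst \<sigma> (IImp B A)) (appt (a @ g) (concat xss)) ws)"
      if \<sigma>: "source_subst \<sigma>" and xss: "list_all2 (\<lambda>B. Wp S (bpos Q B)) \<Gamma> xss"
        and ws: "Wp S (bneg Q (IImp B A)) ws"
        and b: "\<forall>(C, x, g)\<in>set (zip \<Gamma> (zip xss gs)).
          prv It S (bounded_binterp Q (isubst \<sigma> C) x (appt g (concat xss @ ws)))" for \<sigma> xss ws S
    proof -
      obtain x w where xw: "ws = x @ w" "Wp S (bpos Q B) x" "Wp S (bneg Q A) w"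
        using ws by (auto elim: Wp_appendE)
      let ?b = "bounded_binterp Q (isubst \<sigma> B) x (appt g (concat (xss @ [x]) @ w))"
      have g: "Wt (arrs (ctx_pos Q \<Gamma> @ bpos Q B @ bneg Q A) (hat Q (bneg Q B))) g"
        using L by (simp add: real_seq_def list_all2_snoc)
      have "wff ?b"
        using source_wfs[OF \<sigma> B] Wp_terms[OF xw(2)] Wt_terms[OF g] ctx_wft[OF xss] Wp_wft[OF xw(3)]
        by (intro bounded_wff) (auto simp: terms_of_def appt_def)
      \<comment> \<open>The bounded antecedent is made a hypothesis before the sequent is applied,
        which requires realizability for every \<open>S\<close> and not just a fixed one.\<close>
      have "list_all2 (\<lambda>C. Wp (insert ?b S) (bpos Q C)) (\<Gamma> @ [B]) (xss @ [x])"
        using xss xw by (auto intro!: list_all2_appendI elim!: list_all2_mono intro: Wp_mono)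
      moreover have "Wp (insert ?b S) (bneg Q A) w"
        by (rule Wp_mono[OF xw(3)]) auto
      moreover have "\<forall>(C, y, h)\<in>set (zip (\<Gamma> @ [B]) (zip (xss @ [x]) (gs @ [g]))).
          prv It (insert ?b S) (bounded_binterp Q (isubst \<sigma> C) y (appt h (concat (xss @ [x]) @ w)))"
        using b \<open>wff ?b\<close> list_all2_lengthD[OF xss] len xw(1)
        by (auto intro: prv_hyp elim!: prv_mono)
      ultimately have "prv It (insert ?b S) (binterp Q (isubst \<sigma> A) (appt a (concat (xss @ [x]))) w)"
        using L \<sigma> unfolding real_seq_def by blast
      from prv_impI[OF this \<open>wff ?b\<close>] show ?thesis
        using xw a by (simp add: binterp_IImp appt_append appt_appt Wp_length)
    qed
    then show "real_seq \<Gamma> (IImp B A) (a @ g) gs"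
      using L types unfolding real_seq_def by blast
  next
    assume R: "real_seq \<Gamma> (IImp B A) (a @ g) gs"
    then have len: "length gs = length \<Gamma>" by (auto simp: real_seq_def dest: list_all2_lengthD)
    have "prv It S (binterp Q (isubst \<sigma> A) (appt a (concat xss')) w)"
      if \<sigma>: "source_subst \<sigma>" and xss': "list_all2 (\<lambda>B. Wp S (bpos Q B)) (\<Gamma> @ [B]) xss'"
        and w: "Wp S (bneg Q A) w"
        and b: "\<forall>(C, x, g)\<in>set (zip (\<Gamma> @ [B]) (zip xss' (gs @ [g]))).
          prv It S (bounded_binterp Q (isubst \<sigma> C) x (appt g (concat xss' @ w)))" for \<sigma> xss' w S
    proof -
      obtain xss x where xss: "xss' = xss @ [x]" "list_all2 (\<lambda>B. Wp S (bpos Q B)) \<Gamma> xss"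
          "Wp S (bpos Q B) x"
        using xss' by (auto simp: list_all2_append1 list_all2_Cons1)
      have "Wp S (bneg Q (IImp B A)) (x @ w)" using xss w by (simp add: Wp_append Wp_length)
      moreover have "\<forall>(C, x', g)\<in>set (zip \<Gamma> (zip xss gs)).
          prv It S (bounded_binterp Q (isubst \<sigma> C) x' (appt g (concat xss @ x @ w)))"
        using b list_all2_lengthD[OF xss(2)] len xss(1) by auto
      ultimately have "prv It S (binterp Q (isubst \<sigma> (IImp B A)) (appt (a @ g) (concat xss)) (x @ w))"
        using R \<sigma> xss(2) unfolding real_seq_def by blast
      then have "prv It S (IImp (bounded_binterp Q (isubst \<sigma> B) x (appt g (concat xss' @ w)))
          (binterp Q (isubst \<sigma> A) (appt a (concat xss')) w))"
        using xss a by (simp add: binterp_IImp appt_append appt_appt Wp_length)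
      moreover have "prv It S (bounded_binterp Q (isubst \<sigma> B) x (appt g (concat xss' @ w)))"
        using b list_all2_lengthD[OF xss(2)] len xss(1) by auto
      ultimately show ?thesis by (rule prv_mp)
    qed
    then show "real_seq (\<Gamma> @ [B]) A a (gs @ [g])"
      using R types unfolding real_seq_def by blast
  qed
qed

text \<open>Each step of the induction moves the last formula of the context across the turnstile.
  In the converse direction the tuple realizing the implication is cut into value and bound
  according to its types.\<close>

lemma real_seq_imps:
  assumes "\<forall>B\<in>set \<Gamma>. wfs B" "wfs A"
  shows "(\<exists>a gs. real_seq \<Gamma> A a gs) \<longleftrightarrow> realized (imps \<Gamma> A)"
  using assms
proof (induction \<Gamma> arbitrary: A rule: rev_induct)
  case Nil
  have "real_seq [] A a gs \<Longrightarrow> gs = []" for a gs by (simp add: real_seq_def)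
  then show ?case by (auto simp: realized_def)
next
  case (snoc B \<Gamma>)
  have "(\<exists>a gs. real_seq (\<Gamma> @ [B]) A a gs) \<longleftrightarrow> (\<exists>c gs. real_seq \<Gamma> (IImp B A) c gs)"
  proof
    assume "\<exists>a gs. real_seq (\<Gamma> @ [B]) A a gs"
    then obtain a gs' where *: "real_seq (\<Gamma> @ [B]) A a gs'" by blast
    then obtain gs g where "gs' = gs @ [g]"
      by (auto simp: real_seq_def list_all2_append1 list_all2_Cons1)
    moreover have "length a = length (bpos Q A)"
      using * by (auto simp: real_seq_def dest: Wt_length)
    ultimately show "\<exists>c gs. real_seq \<Gamma> (IImp B A) c gs"
      using * real_seq_snoc snoc.prems by auto
  next
    assume "\<exists>c gs. real_seq \<Gamma> (IImp B A) c gs"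
    then obtain c gs where *: "real_seq \<Gamma> (IImp B A) c gs" by blast
    then have "Wt (arrs (ctx_pos Q \<Gamma>) (arrs (bpos Q B) (bpos Q A)) @
        arrs (ctx_pos Q \<Gamma>) (arrs (bpos Q B) (arrs (bneg Q A) (hat Q (bneg Q B))))) c"
      by (simp add: real_seq_def arrs_append)
    then obtain a g where "c = a @ g" "length a = length (bpos Q A)"
      by (auto elim!: Wt_appendE dest: Wt_length)
    then show "\<exists>a gs. real_seq (\<Gamma> @ [B]) A a gs"
      using * real_seq_snoc[of a A B \<Gamma> gs g] snoc.prems by auto
  qed
  also have "\<dots> \<longleftrightarrow> realized (imps (\<Gamma> @ [B]) A)"
    using snoc.IH[of "IImp B A"] snoc.prems by simp
  finally show ?case .
qed

text \<open>The closed terms obtained by abstraction agree with \<open>a\<close> and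
  \<open>gs\<close> only up to provable equality. Replacement carries the hypotheses from the terms
  to the functions and the conclusion back from the functions to the terms.\<close>

lemma real_seqI:
  assumes wf: "\<forall>B\<in>set \<Gamma>. wfs B" "wfs A"
    and a: "definable (ctx_pos Q \<Gamma>) (bpos Q A) a"
    and gs: "list_all2 (\<lambda>B. definable (ctx_pos Q \<Gamma> @ bneg Q A) (hat Q (bneg Q B))) \<Gamma> gs"
    and main: "\<And>\<sigma> xss ws S. source_subst \<sigma> \<Longrightarrow> list_all2 (\<lambda>B. Wp S (bpos Q B)) \<Gamma> xss \<Longrightarrow>
      Wp S (bneg Q A) ws \<Longrightarrow>
      \<forall>(B, x, g)\<in>set (zip \<Gamma> (zip xss gs)).
         prv It S (bounded_binterp Q (isubst \<sigma> B) x (g (concat xss @ ws))) \<Longrightarrow>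
      prv It S (binterp Q (isubst \<sigma> A) (a (concat xss)) ws)"
  shows "realized (imps \<Gamma> A)"
proof -
  obtain a' where a': "Wt (arrs (ctx_pos Q \<Gamma>) (bpos Q A)) a'"
    "\<And>us. length us = length (ctx_pos Q \<Gamma>) \<Longrightarrow> \<forall>u\<in>set us. wft u \<Longrightarrow> list_all2 eqv (appt a' us) (a us)"
    using definable_realize[OF a] by blast
  let ?us = "\<lambda>us. length us = length (ctx_pos Q \<Gamma> @ bneg Q A) \<and> (\<forall>u\<in>set us. wft u)"
  have "\<forall>p\<in>set (zip \<Gamma> gs). \<exists>g'. Wt (arrs (ctx_pos Q \<Gamma> @ bneg Q A) (hat Q (bneg Q (fst p)))) g' \<and>
      (\<forall>us. ?us us \<longrightarrow> list_all2 eqv (appt g' us) (snd p us))"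
  proof
    fix p assume "p \<in> set (zip \<Gamma> gs)"
    then have "definable (ctx_pos Q \<Gamma> @ bneg Q A) (hat Q (bneg Q (fst p))) (snd p)"
      using gs by (auto simp: list_all2_iff)
    from definable_realize[OF this]
    show "\<exists>g'. Wt (arrs (ctx_pos Q \<Gamma> @ bneg Q A) (hat Q (bneg Q (fst p)))) g' \<and>
      (\<forall>us. ?us us \<longrightarrow> list_all2 eqv (appt g' us) (snd p us))" by blast
  qed
  from list_all2_choice[OF this] obtain gs' where gs': "list_all2 (\<lambda>p g'.
      Wt (arrs (ctx_pos Q \<Gamma> @ bneg Q A) (hat Q (bneg Q (fst p)))) g' \<and>
      (\<forall>us. ?us us \<longrightarrow> list_all2 eqv (appt g' us) (snd p us))) (zip \<Gamma> gs) gs'"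
    by blast
  have len: "length gs = length \<Gamma>" "length gs' = length \<Gamma>"
    using list_all2_lengthD[OF gs] list_all2_lengthD[OF gs'] by simp_all
  have gs'_nth: "Wt (arrs (ctx_pos Q \<Gamma> @ bneg Q A) (hat Q (bneg Q (\<Gamma> ! i)))) (gs' ! i)"
      "\<And>us. ?us us \<Longrightarrow> list_all2 eqv (appt (gs' ! i) us) ((gs ! i) us)" if "i < length \<Gamma>" for i
    using gs' that len by (auto simp: list_all2_conv_all_nth)
  have "real_seq \<Gamma> A a' gs'"
    unfolding real_seq_def
  proof (intro conjI allI impI)
    show "Wt (arrs (ctx_pos Q \<Gamma>) (bpos Q A)) a'" by (rule a')
    show "list_all2 (\<lambda>B. Wt (arrs (ctx_pos Q \<Gamma> @ bneg Q A) (hat Q (bneg Q B)))) \<Gamma> gs'"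
      using gs'_nth(1) len by (intro list_all2_all_nthI) auto
    fix \<sigma> xss ws S
    assume \<sigma>: "source_subst \<sigma>" and xss: "list_all2 (\<lambda>B. Wp S (bpos Q B)) \<Gamma> xss"
      and ws: "Wp S (bneg Q A) ws"
      and b: "\<forall>(B, x, g)\<in>set (zip \<Gamma> (zip xss gs')).
         prv It S (bounded_binterp Q (isubst \<sigma> B) x (appt g (concat xss @ ws)))"
    have us: "?us (concat xss @ ws)"
      using ctx_length[OF xss] ctx_wft[OF xss] Wp_length[OF ws] Wp_wft[OF ws] by auto
    have "prv It S (bounded_binterp Q (isubst \<sigma> (\<Gamma> ! i)) (xss ! i) ((gs ! i) (concat xss @ ws)))"
      if i: "i < length \<Gamma>" for i
    proof -
      have x: "Wp S (bpos Q (\<Gamma> ! i)) (xss ! i)" using xss i by (simp add: list_all2_conv_all_nth)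
      have "(\<Gamma> ! i, xss ! i, gs' ! i) \<in> set (zip \<Gamma> (zip xss gs'))"
        using i len list_all2_lengthD[OF xss] by (auto simp: set_zip)
      then have "prv It S (bounded_binterp Q (isubst \<sigma> (\<Gamma> ! i)) (xss ! i)
          (appt (gs' ! i) (concat xss @ ws)))"
        using b by fastforce
      moreover have "prv It {bounded_binterp Q (isubst \<sigma> (\<Gamma> ! i)) (xss ! i)
          (appt (gs' ! i) (concat xss @ ws))}
          (bounded_binterp Q (isubst \<sigma> (\<Gamma> ! i)) (xss ! i) ((gs ! i) (concat xss @ ws)))"
        using gs'_nth[OF i] us Wp_length[OF x] Wp_wft[OF x] wf i Wt_length[OF gs'_nth(1)[OF i]]
        by (intro bounded_eqv source_wfs \<sigma> eqv_refls) auto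
      ultimately show ?thesis by (rule prv_cut1)
    qed
    then have "\<forall>(B, x, g)\<in>set (zip \<Gamma> (zip xss gs)).
         prv It S (bounded_binterp Q (isubst \<sigma> B) x (g (concat xss @ ws)))"
      using len list_all2_lengthD[OF xss] by (auto simp: set_zip)
    from main[OF \<sigma> xss ws this]
    have "prv It S (binterp Q (isubst \<sigma> A) (a (concat xss)) ws)" .
    moreover have "prv It {binterp Q (isubst \<sigma> A) (a (concat xss)) ws}
        (binterp Q (isubst \<sigma> A) (appt a' (concat xss)) ws)"
    proof -
      have "list_all2 eqv (appt a' (concat xss)) (a (concat xss))"
        using a'(2) ctx_length[OF xss] ctx_wft[OF xss] by blast
      then have "list_all2 eqv (a (concat xss)) (appt a' (concat xss))"
        by (auto simp: list_all2_conv_all_nth intro: eqv_sym)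
      then show ?thesis
        using definable_length[OF a ctx_length[OF xss]] Wp_length[OF ws] Wp_wft[OF ws] wf
        by (intro binterp_eqv source_wfs \<sigma> eqv_refls) auto
    qed
    ultimately show "prv It S (binterp Q (isubst \<sigma> A) (appt a' (concat xss)) ws)"
      by (rule prv_cut1)
  qed
  then show ?thesis using real_seq_imps[OF wf] by blast
qed

end

section \<open>Realizers for propositional and quantifier axioms and rules\<close>

section \<open>Realization of the axioms and rules of a Hilbert system\<close>

context source_target
begin

lemma definable_take: "definable (\<tau>s @ \<sigma>s) \<tau>s (take (length \<tau>s))"
  using definable_block[of "[]" \<tau>s \<sigma>s] by simp

lemma definable_drop: "definable (\<rho>s @ \<tau>s) \<tau>s (\<lambda>us. take (length \<tau>s) (drop (length \<rho>s) us))"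
  using definable_block[of \<rho>s \<tau>s "[]"] by simp

lemma definable_id: "definable \<tau>s \<tau>s (take (length \<tau>s))"
  using definable_take[of \<tau>s "[]"] by simp

lemma definable_appt_const:
  "Wt (arrs \<sigma>s \<tau>s) cs \<Longrightarrow> definable \<rho>s \<sigma>s G \<Longrightarrow> definable \<rho>s \<tau>s (\<lambda>us. appt cs (G us))"
  by (rule definable_appt[OF definable_const])

lemma real_seq_single:
  assumes "realized (IImp A B)" "wfs A" "wfs B"
  obtains a g where "Wt (arrs (bpos Q A) (bpos Q B)) a"
    and "Wt (arrs (bpos Q A @ bneg Q B) (hat Q (bneg Q A))) g"
    and "\<And>\<sigma> x w S. source_subst \<sigma> \<Longrightarrow> Wp S (bpos Q A) x \<Longrightarrow> Wp S (bneg Q B) w \<Longrightarrow>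
      prv It S (bounded_binterp Q (isubst \<sigma> A) x (appt g (x @ w))) \<Longrightarrow>
      prv It S (binterp Q (isubst \<sigma> B) (appt a x) w)"
proof -
  have "realized (imps [A] B)" using assms by simp
  then obtain a gs where *: "real_seq [A] B a gs"
    using real_seq_imps[of "[A]" B] assms by auto
  then obtain g where "gs = [g]" by (auto simp: real_seq_def list_all2_Cons1)
  with * have a: "Wt (arrs (bpos Q A) (bpos Q B)) a"
    and g: "Wt (arrs (bpos Q A @ bneg Q B) (hat Q (bneg Q A))) g"
    and r: "\<And>\<sigma> xss w S. source_subst \<sigma> \<Longrightarrow> list_all2 (\<lambda>B. Wp S (bpos Q B)) [A] xss \<Longrightarrow> Wp S (bneg Q B) w \<Longrightarrow>
      \<forall>(C, x, g)\<in>set (zip [A] (zip xss [g])).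
         prv It S (bounded_binterp Q (isubst \<sigma> C) x (appt g (concat xss @ w))) \<Longrightarrow>
      prv It S (binterp Q (isubst \<sigma> B) (appt a (concat xss)) w)"
    unfolding real_seq_def by auto
  have "prv It S (binterp Q (isubst \<sigma> B) (appt a x) w)"
    if "source_subst \<sigma>" "Wp S (bpos Q A) x" "Wp S (bneg Q B) w"
      "prv It S (bounded_binterp Q (isubst \<sigma> A) x (appt g (x @ w)))" for \<sigma> x w S
    using r[of \<sigma> S "[x]" w] that by simp
  with a g that show thesis by blast
qed

lemma realizedE:
  assumes "realized A"
  obtains a where "Wt (bpos Q A) a"
    and "\<And>\<sigma> w S. source_subst \<sigma> \<Longrightarrow> Wp S (bneg Q A) w \<Longrightarrow> prv It S (binterp Q (isubst \<sigma> A) a w)"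
proof -
  obtain a where "real_seq [] A a []" using assms by (auto simp: realized_def)
  with that[of a] show thesis by (simp add: real_seq_def)
qed

lemma real_single:
  assumes "wfs A" "wfs B" "definable (bpos Q A) (bpos Q B) F"
    "definable (bpos Q A @ bneg Q B) (hat Q (bneg Q A)) G"
    "\<And>\<sigma> x w S. source_subst \<sigma> \<Longrightarrow> Wp S (bpos Q A) x \<Longrightarrow> Wp S (bneg Q B) w \<Longrightarrow>
      prv It S (bounded_binterp Q (isubst \<sigma> A) x (G (x @ w))) \<Longrightarrow>
      prv It S (binterp Q (isubst \<sigma> B) (F x) w)"
  shows "realized (IImp A B)"
proof -
  have "realized (imps [A] B)"
  proof (rule real_seqI[where a = F and gs = "[G]"])
    fix \<sigma> xss ws S
    assume *: "source_subst \<sigma>" "list_all2 (\<lambda>B. Wp S (bpos Q B)) [A] xss" "Wp S (bneg Q B) ws"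
      "\<forall>(B, x, g)\<in>set (zip [A] (zip xss [G])). prv It S (bounded_binterp Q (isubst \<sigma> B) x
          (g (concat xss @ ws)))"
    then obtain x where "xss = [x]" "Wp S (bpos Q A) x" by (auto simp: list_all2_Cons1)
    then show "prv It S (binterp Q (isubst \<sigma> B) (F (concat xss)) ws)"
      using assms(5)[of \<sigma> S x ws] * by simp
  qed (use assms in simp_all)
  then show ?thesis by simp
qed

lemma real_double:
  assumes "wfs A" "wfs B" "wfs C" "definable (bpos Q A @ bpos Q B) (bpos Q C) F"
    "definable (bpos Q A @ bpos Q B @ bneg Q C) (hat Q (bneg Q A)) G"
    "definable (bpos Q A @ bpos Q B @ bneg Q C) (hat Q (bneg Q B)) H"
    "\<And>\<sigma> x y w S. source_subst \<sigma> \<Longrightarrow> Wp S (bpos Q A) x \<Longrightarrow> Wp S (bpos Q B) y \<Longrightarrow> Wp S (bneg Q C) w \<Longrightarrow>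
      prv It S (bounded_binterp Q (isubst \<sigma> A) x (G (x @ y @ w))) \<Longrightarrow>
      prv It S (bounded_binterp Q (isubst \<sigma> B) y (H (x @ y @ w))) \<Longrightarrow>
      prv It S (binterp Q (isubst \<sigma> C) (F (x @ y)) w)"
  shows "realized (IImp A (IImp B C))"
proof -
  have "realized (imps [A, B] C)"
  proof (rule real_seqI[where a = F and gs = "[G, H]"])
    fix \<sigma> xss ws S
    assume *: "source_subst \<sigma>" "list_all2 (\<lambda>B. Wp S (bpos Q B)) [A, B] xss" "Wp S (bneg Q C) ws"
      "\<forall>(B, x, g)\<in>set (zip [A, B] (zip xss [G, H])).
        prv It S (bounded_binterp Q (isubst \<sigma> B) x (g (concat xss @ ws)))"
    then obtain x y where "xss = [x, y]" "Wp S (bpos Q A) x" "Wp S (bpos Q B) y"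
      by (auto simp: list_all2_Cons1)
    then show "prv It S (binterp Q (isubst \<sigma> C) (F (concat xss)) ws)"
      using assms(7)[of \<sigma> S x y ws] * by simp
  qed (use assms in simp_all)
  then show ?thesis by simp
qed

text \<open>The value is the superscript of the first \<open>A\<close>, and a challenge to the final
  \<open>A\<close> is wrapped by \<open>\<eta>\<close> into a bound for the first. Nothing is asked
  of \<open>B\<close>, so its bound is any inhabitant of \<open>W\<close>.\<close>

lemma realized_K:
  assumes "wfs A" "wfs B" shows "realized (IImp A (IImp B A))"
proof -
  obtain \<eta> where *: "eta_for A \<eta>" using ex_eta[OF assms(1)] by blast
  note \<eta> = eta_for_Wt[OF *] eta_for_prv[OF *]
  obtain b where b: "Wt (hat Q (bneg Q B)) b" using ex_Wt by blast
  have "definable (bpos Q A @ bpos Q B @ bneg Q A) (bneg Q A)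
      (\<lambda>us. take (length (bneg Q A)) (drop (length (bpos Q A @ bpos Q B)) us))"
    using definable_drop[of "bpos Q A @ bpos Q B"] by simp
  note G = definable_appt_const[OF \<eta>(1) this]
  show ?thesis
    by (rule real_double[OF assms assms(1) definable_take G definable_const[OF b]])
      (simp add: Wp_length \<eta>(2))
qed

text \<open>A challenge to the conjunction is a pair; each half, wrapped by the
  \<open>\<eta>\<close> of its conjunct, bounds the corresponding hypothesis.\<close>

lemma realized_andI:
  assumes "wfs A" "wfs B" shows "realized (IImp A (IImp B (IAnd A B)))"
proof -
  obtain \<eta> where *: "eta_for A \<eta>" using ex_eta[OF assms(1)] by blast
  note \<eta> = eta_for_Wt[OF *] eta_for_prv[OF *]
  obtain \<theta> where *: "eta_for B \<theta>" using ex_eta[OF assms(2)] by blast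
  note \<theta> = eta_for_Wt[OF *] eta_for_prv[OF *]
  let ?p = "bpos Q A @ bpos Q B"
  have F: "definable ?p (bpos Q (IAnd A B)) (take (length ?p))"
    using definable_id[of ?p] by simp
  have "definable (bpos Q A @ bpos Q B @ bneg Q (IAnd A B)) (bneg Q A)
      (\<lambda>us. take (length (bneg Q A)) (drop (length ?p) us))"
    using definable_block[of ?p "bneg Q A" "bneg Q B"] by simp
  note G = definable_appt_const[OF \<eta>(1) this]
  have "definable (bpos Q A @ bpos Q B @ bneg Q (IAnd A B)) (bneg Q B)
      (\<lambda>us. take (length (bneg Q B)) (drop (length (?p @ bneg Q A)) us))"
    using definable_drop[of "?p @ bneg Q A" "bneg Q B"] by simp
  note H = definable_appt_const[OF \<theta>(1) this]
  show ?thesis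
  proof (rule real_double[OF assms _ F G H])
    fix \<sigma> x y w S
    assume s: "source_subst \<sigma>" "Wp S (bpos Q A) x" "Wp S (bpos Q B) y"
        and w: "Wp S (bneg Q (IAnd A B)) w"
      and b: "prv It S (bounded_binterp Q (isubst \<sigma> A) x
          (appt \<eta> (take (length (bneg Q A)) (drop (length ?p) (x @ y @ w)))))"
        "prv It S (bounded_binterp Q (isubst \<sigma> B) y
          (appt \<theta> (take (length (bneg Q B)) (drop (length (?p @ bneg Q A)) (x @ y @ w)))))"
    obtain u v where uv: "w = u @ v" "Wp S (bneg Q A) u" "Wp S (bneg Q B) v"
      using w by (auto elim: Wp_appendE)
    have "prv It S (binterp Q (isubst \<sigma> A) x u)" "prv It S (binterp Q (isubst \<sigma> B) y v)"
      using s b uv by (auto intro!: \<eta>(2) \<theta>(2) simp: Wp_length)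
    then show "prv It S (binterp Q (isubst \<sigma> (IAnd A B)) (take (length ?p) (x @ y)) w)"
      using s uv by (simp add: binterp_IAnd Wp_length prv_andI)
  qed (use assms in simp)
qed

text \<open>A challenge to one conjunct is completed by an inhabitant of \<open>W\<close> to a
  challenge to the conjunction, then wrapped by \<open>\<eta>\<close>.\<close>

lemma realized_and:
  assumes "wfs A" "wfs B" shows "realized (IImp (IAnd A B) A)" and "realized (IImp (IAnd A B) B)"
proof -
  let ?C = "IAnd A B"
  have C: "wfs ?C" using assms by simp
  obtain \<eta> where *: "eta_for ?C \<eta>" using ex_eta[OF C] by blast
  note \<eta> = eta_for_Wt[OF *] eta_for_prv[OF *]
  obtain a b where a: "Wt (bneg Q A) a" and b: "Wt (bneg Q B) b" using ex_Wt by blast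
  have F: "definable (bpos Q ?C) (bpos Q A) (take (length (bpos Q A)))"
    "definable (bpos Q ?C) (bpos Q B) (\<lambda>us. take (length (bpos Q B)) (drop (length (bpos Q A)) us))"
    by (simp_all add: definable_take definable_drop)
  have "definable (bpos Q ?C @ bneg Q A) (bneg Q ?C)
      (\<lambda>us. take (length (bneg Q A)) (drop (length (bpos Q ?C)) us) @ b)"
    unfolding bneg_simps by (intro definable_append definable_drop definable_const b)
  note G = definable_appt_const[OF \<eta>(1) this]
  have "definable (bpos Q ?C @ bneg Q B) (bneg Q ?C)
      (\<lambda>us. a @ take (length (bneg Q B)) (drop (length (bpos Q ?C)) us))"
    unfolding bneg_simps by (intro definable_append definable_drop definable_const a)
  note H = definable_appt_const[OF \<eta>(1) this]
  show "realized (IImp ?C A)"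
  proof (rule real_single[OF C assms(1) F(1) G])
    fix \<sigma> x w S
    assume s: "source_subst \<sigma>" "Wp S (bpos Q ?C) x" "Wp S (bneg Q A) w"
      and "prv It S (bounded_binterp Q (isubst \<sigma> ?C) x
        (appt \<eta> (take (length (bneg Q A)) (drop (length (bpos Q ?C)) (x @ w)) @ b)))"
    then have "prv It S (binterp Q (isubst \<sigma> ?C) x (w @ b))"
      using Wt_Wp[OF b] by (intro \<eta>(2)) (auto simp: Wp_append Wp_length)
    then show "prv It S (binterp Q (isubst \<sigma> A) (take (length (bpos Q A)) x) w)"
      using s by (auto simp: binterp_IAnd Wp_length dest: prv_andD)
  qed
  show "realized (IImp ?C B)"
  proof (rule real_single[OF C assms(2) F(2) H])
    fix \<sigma> x w S
    assume s: "source_subst \<sigma>" "Wp S (bpos Q ?C) x" "Wp S (bneg Q B) w"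
      and "prv It S (bounded_binterp Q (isubst \<sigma> ?C) x
        (appt \<eta> (a @ take (length (bneg Q B)) (drop (length (bpos Q ?C)) (x @ w)))))"
    then have "prv It S (binterp Q (isubst \<sigma> ?C) x (a @ w))"
      using Wt_Wp[OF a] by (intro \<eta>(2)) (auto simp: Wp_append Wp_length)
    then show "prv It S (binterp Q (isubst \<sigma> B)
        (take (length (bpos Q B)) (drop (length (bpos Q A)) x)) w)"
      using s Wt_length[OF a] Wp_length[OF s(2)] by (auto simp: binterp_IAnd Wp_length dest: prv_andD)
  qed
qed

text \<open>Absurdity has no challenges, but as an antecedent it still stands under a bounded
  quantifier over the empty tuple, whose bound need not be empty. There \<open>\<eta>\<close> takes
  no arguments and is itself the bound; the value is an arbitrary inhabitant of
  \<open>W\<close>.\<close>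

lemma realized_bot:
  assumes "wfs A" shows "realized (IImp IBot A)"
proof -
  obtain \<eta> where *: "eta_for IBot \<eta>" using ex_eta[of IBot] by auto
  note \<eta> = eta_for_Wt[OF *] eta_for_prv[OF *]
  have \<eta>': "Wt (hat Q (bneg Q IBot)) \<eta>" using \<eta>(1) by simp
  obtain a where a: "Wt (bpos Q A) a" using ex_Wt by blast
  show ?thesis
  proof (rule real_single[OF _ assms definable_const[OF a] definable_const[OF \<eta>']])
    fix \<sigma> x w S
    assume s: "source_subst \<sigma>" "Wp S (bpos Q IBot) x" "Wp S (bneg Q A) w"
      and b: "prv It S (bounded_binterp Q (isubst \<sigma> IBot) x \<eta>)"
    have "prv It S (binterp Q (isubst \<sigma> IBot) x [])"
      using s b by (intro \<eta>(2)) (auto simp: Wp_def)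
    moreover have "wff (binterp Q (isubst \<sigma> A) a w)"
      using s a assms by (intro binterp_wff source_wfs) (auto intro: Wp_terms Wt_terms)
    ultimately show "prv It S (binterp Q (isubst \<sigma> A) a w)"
      by (auto intro: prv_botE)
  qed simp
qed

text \<open>No bound has to be computed: the realizer of \<open>A\<close> answers every challenge,
  in particular a tuple of fresh variables in \<open>W\<close>, so \<open>bounded_quantify\<close>
  without bounded antecedents proves \<open>A\<close> under whatever bound \<open>g\<close> asks
  for.\<close>

lemma realized_mp:
  assumes AB: "realized (IImp A B)" and A: "realized A" and wf: "wfs A" "wfs B"
  shows "realized B"
proof -
  obtain a where a: "Wt (bpos Q A) a"
    "\<And>\<sigma> w S. source_subst \<sigma> \<Longrightarrow> Wp S (bneg Q A) w \<Longrightarrow> prv It S (binterp Q (isubst \<sigma> A) a w)"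
    using realizedE[OF A] by blast
  obtain b g where b: "Wt (arrs (bpos Q A) (bpos Q B)) b"
    and g: "Wt (arrs (bpos Q A @ bneg Q B) (hat Q (bneg Q A))) g"
    and r: "\<And>\<sigma> x w S. source_subst \<sigma> \<Longrightarrow> Wp S (bpos Q A) x \<Longrightarrow> Wp S (bneg Q B) w \<Longrightarrow>
      prv It S (bounded_binterp Q (isubst \<sigma> A) x (appt g (x @ w))) \<Longrightarrow>
      prv It S (binterp Q (isubst \<sigma> B) (appt b x) w)"
    using real_seq_single[OF AB wf] by blast
  let ?n = "length (bneg Q A)"
  have "realized (imps [] B)"
  proof (rule real_seqI[where a = "\<lambda>_. appt b a" and gs = "[]"])
    show "definable (ctx_pos Q []) (bpos Q B) (\<lambda>_. appt b a)"
      by (intro definable_appt_const[OF b] definable_const a)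
    fix \<sigma> xss ws S
    assume \<sigma>: "source_subst \<sigma>" and ws: "Wp S (bneg Q B) ws"
    let ?as = "appt g (a @ ws)"
    have as: "bound_terms A ?as"
      using Wt_terms[OF g] Wt_terms[OF a(1)] Wp_terms[OF ws] by (auto simp: terms_of_def appt_def)
    \<comment> \<open>Using the realizer at the shifted substitution keeps the lowest
      \<open>?n\<close> variables free to act as the challenge that is then bound.\<close>
    have "prv It (Ws (bneg Q A) (vars ?n)) (binterp Q (isubst (\<lambda>i. tshift ?n (\<sigma> i)) A) a (vars ?n))"
      using \<sigma> by (intro a(2)) (auto intro!: Wp_hyp)
    moreover have "isubst (\<lambda>i. tshift ?n (\<sigma> i)) A = ishift ?n (isubst \<sigma> A)"
      by (simp add: ishift_def isubst_isubst tshift_def)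
    ultimately have "prv It (Ws [] (map (tshift ?n) []) \<union> Ws (bneg Q A) (vars ?n) \<union>
        (\<lambda>(B, x, b). bounded_binterp Q B x b) ` set []) (binterp Q (ishift ?n (isubst \<sigma> A)) a (vars ?n))"
      by simp
    from bounded_quantify[OF as _ _ _ _ _ this]
    have "prv It {} (BQ Q (bneg Q A) ?as (binterp Q (ishift ?n (isubst \<sigma> A)) a (vars ?n)))"
      using source_wfs[OF \<sigma> wf(1)] Wt_terms[OF a(1)] by (simp add: terms_of_def)
    then have "prv It S (bounded_binterp Q (isubst \<sigma> A) a ?as)"
      using Wt_tshift[OF a(1)] by (auto simp: bounded_binterp_def Let_def intro: prv_mono)
    then have "prv It S (binterp Q (isubst \<sigma> B) (appt b a) ws)"
      using r \<sigma> ws Wt_Wp[OF a(1)] by blast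
    then show "prv It S (binterp Q (isubst \<sigma> B) ((\<lambda>_. appt b a) (concat xss)) ws)" .
  qed (use wf in simp_all)
  then show ?thesis by simp
qed

text \<open>Instantiation does not change witnessing types, so the value is passed on unchanged;
  \<open>\<eta>\<close> only removes the bounded quantifier around the hypothesis.\<close>

lemma realized_allE:
  assumes "wfs A" "twf (lang Is) t" shows "realized (IImp (IAll A) (isubst (inst [t]) A))"
proof -
  have A: "wfs (IAll A)" using assms by simp
  obtain \<eta> where *: "eta_for (IAll A) \<eta>" using ex_eta[OF A] by blast
  note \<eta> = eta_for_Wt[OF *] eta_for_prv[OF *]
  have F: "definable (bpos Q (IAll A)) (bpos Q (isubst (inst [t]) A)) (take (length (bpos Q A)))"
    by (simp add: definable_id)
  have "definable (bpos Q (IAll A) @ bneg Q (isubst (inst [t]) A)) (bneg Q (IAll A))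
      (\<lambda>us. take (length (bneg Q A)) (drop (length (bpos Q A)) us))"
    using definable_drop[of "bpos Q A" "bneg Q A"] by simp
  note G = definable_appt_const[OF \<eta>(1) this]
  show ?thesis
  proof (rule real_single[OF A _ F G])
    show "wfs (isubst (inst [t]) A)" using assms by (intro iwf_isubst twf_inst) auto
    fix \<sigma> x w S
    assume s: "source_subst \<sigma>" "Wp S (bpos Q (IAll A)) x" "Wp S (bneg Q (isubst (inst [t]) A)) w"
      and b: "prv It S (bounded_binterp Q (isubst \<sigma> (IAll A)) x
        (appt \<eta> (take (length (bneg Q A)) (drop (length (bpos Q A)) (x @ w)))))"
    have "prv It S (binterp Q (isubst \<sigma> (IAll A)) x w)"
      using s b by (intro \<eta>(2)) (auto simp: Wp_length)
    then have *: "prv It S (IAll (binterp Q (isubst (ups 1 \<sigma>) A) (map (tshift 1) x) (map (tshift 1) w)))"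
      by simp
    let ?t = "tsubst \<sigma> t"
    have t: "wft ?t" using assms(2) s(1) by (intro wfs_wft twf_tsubst) auto
    have "wfs (isubst (ups 1 \<sigma>) A)" using assms s by (intro iwf_isubst twf_ups) auto
    then have "isubst (inst [?t]) (binterp Q (isubst (ups 1 \<sigma>) A) (map (tshift 1) x)
        (map (tshift 1) w)) =
        binterp Q (isubst (inst [?t]) (isubst (ups 1 \<sigma>) A)) (map (tsubst (inst [?t])) (map (tshift 1) x))
          (map (tsubst (inst [?t])) (map (tshift 1) w))"
      using s t Wp_terms[OF s(2)] Wp_terms[OF s(3)] by (intro binterp_subst twf_inst) auto
    also have "\<dots> = binterp Q (isubst \<sigma> (isubst (inst [t]) A)) x w"
      by (simp add: isubst_isubst_inst o_def)
    finally show "prv It S (binterp Q (isubst \<sigma> (isubst (inst [t]) A)) (take (length (bpos Q A)) x) w)"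
      using prv_allE[OF * t] Wp_length[OF s(2)] by simp
  qed
qed

text \<open>Because \<open>star\<close> bangs the body of an existential, a challenge to the
  conclusion already is a bound for the hypothesis, and no \<open>\<eta>\<close> is needed.\<close>

lemma realized_exI:
  assumes "wfs A" "twf (lang Is) t" shows "realized (IImp (isubst (inst [t]) A) (IEx A))"
proof -
  let ?A = "isubst (inst [t]) A"
  have F: "definable (bpos Q ?A) (bpos Q (IEx A)) (take (length (bpos Q A)))"
    by (simp add: definable_id)
  have G: "definable (bpos Q ?A @ bneg Q (IEx A)) (hat Q (bneg Q ?A))
      (\<lambda>us. take (length (hat Q (bneg Q A))) (drop (length (bpos Q A)) us))"
    using definable_drop[of "bpos Q A" "hat Q (bneg Q A)"] by simp
  show ?thesis
  proof (rule real_single[OF _ _ F G])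
    show "wfs ?A" using assms by (intro iwf_isubst twf_inst) auto
    fix \<sigma> x w S
    assume s: "source_subst \<sigma>" "Wp S (bpos Q ?A) x" "Wp S (bneg Q (IEx A)) w"
      and b: "prv It S (bounded_binterp Q (isubst \<sigma> ?A) x
        (take (length (hat Q (bneg Q A))) (drop (length (bpos Q A)) (x @ w))))"
    let ?t = "tsubst \<sigma> t" and ?B = "bounded_binterp Q (isubst (ups 1 \<sigma>) A) (map (tshift 1) x)
        (map (tshift 1) w)"
    have t: "wft ?t" using assms(2) s(1) by (intro wfs_wft twf_tsubst) auto
    have wf: "wfs (isubst (ups 1 \<sigma>) A)" using assms s by (intro iwf_isubst twf_ups) auto
    then have "isubst (inst [?t]) ?B =
        bounded_binterp Q (isubst (inst [?t]) (isubst (ups 1 \<sigma>) A)) (map (tsubst (inst [?t]))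
            (map (tshift 1) x))
          (map (tsubst (inst [?t])) (map (tshift 1) w))"
      using s t Wp_terms[OF s(2)] Wp_terms[OF s(3)] by (intro bounded_subst twf_inst) auto
    also have "\<dots> = bounded_binterp Q (isubst \<sigma> ?A) x w"
      by (simp add: isubst_isubst_inst o_def)
    finally have "prv It S (isubst (inst [?t]) ?B)"
      using b Wp_length[OF s(2)] Wp_length[OF s(3)] by simp
    moreover have "wff ?B"
      using wf Wp_terms[OF s(2)] Wp_terms[OF s(3)] by (intro bounded_wff) auto
    ultimately have "prv It S (IEx ?B)" using t by (rule prv_exI)
    then show "prv It S (binterp Q (isubst \<sigma> (IEx A)) (take (length (bpos Q A)) x) w)"
      using Wp_length[OF s(2)] by simp
  qed (use assms in simp)
qed

lemma Wp_shift: "Wp S \<tau>s ts \<Longrightarrow> Wp (ishift n ` S) \<tau>s (map (tshift n) ts)"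
  unfolding Wp_def list_all2_map2
proof (elim list_all2_mono conjE, intro conjI)
  fix \<tau> t assume t: "wft t" "prv It S (iW Q \<tau> t)"
  then show "wft (tshift n t)" by simp
  show "prv It (ishift n ` S) (iW Q \<tau> (tshift n t))"
    using prv_subst[OF t(2), of "\<lambda>i. Var (i + n)"] by (simp add: ishift_def[abs_def] tshift_def)
qed

lemma prv_shift: "prv It S A \<Longrightarrow> prv It (ishift n ` S) (ishift n A)"
  using prv_subst[of S A "\<lambda>i. Var (i + n)"] by (simp add: ishift_def[abs_def])

lemma bounded_shift:
  "wfs A \<Longrightarrow> pos_terms A xs \<Longrightarrow> bound_terms A as \<Longrightarrow>
    ishift n (bounded_binterp Q A xs as) = bounded_binterp Q (ishift n A) (map (tshift n) xs)
        (map (tshift n) as)"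
  unfolding ishift_def tshift_def by (rule bounded_subst) auto

lemma binterp_shift:
  "wfs A \<Longrightarrow> pos_terms A xs \<Longrightarrow> neg_terms A ys \<Longrightarrow>
    ishift n (binterp Q A xs ys) = binterp Q (ishift n A) (map (tshift n) xs) (map (tshift n) ys)"
  unfolding ishift_def tshift_def by (rule binterp_subst) auto

text \<open>The realizers are kept. They are closed, hence unaffected by the shift, and the premise
  is used with \<open>ups 1 \<sigma>\<close> and the shifted hypotheses, which leaves variable 0 as
  eigenvariable.\<close>

lemma realized_allI:
  assumes r: "realized (IImp (ishift 1 A) B)" and wf: "wfs A" "wfs B"
  shows "realized (IImp A (IAll B))"
proof -
  obtain b g where b: "Wt (arrs (bpos Q A) (bpos Q B)) b"
    and g: "Wt (arrs (bpos Q A @ bneg Q B) (hat Q (bneg Q A))) g"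
    and r: "\<And>\<sigma> x w S. source_subst \<sigma> \<Longrightarrow> Wp S (bpos Q A) x \<Longrightarrow> Wp S (bneg Q B) w \<Longrightarrow>
      prv It S (bounded_binterp Q (isubst \<sigma> (ishift 1 A)) x (appt g (x @ w))) \<Longrightarrow>
      prv It S (binterp Q (isubst \<sigma> B) (appt b x) w)"
    using real_seq_single[OF r] wf by (simp only: iwf_ishift bpos_ishift bneg_ishift) blast
  have F: "definable (bpos Q A) (bpos Q (IAll B)) (\<lambda>us. appt b (take (length (bpos Q A)) us))"
    using definable_appt_const[OF b definable_id] by simp
  have G: "definable (bpos Q A @ bneg Q (IAll B)) (hat Q (bneg Q A))
      (\<lambda>us. appt g (take (length (bpos Q A @ bneg Q B)) us))"
    using definable_appt_const[OF g definable_id] by simp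
  show ?thesis
  proof (rule real_single[OF wf(1) _ F G])
    fix \<sigma> x w S
    assume s: "source_subst \<sigma>" "Wp S (bpos Q A) x" "Wp S (bneg Q (IAll B)) w"
      and p: "prv It S (bounded_binterp Q (isubst \<sigma> A) x
          (appt g (take (length (bpos Q A @ bneg Q B)) (x @ w))))"
    let ?x = "map (tshift 1) x" and ?w = "map (tshift 1) w"
    have len: "length x = length (bpos Q A)" "length w = length (bneg Q B)"
      using Wp_length[OF s(2)] Wp_length[OF s(3)] by auto
    have "bound_terms A (appt g (x @ w))"
      using Wt_terms[OF g] Wp_terms[OF s(2)] Wp_terms[OF s(3)] by (auto simp: terms_of_def appt_def)
    then have "ishift 1 (bounded_binterp Q (isubst \<sigma> A) x (appt g (x @ w))) =
        bounded_binterp Q (ishift 1 (isubst \<sigma> A)) ?x (map (tshift 1) (appt g (x @ w)))"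
      using source_wfs[OF s(1) wf(1)] Wp_terms[OF s(2)] by (intro bounded_shift) auto
    then have "ishift 1 (bounded_binterp Q (isubst \<sigma> A) x (appt g (x @ w))) =
        bounded_binterp Q (isubst (ups 1 \<sigma>) (ishift 1 A)) ?x (appt g (?x @ ?w))"
      by (simp only: isubst_ups_ishift map_tshift_appt Wt_tshift[OF g] map_append)
    moreover have "prv It (ishift 1 ` S) (ishift 1 (bounded_binterp Q (isubst \<sigma> A) x (appt g (x @ w))))"
      using prv_shift[OF p, of 1] len by simp
    ultimately have "prv It (ishift 1 ` S) (bounded_binterp Q (isubst (ups 1 \<sigma>) (ishift 1 A)) ?x
        (appt g (?x @ ?w)))"
      by simp
    moreover have "source_subst (ups 1 \<sigma>)" using s(1) by (auto intro: twf_ups)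
    moreover have "Wp (ishift 1 ` S) (bpos Q A) ?x" "Wp (ishift 1 ` S) (bneg Q B) ?w"
      using Wp_shift[OF s(2)] Wp_shift[OF s(3)] by simp_all
    ultimately have "prv It (ishift 1 ` S) (binterp Q (isubst (ups 1 \<sigma>) B) (appt b ?x) ?w)"
      by (intro r)
    then have "prv It S (IAll (binterp Q (isubst (ups 1 \<sigma>) B) (appt b ?x) ?w))"
      by (rule prv_allI)
    moreover have "appt b ?x = map (tshift 1) (appt b x)"
      by (simp only: map_tshift_appt Wt_tshift[OF b])
    ultimately show "prv It S (binterp Q (isubst \<sigma> (IAll B)) (appt b (take (length (bpos Q A)) x)) w)"
      using len by simp
  qed (use wf in simp)
qed

text \<open>As an antecedent the existential stands under a bounded quantifier whose variables are
  themselves bounds for \<open>A\<close>. The bound requested by \<open>g\<close> is therefore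
  wrapped once more by the \<open>\<eta>\<close> of the existential formula.\<close>

lemma realized_exE:
  assumes r: "realized (IImp A (ishift 1 B))" and wf: "wfs A" "wfs B"
  shows "realized (IImp (IEx A) B)"
proof -
  obtain b g where b: "Wt (arrs (bpos Q A) (bpos Q B)) b"
    and g: "Wt (arrs (bpos Q A @ bneg Q B) (hat Q (bneg Q A))) g"
    and r: "\<And>\<sigma> x w S. source_subst \<sigma> \<Longrightarrow> Wp S (bpos Q A) x \<Longrightarrow> Wp S (bneg Q B) w \<Longrightarrow>
      prv It S (bounded_binterp Q (isubst \<sigma> A) x (appt g (x @ w))) \<Longrightarrow>
      prv It S (binterp Q (isubst \<sigma> (ishift 1 B)) (appt b x) w)"
    using real_seq_single[OF r] wf by (simp only: iwf_ishift bpos_ishift bneg_ishift) blast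
  have E: "wfs (IEx A)" using wf by simp
  obtain \<eta> where *: "eta_for (IEx A) \<eta>" using ex_eta[OF E] by blast
  note \<eta> = eta_for_Wt[OF *] eta_for_prv[OF *]
  have F: "definable (bpos Q (IEx A)) (bpos Q B) (\<lambda>us. appt b (take (length (bpos Q A)) us))"
    using definable_appt_const[OF b definable_id] by simp
  have "definable (bpos Q (IEx A) @ bneg Q B) (bneg Q (IEx A))
      (\<lambda>us. appt g (take (length (bpos Q A @ bneg Q B)) us))"
    using definable_appt_const[OF g definable_id] by simp
  note G = definable_appt_const[OF \<eta>(1) this]
  show ?thesis
  proof (rule real_single[OF E wf(2) F G])
    fix \<sigma> x w S
    assume s: "source_subst \<sigma>" "Wp S (bpos Q (IEx A)) x" "Wp S (bneg Q B) w"
      and p: "prv It S (bounded_binterp Q (isubst \<sigma> (IEx A)) x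
        (appt \<eta> (appt g (take (length (bpos Q A @ bneg Q B)) (x @ w)))))"
    let ?x = "map (tshift 1) x" and ?w = "map (tshift 1) w"
    have x: "Wp S (bpos Q A) x" using s by simp
    have len: "length x = length (bpos Q A)" "length w = length (bneg Q B)"
      using Wp_length[OF x] Wp_length[OF s(3)] by auto
    have xw: "Wp S (bpos Q A @ bneg Q B) (x @ w)" using x s(3) len by (simp add: Wp_append)
    have "Wp S (hat Q (bneg Q A)) (appt g (take (length (bpos Q A @ bneg Q B)) (x @ w)))"
      by (rule definable_Wp[OF definable_appt_const[OF g definable_id] xw])
    then have "prv It S (binterp Q (isubst \<sigma> (IEx A)) x (appt g (x @ w)))"
      using s p len by (intro \<eta>(2)) auto
    then have ex: "prv It S (IEx (bounded_binterp Q (isubst (ups 1 \<sigma>) A) ?x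
        (map (tshift 1) (appt g (x @ w)))))"
      (is "prv It S (IEx ?B)") by simp
    have B: "?B = bounded_binterp Q (isubst (ups 1 \<sigma>) A) ?x (appt g (?x @ ?w))"
      by (simp only: map_tshift_appt Wt_tshift[OF g] map_append)
    have "prv It (insert ?B (ishift 1 ` S)) (binterp Q (isubst (ups 1 \<sigma>) (ishift 1 B)) (appt b ?x) ?w)"
    proof (rule r)
      show "source_subst (ups 1 \<sigma>)" using s(1) by (auto intro: twf_ups)
      show "Wp (insert ?B (ishift 1 ` S)) (bpos Q A) ?x" "Wp (insert ?B (ishift 1 ` S)) (bneg Q B) ?w"
        by (rule Wp_mono[OF Wp_shift[OF x]] Wp_mono[OF Wp_shift[OF s(3)]]; auto)+
      show "prv It (insert ?B (ishift 1 ` S)) (bounded_binterp Q (isubst (ups 1 \<sigma>) A) ?x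
          (appt g (?x @ ?w)))"
        unfolding B[symmetric] using prv_wf[OF ex] by (intro prv_hyp) auto
    qed
    moreover have "binterp Q (isubst (ups 1 \<sigma>) (ishift 1 B)) (appt b ?x) ?w =
        ishift 1 (binterp Q (isubst \<sigma> B) (appt b x) w)"
    proof -
      have "pos_terms B (appt b x)"
        using Wt_terms[OF b] Wp_terms[OF x] by (auto simp: terms_of_def appt_def)
      then have "ishift 1 (binterp Q (isubst \<sigma> B) (appt b x) w) =
          binterp Q (ishift 1 (isubst \<sigma> B)) (map (tshift 1) (appt b x)) ?w"
        using source_wfs[OF s(1) wf(2)] Wp_terms[OF s(3)] by (intro binterp_shift) auto
      then show ?thesis by (simp only: isubst_ups_ishift map_tshift_appt Wt_tshift[OF b])
    qed
    ultimately have "prv It S (binterp Q (isubst \<sigma> B) (appt b x) w)"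
      using prv_exE[OF ex] by simp
    then show "prv It S (binterp Q (isubst \<sigma> B) (appt b (take (length (bpos Q A)) x)) w)"
      using len by simp
  qed
qed

text \<open>Modus ponens inside the bounded quantifier over challenges \<open>y\<close> to
  \<open>B\<close>. For \<open>y\<close> below \<open>z\<close>, the hypothesis on the implication
  is unwrapped by \<open>\<eta>\<close> at its challenge \<open>x, y\<close>, and the bound
  \<open>v2 x y\<close> it requests for \<open>A\<close> is the one supplied under the
  quantifier.\<close>

lemma bounded_mp:
  assumes wf: "wfs A" "wfs B" and s: "source_subst \<sigma>"
    and x: "Wp S (bpos Q A) x" and v: "Wp S (bpos Q (IImp A B)) (v1 @ v2)" "length v1 =
        length (bpos Q B)"
    and z: "Wp S (hat Q (bneg Q B)) z"
    and eta: "eta_for (IImp A B) \<eta>"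
  defines "r \<equiv> length (bneg Q B)"
  assumes AB: "prv It S (BQ Q (bneg Q B) z (bounded_binterp Q (ishift r (isubst \<sigma> (IImp A B)))
      (map (tshift r) (v1 @ v2)) (appt (map (tshift r) (appt \<eta> x)) (vars r))))"
    and A: "prv It S (BQ Q (bneg Q B) z (bounded_binterp Q (ishift r (isubst \<sigma> A))
      (map (tshift r) x) (appt (map (tshift r) (appt v2 x)) (vars r))))"
  shows "prv It S (bounded_binterp Q (isubst \<sigma> B) (appt v1 x) z)"
proof -
  note \<eta> = eta_for_Wt[OF eta] eta_for_prv[OF eta]
  let ?Y = "IImp A B" and ?\<sigma> = "\<lambda>i. tshift r (\<sigma> i)" and ?x = "map (tshift r) x"
    and ?v1 = "map (tshift r) v1" and ?v2 = "map (tshift r) v2"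
  have \<sigma>': "isubst ?\<sigma> C = ishift r (isubst \<sigma> C)" for C :: "('f, 'p) ifm"
    by (simp add: ishift_def isubst_isubst tshift_def)
  have s': "source_subst ?\<sigma>" using s by simp
  have len: "length x = length (bpos Q A)" using x by (rule Wp_length)
  have v12: "pos_terms B v1"
    "bound_terms A v2"
    using Wp_terms[OF v(1)] v(2) by (auto simp: terms_of_def)
  let ?bY = "bounded_binterp Q (ishift r (isubst \<sigma> ?Y)) (map (tshift r) (v1 @ v2))
      (appt (map (tshift r) (appt \<eta> x)) (vars r))"
    and ?bA = "bounded_binterp Q (ishift r (isubst \<sigma> A)) ?x (appt (map (tshift r) (appt v2 x)) (vars r))"
  let ?Bs = "[(ishift r (isubst \<sigma> ?Y), map (tshift r) (v1 @ v2), appt (map (tshift r) (appt \<eta> x))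
      (vars r)),
      (ishift r (isubst \<sigma> A), ?x, appt (map (tshift r) (appt v2 x)) (vars r))]"
  \<comment> \<open>\<open>Q1\<close> carries assumptions \<open>!W\<close> along; they keep
    \<open>x\<close>, \<open>v1\<close> and \<open>v2\<close> in \<open>W\<close> inside the
    quantifier.\<close>
  let ?zs = "x @ v1 @ v2" and ?\<sigma>s = "bpos Q A @ bpos Q ?Y"
  let ?S = "Ws ?\<sigma>s (map (tshift r) ?zs) \<union> Ws (bneg Q B) (vars r) \<union>
      (\<lambda>(B, x, b). bounded_binterp Q B x b) ` set ?Bs"
  have zs: "Wp S ?\<sigma>s ?zs" using x v by (simp add: Wp_append len)
  have zs': "terms (length ?\<sigma>s) ?zs" by (rule Wp_terms[OF zs])
  have Bs: "\<forall>(B, x, b)\<in>set ?Bs. wfs B \<and> pos_terms B x \<and> bound_terms B b"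
    using source_wfs[OF s] wf Wp_terms[OF x] Wp_terms[OF v(1)] Wt_terms[OF \<eta>(1)] v12
    by (auto simp: terms_of_def appt_def)
  have "Wp ?S ?\<sigma>s (map (tshift r) ?zs)"
    using zs' by (intro Wp_hyp) (auto simp: terms_of_def)
  then have px: "Wp ?S (bpos Q A) ?x" and pv: "Wp ?S (bpos Q ?Y) (map (tshift r) (v1 @ v2))"
    using Wp_append[of ?x "bpos Q A" ?S "bpos Q ?Y" "map (tshift r) (v1 @ v2)"] len by simp_all
  have pr: "Wp ?S (bneg Q B) (vars r)" by (intro Wp_hyp) (auto simp: r_def)
  have wfb: "\<forall>C\<in>(\<lambda>(B, x, b). bounded_binterp Q B x b) ` set ?Bs. wff C"
    using Bs by (auto intro: bounded_wff)
  have "prv It ?S ?bY" using wfb by (intro prv_hyp) auto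
  moreover have "appt (map (tshift r) (appt \<eta> x)) (vars r) = appt \<eta> (?x @ vars r)"
    by (simp only: map_tshift_appt Wt_tshift[OF \<eta>(1)] appt_appt)
  ultimately have "prv It ?S (bounded_binterp Q (isubst ?\<sigma> ?Y) (map (tshift r) (v1 @ v2))
      (appt \<eta> (?x @ vars r)))"
    by (simp only: \<sigma>')
  moreover have "Wp ?S (bneg Q ?Y) (?x @ vars r)" using px pr len by (simp add: Wp_append)
  ultimately have "prv It ?S (binterp Q (isubst ?\<sigma> ?Y) (map (tshift r) (v1 @ v2)) (?x @ vars r))"
    by (intro \<eta>(2) s' pv)
  then have "prv It ?S (IImp (bounded_binterp Q (isubst ?\<sigma> A) ?x (appt ?v2 (?x @ vars r)))
      (binterp Q (isubst ?\<sigma> B) (appt ?v1 ?x) (vars r)))"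
    using v(2) len binterp_IImp[of ?v1 Q "isubst ?\<sigma> B" ?x "isubst ?\<sigma> A" ?v2 "vars r"] by simp
  moreover have "prv It ?S ?bA" using wfb by (intro prv_hyp) auto
  then have "prv It ?S (bounded_binterp Q (isubst ?\<sigma> A) ?x (appt ?v2 (?x @ vars r)))"
    by (simp only: map_tshift_appt appt_appt \<sigma>')
  ultimately have "prv It ?S (binterp Q (isubst ?\<sigma> B) (appt ?v1 ?x) (vars r))"
    by (rule prv_mp)
  then have "prv It ?S (binterp Q (ishift r (isubst \<sigma> B)) (map (tshift r) (appt v1 x)) (vars r))"
    by (simp only: \<sigma>' map_tshift_appt)
  then have "prv It (Ws ?\<sigma>s ?zs \<union> (\<lambda>(C, x, b). BQ Q (bneg Q B) z (bounded_binterp Q C x b)) ` set ?Bs)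
      (BQ Q (bneg Q B) z (binterp Q (ishift r (isubst \<sigma> B)) (map (tshift r) (appt v1 x)) (vars r)))"
    using source_wfs[OF s wf(2)] Wp_terms[OF z] zs' Wp_terms[OF x] v12 Bs unfolding r_def
    by (intro bounded_quantify) (auto simp: terms_appt)
  then have "prv It (Ws ?\<sigma>s ?zs \<union> (\<lambda>(C, x, b). BQ Q (bneg Q B) z (bounded_binterp Q C x b)) ` set ?Bs)
      (bounded_binterp Q (isubst \<sigma> B) (appt v1 x) z)"
    by (simp add: bounded_binterp_def Let_def r_def)
  then show ?thesis
  proof (rule prv_cuts)
    fix C assume "C \<in> Ws ?\<sigma>s ?zs \<union> (\<lambda>(C, x, b). BQ Q (bneg Q B) z (bounded_binterp Q C x b)) ` set ?Bs"
    then show "prv It S C" using Wp_prv[OF zs] AB A by (auto simp del: map_append)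
  qed
qed

text \<open>Let the superscripts be \<open>u1, u2, u3\<close>, \<open>v1, v2\<close> and
  \<open>x\<close>, let \<open>w\<close> be the challenge, and put \<open>y = v1 x\<close>,
  \<open>z = u2 x y w\<close>. The value is \<open>u1 x y\<close>. The inner implication wants
  \<open>B\<close> below \<open>z\<close>, which \<open>bounded_mp\<close> provides. The bounds are
  \<open>\<eta> x y w\<close> for the first premise, \<open>d (\<theta> x) z\<close> for the second
  and \<open>j (u3 x y w) (c (v2 x) z)\<close> for \<open>A\<close>: here \<open>c\<close> and
  \<open>d\<close> promote \<open>A\<close> and \<open>IImp A B\<close> below \<open>z\<close>, and
  \<open>j\<close> serves the two uses of \<open>A\<close>.\<close>

lemma realized_S:
  assumes wf: "wfs A" "wfs B" "wfs C"
  shows "realized (IImp (IImp A (IImp B C)) (IImp (IImp A B) (IImp A C)))"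
proof -
  let ?X = "IImp A (IImp B C)" and ?Y = "IImp A B"
  define pA pB pC nA nB nC hA hB where defs: "pA = bpos Q A" "pB = bpos Q B" "pC = bpos Q C"
    "nA = bneg Q A" "nB = bneg Q B" "nC = bneg Q C" "hA = hat Q nA" "hB = hat Q nB"
  \<comment> \<open>Uncurried component types: value, bound for \<open>B\<close> and bound for
    \<open>A\<close> in the first premise; value and bound for \<open>A\<close> in the
    second.\<close>
  define U1 U2 U3 V1 V2 where U: "U1 = arrs (pA @ pB) pC" "U2 = arrs (pA @ pB @ nC) hB"
    "U3 = arrs (pA @ pB @ nC) hA" and V: "V1 = arrs pA pB" "V2 = arrs (pA @ nB) hA"
  have X: "wfs ?X" and Y: "wfs ?Y" using wf by simp_all
  have posX: "bpos Q ?X = U1 @ U2 @ U3" and posY: "bpos Q ?Y = V1 @ V2"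
    and negX: "bneg Q ?X = pA @ pB @ nC" and negY: "bneg Q ?Y = pA @ nB"
    by (simp_all add: defs U V arrs_append arrs_arrs)
  obtain \<eta> where *: "eta_for ?X \<eta>" using ex_eta[OF X] by blast
  note \<eta> = eta_for_Wt[OF *] eta_for_prv[OF *]
  obtain \<theta> where *: "eta_for ?Y \<theta>" using ex_eta[OF Y] by blast
  note eta_Y = * and \<theta> = eta_for_Wt[OF *] eta_for_prv[OF *]
  obtain j where j: "Wt (arrs hA (arrs hA hA)) j"
    "\<And>\<sigma> x as bs S. source_subst \<sigma> \<Longrightarrow> Wp S pA x \<Longrightarrow> Wp S hA as \<Longrightarrow> Wp S hA bs \<Longrightarrow>
      prv It S (bounded_binterp Q (isubst \<sigma> A) x (appt j (as @ bs))) \<Longrightarrow>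
      prv It S (bounded_binterp Q (isubst \<sigma> A) x as) \<and> prv It S (bounded_binterp Q (isubst \<sigma> A) x bs)"
    using bounded_join[OF wf(1)] unfolding defs by blast
  obtain c where c: "Wt (arrs (arrs nB hA) (arrs hB hA)) c"
    "\<And>\<sigma> x fs zs S. source_subst \<sigma> \<Longrightarrow> Wp S pA x \<Longrightarrow> Wp S (arrs nB hA) fs \<Longrightarrow> Wp S hB zs \<Longrightarrow>
      prv It S (bounded_binterp Q (isubst \<sigma> A) x (appt c (fs @ zs))) \<Longrightarrow>
      prv It S (BQ Q nB zs (bounded_binterp Q (ishift (length nB) (isubst \<sigma> A))
          (map (tshift (length nB)) x)
        (appt (map (tshift (length nB)) fs) (vars (length nB)))))"
    using bounded_circ[OF wf(1), of nB] unfolding defs by blast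
  define hY where "hY = hat Q (bneg Q ?Y)"
  obtain d where d: "Wt (arrs (arrs nB hY) (arrs hB hY)) d"
    "\<And>\<sigma> x fs zs S. source_subst \<sigma> \<Longrightarrow> Wp S (bpos Q ?Y) x \<Longrightarrow> Wp S (arrs nB hY) fs \<Longrightarrow> Wp S hB zs \<Longrightarrow>
      prv It S (bounded_binterp Q (isubst \<sigma> ?Y) x (appt d (fs @ zs))) \<Longrightarrow>
      prv It S (BQ Q nB zs (bounded_binterp Q (ishift (length nB) (isubst \<sigma> ?Y))
          (map (tshift (length nB)) x)
        (appt (map (tshift (length nB)) fs) (vars (length nB)))))"
    using bounded_circ[OF Y, of nB] unfolding defs hY_def by blast
  have \<theta>1: "Wt (arrs pA (arrs nB hY)) \<theta>" using \<theta>(1) by (simp only: negY hY_def arrs_arrs)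
  \<comment> \<open>Positions 0 to 6 hold \<open>u1, u2, u3, v1, v2, x, w\<close>. The value must
    not depend on the challenge \<open>w\<close>, so \<open>?Rc\<close> omits it.\<close>
  let ?R = "[U1, U2, U3, V1, V2, pA, nC]" and ?Rc = "[U1, U2, U3, V1, V2, pA]"
  have D: "definable (concat ?R) (arrs (pA @ pB @ nC) hB) (block ?R 1)"
    "definable (concat ?R) (arrs (pA @ pB @ nC) hA) (block ?R 2)"
    "definable (concat ?R) (arrs pA pB) (block ?R 3)"
    "definable (concat ?R) (arrs pA (arrs nB hA)) (block ?R 4)"
    "definable (concat ?R) pA (block ?R 5)" "definable (concat ?R) nC (block ?R 6)"
    unfolding arrs_arrs U[symmetric] V[symmetric]
    using definable_blocks[of 1 ?R] definable_blocks[of 2 ?R] definable_blocks[of 3 ?R]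
      definable_blocks[of 4 ?R] definable_blocks[of 5 ?R] definable_blocks[of 6 ?R] by simp_all
  have Dc: "definable (concat ?Rc) (arrs (pA @ pB) pC) (block ?Rc 0)"
    "definable (concat ?Rc) (arrs pA pB) (block ?Rc 3)" "definable (concat ?Rc) pA (block ?Rc 5)"
    unfolding U[symmetric] V[symmetric]
    using definable_blocks[of 0 ?Rc] definable_blocks[of 3 ?Rc] definable_blocks[of 5 ?Rc] by simp_all
  let ?F = "\<lambda>us. appt (block ?Rc 0 us) (block ?Rc 5 us @ appt (block ?Rc 3 us) (block ?Rc 5 us))"
  have F: "definable (concat ?Rc) pC ?F"
    by (rule definable_appt[OF Dc(1) definable_append[OF Dc(3) definable_appt[OF Dc(2,3)]]])
  let ?xyw = "\<lambda>us. block ?R 5 us @ appt (block ?R 3 us) (block ?R 5 us) @ block ?R 6 us"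
  have xyw: "definable (concat ?R) (pA @ pB @ nC) ?xyw"
    by (rule definable_append[OF D(5) definable_append[OF definable_appt[OF D(3,5)] D(6)]])
  let ?z = "\<lambda>us. appt (block ?R 1 us) (?xyw us)"
  have z: "definable (concat ?R) hB ?z"
    by (rule definable_appt[OF D(1) xyw])
  let ?Ga = "\<lambda>us. appt \<eta> (?xyw us)"
  have G1: "definable (concat ?R) (hat Q (bneg Q ?X)) ?Ga"
    by (rule definable_appt_const[OF \<eta>(1)]) (simp only: negX xyw)
  let ?Gb = "\<lambda>us. appt d (appt \<theta> (block ?R 5 us) @ ?z us)"
  have G2: "definable (concat ?R) (hat Q (bneg Q ?Y)) ?Gb"
    unfolding hY_def[symmetric]
    by (intro definable_appt_const[OF d(1)[unfolded arrs_arrs]] definable_append z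
      definable_appt_const[OF \<theta>1] D)
  let ?k = "\<lambda>us. appt c (appt (block ?R 4 us) (block ?R 5 us) @ ?z us)"
  have v2x: "definable (concat ?R) (arrs nB hA) (\<lambda>us. appt (block ?R 4 us) (block ?R 5 us))"
    by (rule definable_appt[OF D(4,5)])
  have k: "definable (concat ?R) hA ?k"
    by (intro definable_appt_const[OF c(1)[unfolded arrs_arrs]] definable_append z v2x)
  let ?Gc = "\<lambda>us. appt j (appt (block ?R 2 us) (?xyw us) @ ?k us)"
  have u3: "definable (concat ?R) hA (\<lambda>us. appt (block ?R 2 us) (?xyw us))"
    by (rule definable_appt[OF D(2) xyw])
  have G3: "definable (concat ?R) hA ?Gc"
    by (intro definable_appt_const[OF j(1)[unfolded arrs_arrs]] definable_append k u3)
  have ctx: "ctx_pos Q [?X, ?Y, A] = concat ?Rc"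
    by (simp add: posX posY del: bpos_simps(4)) (simp add: defs)
  have ctxC: "ctx_pos Q [?X, ?Y, A] @ bneg Q C = concat ?R"
    by (simp add: posX posY del: bpos_simps(4)) (simp add: defs)
  have "realized (imps [?X, ?Y, A] C)"
  proof (rule real_seqI[where a = ?F and gs = "[?Ga, ?Gb, ?Gc]"])
    show "definable (ctx_pos Q [?X, ?Y, A]) (bpos Q C) ?F"
      using F unfolding ctx by (simp only: defs)
    show "list_all2 (\<lambda>B. definable (ctx_pos Q [?X, ?Y, A] @ bneg Q C) (hat Q (bneg Q B)))
        [?X, ?Y, A] [?Ga, ?Gb, ?Gc]"
      unfolding ctxC list.rel_inject using G1 G2 G3 by (simp only: defs list.rel_intros simp_thms)
    fix \<sigma> xss w S
    assume s: "source_subst \<sigma>" and xss: "list_all2 (\<lambda>B. Wp S (bpos Q B)) [?X, ?Y, A] xss"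
      and w: "Wp S (bneg Q C) w"
      and b: "\<forall>(B, x, g)\<in>set (zip [?X, ?Y, A] (zip xss [?Ga, ?Gb, ?Gc])).
        prv It S (bounded_binterp Q (isubst \<sigma> B) x (g (concat xss @ w)))"
    obtain u v x where uvx: "xss = [u, v, x]" "Wp S (bpos Q ?X) u" "Wp S (bpos Q ?Y) v" "Wp S pA x"
      using xss unfolding list_all2_Cons1 list_all2_Nil defs by blast
    obtain u1 u2 u3 where u: "u = u1 @ u2 @ u3" "Wp S U1 u1" "Wp S U2 u2" "Wp S U3 u3"
      using uvx(2) unfolding posX by (auto elim!: Wp_appendE)
    obtain v1 v2 where v: "v = v1 @ v2" "Wp S V1 v1" "Wp S V2 v2"
      using uvx(3) unfolding posY by (auto elim!: Wp_appendE)
    have w': "Wp S nC w" using w by (simp add: defs)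
    let ?us = "[u1, u2, u3, v1, v2, x, w]"
    have us: "concat xss @ w = concat ?us" "concat xss = concat [u1, u2, u3, v1, v2, x]"
      using uvx u v by simp_all
    have all: "list_all2 (Wp S) ?R ?us"
      using u v uvx w' by simp
    then have W: "Wp S (concat ?R) (concat ?us)"
      by (auto simp: Wp_append Wp_length)
    have "list_all2 (\<lambda>\<rho>s us. length us = length \<rho>s) ?R ?us"
      using all by (auto dest: Wp_length)
    note bl = block_concat[OF this]
    have blk: "block ?R 1 (concat ?us) = u2" "block ?R 2 (concat ?us) = u3" "block ?R 3 (concat ?us) =
        v1"
      "block ?R 4 (concat ?us) = v2" "block ?R 5 (concat ?us) = x" "block ?R 6 (concat ?us) = w"
      using bl[of 1] bl[of 2] bl[of 3] bl[of 4] bl[of 5] bl[of 6] by simp_all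
    have "list_all2 (\<lambda>\<rho>s us. length us = length \<rho>s) ?Rc [u1, u2, u3, v1, v2, x]"
      using all by (auto dest: Wp_length)
    note bl0 = block_concat[OF this]
    have blk0: "block ?Rc 0 (concat [u1, u2, u3, v1, v2, x]) = u1"
      "block ?Rc 3 (concat [u1, u2, u3, v1, v2, x]) = v1"
          "block ?Rc 5 (concat [u1, u2, u3, v1, v2, x]) = x"
      using bl0[of 0] bl0[of 3] bl0[of 5] by simp_all
    define y where "y = appt v1 x"
    define z' where "z' = appt u2 (x @ y @ w)"
    have Wxyw: "Wp S (pA @ pB @ nC) (x @ y @ w)"
      using definable_Wp[OF xyw W] unfolding blk y_def .
    have Wz: "Wp S hB z'" using definable_Wp[OF z W] unfolding blk y_def z'_def .
    have Wu3: "Wp S hA (appt u3 (x @ y @ w))" using definable_Wp[OF u3 W] unfolding blk y_def .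
    have Wv2: "Wp S (arrs nB hA) (appt v2 x)" using definable_Wp[OF v2x W] unfolding blk .
    have Wk: "Wp S hA (appt c (appt v2 x @ z'))" using definable_Wp[OF k W] unfolding blk y_def z'_def .
    have W\<theta>: "Wp S (arrs nB hY) (appt \<theta> x)"
      using definable_Wp[OF definable_appt_const[OF \<theta>1 definable_id] uvx(4)] Wp_length[OF uvx(4)] by simp
    have "prv It S (bounded_binterp Q (isubst \<sigma> ?X) u (?Ga (concat xss @ w)))"
      "prv It S (bounded_binterp Q (isubst \<sigma> ?Y) v (?Gb (concat xss @ w)))"
      "prv It S (bounded_binterp Q (isubst \<sigma> A) x (?Gc (concat xss @ w)))"
      using b unfolding uvx(1) by simp_all
    note bounds = this[unfolded us(1) blk, folded y_def, folded z'_def]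
    have b1: "prv It S (bounded_binterp Q (isubst \<sigma> ?X) u (appt \<eta> (x @ y @ w)))"
      and b2: "prv It S (bounded_binterp Q (isubst \<sigma> ?Y) v (appt d (appt \<theta> x @ z')))"
      and b3: "prv It S (bounded_binterp Q (isubst \<sigma> A) x
          (appt j (appt u3 (x @ y @ w) @ appt c (appt v2 x @ z'))))"
      by (rule bounds)+
    have "prv It S (binterp Q (isubst \<sigma> ?X) u (x @ y @ w))"
      by (rule \<eta>(2)[OF s uvx(2) _ b1]) (simp only: negX Wxyw)
    moreover have "length u1 = length pC" "length u2 = length hB" "length x = length pA" "length y =
        length pB"
      using Wp_length[OF u(2)] Wp_length[OF u(3)] Wp_length[OF uvx(4)] Wp_length[OF v(2)]
      by (simp_all add: U V y_def)
    then have "binterp Q (isubst \<sigma> ?X) u (x @ y @ w) =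
        IImp (bounded_binterp Q (isubst \<sigma> A) x (appt u3 (x @ y @ w)))
        (IImp (bounded_binterp Q (isubst \<sigma> B) y z') (binterp Q (isubst \<sigma> C) (appt u1 (x @ y)) w))"
      using binterp_IImp[of "u1 @ u2" Q "isubst \<sigma> (IImp B C)" x "isubst \<sigma> A" u3 "y @ w"]
        binterp_IImp[of "appt u1 x" Q "isubst \<sigma> C" y "isubst \<sigma> B" "appt u2 x" w]
      by (simp add: u(1) defs appt_append appt_appt z'_def)
    ultimately have main: "prv It S (IImp (bounded_binterp Q (isubst \<sigma> A) x (appt u3 (x @ y @ w)))
        (IImp (bounded_binterp Q (isubst \<sigma> B) y z') (binterp Q (isubst \<sigma> C) (appt u1 (x @ y)) w)))"
      by simp
    \<comment> \<open>The joined bound is split: one half feeds the first premise, the other is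
      handed to \<open>c\<close> for the derivation of \<open>B\<close> below
      \<open>z'\<close>.\<close>
    note b3' = j(2)[OF s uvx(4) Wu3 Wk b3]
    have A1: "prv It S (BQ Q nB z' (bounded_binterp Q (ishift (length nB) (isubst \<sigma> A))
        (map (tshift (length nB)) x)
        (appt (map (tshift (length nB)) (appt v2 x)) (vars (length nB)))))"
      by (rule c(2)[OF s uvx(4) Wv2 Wz]) (use b3' in blast)
    have Y1: "prv It S (BQ Q nB z' (bounded_binterp Q (ishift (length nB) (isubst \<sigma> ?Y))
        (map (tshift (length nB)) v)
        (appt (map (tshift (length nB)) (appt \<theta> x)) (vars (length nB)))))"
      by (rule d(2)[OF s uvx(3) W\<theta> Wz b2])
    have lv1: "length v1 = length (bpos Q B)" using Wp_length[OF v(2)] by (simp add: V defs)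
    have "prv It S (bounded_binterp Q (isubst \<sigma> B) (appt v1 x) z')"
      by (rule bounded_mp[OF wf(1,2) s uvx(4)[unfolded defs] uvx(3)[unfolded v(1)] lv1
          Wz[unfolded defs] eta_Y
        Y1[unfolded v(1) defs] A1[unfolded defs]])
    then have "prv It S (bounded_binterp Q (isubst \<sigma> B) y z')" by (simp only: y_def)
    with main b3' have "prv It S (binterp Q (isubst \<sigma> C) (appt u1 (x @ y)) w)"
      by (blast intro: prv_mp)
    then show "prv It S (binterp Q (isubst \<sigma> C) (?F (concat xss)) w)"
      unfolding us(2) blk0 y_def .
  qed (use wf in simp_all)
  then show ?thesis by simp
qed

end

section \<open>Witnessability and realizability of a sequent are equivalent\<close>

section \<open>Witnessability as realizability of a sequent\<close>

lemma blocks_map: "blocks ns (map f xs) = map (map f) (blocks ns xs)"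
  by (induction ns xs rule: blocks.induct) (auto simp: take_map drop_map)

lemma list_all2_blocks:
  assumes "\<And>\<sigma>s \<tau>s rs. P (\<sigma>s @ \<tau>s) rs \<Longrightarrow> P \<sigma>s (take (length \<sigma>s) rs) \<and> P \<tau>s (drop (length \<sigma>s) rs)"
    and "P (concat (map f xs)) rs"
  shows "list_all2 (\<lambda>x. P (f x)) xs (blocks (map (\<lambda>x. length (f x)) xs) rs)"
  using assms(2) by (induction xs arbitrary: rs) (auto dest: assms(1))

context source_target
begin

lemma Wt_blocks:
  assumes "Wt (arrs \<rho>s (concat (map f \<Gamma>))) rs"
  shows "list_all2 (\<lambda>B. Wt (arrs \<rho>s (f B))) \<Gamma> (blocks (map (\<lambda>B. length (f B)) \<Gamma>) rs)"
proof -
  have "Wt (concat (map (\<lambda>B. arrs \<rho>s (f B)) \<Gamma>)) rs"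
    using assms by (simp add: arrs_def map_concat o_def)
  then have "list_all2 (\<lambda>B. Wt (arrs \<rho>s (f B))) \<Gamma> (blocks (map (\<lambda>B. length (arrs \<rho>s (f B))) \<Gamma>) rs)"
    by (rule list_all2_blocks[rotated]) (auto elim!: Wt_appendE simp: Wt_length)
  then show ?thesis by simp
qed

lemma Wt_concat:
  "list_all2 (\<lambda>B. Wt (arrs \<rho>s (f B))) \<Gamma> gs \<Longrightarrow> Wt (arrs \<rho>s (concat (map f \<Gamma>))) (concat gs)"
  unfolding Wt_def
  by (induction rule: list_all2_induct) (simp_all add: arrs_append list_all2_appendI)

lemma Wp_blocks:
  "Wp S (concat (map f \<Gamma>)) rs \<Longrightarrow> list_all2 (\<lambda>B. Wp S (f B)) \<Gamma> (blocks (map (\<lambda>B. length (f B)) \<Gamma>) rs)"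
  by (rule list_all2_blocks[where P = "Wp S"]) (auto elim!: Wp_appendE simp: Wp_length)

text \<open>The witnessed sequent speaks of distinct variables with the formulas shifted past them,
  so one substitution yields any superscripts and challenge together with any source instance of the
  formulas.\<close>

lemma witnessable_real_seq:
  assumes wf: "\<forall>B\<in>set \<Gamma>. wfs B" "wfs A" and w: "witnessable It Q \<Gamma> A"
  shows "\<exists>a gs. real_seq \<Gamma> A a gs"
proof -
  define m k where "m = length (ctx_pos Q \<Gamma>)" and "k = length (bneg Q A)"
  define xs ws where "xs = gvars 0 m" and "ws = gvars m k"
  define xss where "xss = blocks (map (\<lambda>B. length (bpos Q B)) \<Gamma>) xs"
  obtain \<gamma> a where len: "length \<gamma> = length (ctx_bounds Q \<Gamma>)" "length a = length (bpos Q A)"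
    and cl: "\<forall>t\<in>set (\<gamma> @ a). closed_term (lang It) t"
    and W\<gamma>: "il_prov It [] (iWs Q (arrs (ctx_pos Q \<Gamma>) (arrs (bneg Q A) (ctx_bounds Q \<Gamma>))) \<gamma>)"
    and Wa: "il_prov It [] (iWs Q (arrs (ctx_pos Q \<Gamma>) (bpos Q A)) a)"
    and main: "il_prov It (map2 (iW Q) (ctx_pos Q \<Gamma> @ bneg Q A) (xs @ ws) @
        map (\<lambda>(B, x, g). bounded_binterp Q (ishift (m + k) B) x (appt g (xs @ ws)))
          (zip \<Gamma> (zip xss (blocks (map (\<lambda>B. length (hat Q (bneg Q B))) \<Gamma>) \<gamma>))))
      (binterp Q (ishift (m + k) A) (appt a xs) ws)"
    using w unfolding witnessable_def Let_def m_def k_def xs_def ws_def xss_def by auto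
  define gs where "gs = blocks (map (\<lambda>B. length (hat Q (bneg Q B))) \<Gamma>) \<gamma>"
  have a: "Wt (arrs (ctx_pos Q \<Gamma>) (bpos Q A)) a"
    using Wa len cl by (subst (asm) il_iWs_iff) auto
  have "Wt (arrs (ctx_pos Q \<Gamma> @ bneg Q A) (concat (map (\<lambda>B. hat Q (bneg Q B)) \<Gamma>))) \<gamma>"
    using W\<gamma> len cl by (subst (asm) il_iWs_iff) (auto simp: arrs_arrs ctx_bounds_def)
  from Wt_blocks[OF this] have gs: "list_all2
      (\<lambda>B. Wt (arrs (ctx_pos Q \<Gamma> @ bneg Q A) (hat Q (bneg Q B)))) \<Gamma> gs"
    by (simp only: gs_def)
  have "prv It S (binterp Q (isubst \<sigma> A) (appt a (concat xss')) ws')"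
    if s: "source_subst \<sigma>" and xss': "list_all2 (\<lambda>B. Wp S (bpos Q B)) \<Gamma> xss'"
        and ws': "Wp S (bneg Q A) ws'"
      and b: "\<forall>(B, x, g)\<in>set (zip \<Gamma> (zip xss' gs)).
         prv It S (bounded_binterp Q (isubst \<sigma> B) x (appt g (concat xss' @ ws')))" for \<sigma> xss' ws' S
  proof -
    \<comment> \<open>The first \<open>m + k\<close> variables become the given tuples, and
      \<open>\<sigma>\<close> reaches exactly the formulas, the realizers being closed.\<close>
    let ?\<theta> = "scons (concat xss' @ ws') \<sigma>"
    have len': "length (concat xss') = m" "length ws' = k" "length xss' = length \<Gamma>" "length gs =
        length \<Gamma>"
      using ctx_length[OF xss'] Wp_length[OF ws'] list_all2_lengthD[OF xss'] list_all2_lengthD[OF gs]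
      by (simp_all add: m_def k_def)
    have \<theta>: "wft (?\<theta> i)" for i
      using source_wft[OF s] ctx_wft[OF xss'] Wp_wft[OF ws'] by (intro twf_scons) auto
    have \<theta>xs: "map (tsubst ?\<theta>) xs = concat xss'" "map (tsubst ?\<theta>) ws = ws'"
      unfolding xs_def ws_def using len' by (subst map_scons_vars; simp)+
    have sh: "isubst ?\<theta> (ishift (m + k) B) = isubst \<sigma> B" for B :: "('f, 'p) ifm"
      using len' by (intro isubst_scons_ishift) simp
    have "map (map (tsubst ?\<theta>)) xss = blocks (map (\<lambda>B. length (bpos Q B)) \<Gamma>) (concat xss')"
      by (simp only: xss_def blocks_map[symmetric] \<theta>xs)
    also have "\<dots> = xss'"
      using xss' by (intro blocks_concat) (auto simp: list_all2_map1 Wp_length elim!: list_all2_mono)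
    finally have \<theta>xss: "map (map (tsubst ?\<theta>)) xss = xss'" .
    have lxss: "length xss = length \<Gamma>" by (simp add: xss_def)
    have xsst: "pos_terms (\<Gamma> ! i) (xss ! i)" if i: "i < length \<Gamma>" for i
    proof -
      have "map (tsubst ?\<theta>) (xss ! i) = xss' ! i" using i lxss \<theta>xss by (metis nth_map)
      then have "length (xss ! i) = length (xss' ! i)" by (metis length_map)
      then have l: "length (xss ! i) = length (bpos Q (\<Gamma> ! i))"
        using xss' i by (auto simp: list_all2_conv_all_nth Wp_length)
      have cx: "concat xss = xs"
        unfolding xss_def by (rule concat_blocks) (simp add: xs_def m_def ctx_pos_def length_concat
            o_def)
      have "xss ! i \<in> set xss" using i lxss by simp
      then have "set (xss ! i) \<subseteq> set xs" unfolding cx[symmetric] set_concat by blast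
      then show ?thesis using l by (auto simp: terms_of_def xs_def)
    qed
    have "prv It S (isubst ?\<theta> C)"
      if "C \<in> set (map2 (iW Q) (ctx_pos Q \<Gamma> @ bneg Q A) (xs @ ws) @
        map (\<lambda>(B, x, g). bounded_binterp Q (ishift (m + k) B) x (appt g (xs @ ws)))
            (zip \<Gamma> (zip xss gs)))" for C
      using that unfolding set_append Un_iff
    proof
      have "Wp S (ctx_pos Q \<Gamma>) (concat xss')"
        using xss' by (induction rule: list_all2_induct) (auto simp: Wp_append Wp_length, simp add:
            Wp_def)
      then have W: "Wp S (ctx_pos Q \<Gamma> @ bneg Q A) (concat xss' @ ws')"
        using ws' by (simp add: Wp_append Wp_length)
      assume "C \<in> set (map2 (iW Q) (ctx_pos Q \<Gamma> @ bneg Q A) (xs @ ws))"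
      then have "isubst ?\<theta> C \<in> isubst ?\<theta> ` Ws (ctx_pos Q \<Gamma> @ bneg Q A) (xs @ ws)" by (rule imageI)
      then have "isubst ?\<theta> C \<in> Ws (ctx_pos Q \<Gamma> @ bneg Q A) (concat xss' @ ws')"
        by (simp only: Ws_subst map_append \<theta>xs)
      with W show ?thesis by (rule Wp_prv)
    next
      assume "C \<in> set (map (\<lambda>(B, x, g). bounded_binterp Q (ishift (m + k) B) x (appt g (xs @ ws)))
        (zip \<Gamma> (zip xss gs)))"
      then obtain i where i: "i < length \<Gamma>"
        and C: "C = bounded_binterp Q (ishift (m + k) (\<Gamma> ! i)) (xss ! i) (appt (gs ! i) (xs @ ws))"
        using lxss len' by (auto simp: set_zip)
      have g: "Wt (arrs (ctx_pos Q \<Gamma> @ bneg Q A) (hat Q (bneg Q (\<Gamma> ! i)))) (gs ! i)"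
        using gs i by (auto simp: list_all2_conv_all_nth)
      have "isubst ?\<theta> C = bounded_binterp Q (isubst ?\<theta> (ishift (m + k) (\<Gamma> ! i)))
          (map (tsubst ?\<theta>) (xss ! i)) (map (tsubst ?\<theta>) (appt (gs ! i) (xs @ ws)))"
        unfolding C using wf i \<theta> xsst[OF i] Wt_terms[OF g]
        by (intro bounded_subst) (auto simp: terms_of_def appt_def xs_def ws_def)
      also have "map (tsubst ?\<theta>) (xss ! i) = xss' ! i" using i lxss \<theta>xss by (metis nth_map)
      finally have "isubst ?\<theta> C = bounded_binterp Q (isubst \<sigma> (\<Gamma> ! i)) (xss' ! i)
          (appt (gs ! i) (concat xss' @ ws'))"
        by (simp only: sh map_tsubst_appt map_append \<theta>xs Wt_tsubst[OF g])
      moreover have "(\<Gamma> ! i, xss' ! i, gs ! i) \<in> set (zip \<Gamma> (zip xss' gs))"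
        using i len' by (auto simp: set_zip)
      ultimately show ?thesis using b by fastforce
    qed
    then have hyps: "C \<in> isubst ?\<theta> ` set (map2 (iW Q) (ctx_pos Q \<Gamma> @ bneg Q A) (xs @ ws) @
        map (\<lambda>(B, x, g). bounded_binterp Q (ishift (m + k) B) x (appt g (xs @ ws)))
            (zip \<Gamma> (zip xss gs))) \<Longrightarrow>
        prv It S C" for C
      by blast
    have "isubst ?\<theta> (binterp Q (ishift (m + k) A) (appt a xs) ws) =
        binterp Q (isubst ?\<theta> (ishift (m + k) A)) (map (tsubst ?\<theta>) (appt a xs)) (map (tsubst ?\<theta>) ws)"
      using wf \<theta> Wt_terms[OF a] by (intro binterp_subst)
        (auto simp: terms_of_def appt_def xs_def ws_def k_def)
    also have "\<dots> = binterp Q (isubst \<sigma> A) (appt a (concat xss')) ws'"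
      by (simp only: sh map_tsubst_appt \<theta>xs Wt_tsubst[OF a])
    finally have eq: "isubst ?\<theta> (binterp Q (ishift (m + k) A) (appt a xs) ws) =
        binterp Q (isubst \<sigma> A) (appt a (concat xss')) ws'" .
    note prv_subst[OF il_prv[OF main[folded gs_def] subset_refl], where \<sigma> = ?\<theta>, OF \<theta>]
    from prv_cuts[OF this hyps] show ?thesis unfolding eq by blast
  qed
  then have "real_seq \<Gamma> A a gs" using a gs unfolding real_seq_def by blast
  then show ?thesis by blast
qed

lemma real_seqD:
  "real_seq \<Gamma> A a gs \<Longrightarrow> source_subst \<sigma> \<Longrightarrow> list_all2 (\<lambda>B. Wp S (bpos Q B)) \<Gamma> xss \<Longrightarrow>
    Wp S (bneg Q A) ws \<Longrightarrow>
    \<forall>(B, x, g)\<in>set (zip \<Gamma> (zip xss gs)).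
      prv It S (bounded_binterp Q (isubst \<sigma> B) x (appt g (concat xss @ ws))) \<Longrightarrow>
    prv It S (binterp Q (isubst \<sigma> A) (appt a (concat xss)) ws)"
  unfolding real_seq_def by blast

text \<open>Realizability is specialized to the shift by \<open>m + k\<close>, to variables as
  tuples, and to \<open>S\<close> the antecedent of the sequent to be proved; \<open>prv_il\<close>
  then turns the set back into the list.\<close>

lemma real_seq_witnessable:
  assumes wf: "\<forall>B\<in>set \<Gamma>. wfs B" "wfs A" and r: "real_seq \<Gamma> A a gs"
  shows "witnessable It Q \<Gamma> A"
proof -
  define m k where "m = length (ctx_pos Q \<Gamma>)" and "k = length (bneg Q A)"
  define xs ws where "xs = gvars 0 m" and "ws = gvars m k"
  define xss where "xss = blocks (map (\<lambda>B. length (bpos Q B)) \<Gamma>) xs"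
  have a: "Wt (arrs (ctx_pos Q \<Gamma>) (bpos Q A)) a"
    and gs: "list_all2 (\<lambda>B. Wt (arrs (ctx_pos Q \<Gamma> @ bneg Q A) (hat Q (bneg Q B)))) \<Gamma> gs"
    using r by (auto simp: real_seq_def)
  have \<gamma>: "Wt (arrs (ctx_pos Q \<Gamma>) (arrs (bneg Q A) (ctx_bounds Q \<Gamma>))) (concat gs)"
    using Wt_concat[OF gs] by (simp add: arrs_arrs ctx_bounds_def)
  have bl: "blocks (map (\<lambda>B. length (hat Q (bneg Q B))) \<Gamma>) (concat gs) = gs"
    using gs by (intro blocks_concat) (auto simp: list_all2_map1 Wt_length elim!: list_all2_mono)
  have xss: "concat xss = xs"
    unfolding xss_def by (rule concat_blocks) (simp add: xs_def m_def ctx_pos_def length_concat o_def)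
  let ?hyps = "map2 (iW Q) (ctx_pos Q \<Gamma> @ bneg Q A) (xs @ ws) @
        map (\<lambda>(B, x, g). bounded_binterp Q (ishift (m + k) B) x (appt g (xs @ ws))) (zip \<Gamma> (zip xss gs))"
  let ?S = "set ?hyps"
  have W: "Wp ?S (ctx_pos Q \<Gamma> @ bneg Q A) (xs @ ws)"
    by (intro Wp_hyp) (auto simp: xs_def ws_def m_def k_def)
  then have Wxs: "Wp ?S (ctx_pos Q \<Gamma>) xs" and Wws: "Wp ?S (bneg Q A) ws"
    by (simp_all add: Wp_append xs_def m_def)
  have Wxss: "list_all2 (\<lambda>B. Wp ?S (bpos Q B)) \<Gamma> xss"
    using Wp_blocks[of ?S "bpos Q" \<Gamma> xs] Wxs unfolding xss_def ctx_pos_def by blast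
  have "wff C" if C: "C \<in> set (map (\<lambda>(B, x, g). bounded_binterp Q (ishift (m + k) B) x
      (appt g (xs @ ws)))
      (zip \<Gamma> (zip xss gs)))" for C
  proof -
    obtain i where i: "i < length \<Gamma>"
      and C: "C = bounded_binterp Q (ishift (m + k) (\<Gamma> ! i)) (xss ! i) (appt (gs ! i) (xs @ ws))"
      using C list_all2_lengthD[OF Wxss] list_all2_lengthD[OF gs] by (auto simp: set_zip)
    have g: "Wt (arrs (ctx_pos Q \<Gamma> @ bneg Q A) (hat Q (bneg Q (\<Gamma> ! i)))) (gs ! i)"
      using gs i by (auto simp: list_all2_conv_all_nth)
    have "Wp ?S (bpos Q (\<Gamma> ! i)) (xss ! i)" using Wxss i by (auto simp: list_all2_conv_all_nth)
    then show ?thesis unfolding C using wf i Wt_terms[OF g] Wp_terms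
      by (intro bounded_wff) (auto simp: terms_of_def appt_def xs_def ws_def)
  qed
  moreover have "\<forall>C\<in>Ws (ctx_pos Q \<Gamma> @ bneg Q A) (xs @ ws). wff C"
    by (rule wff_Ws) (auto simp: xs_def ws_def)
  ultimately have wfh: "\<forall>C\<in>set ?hyps. wff C"
    unfolding set_append by blast
  have "prv It ?S (binterp Q (isubst (\<lambda>i. Var (i + (m + k))) A) (appt a (concat xss)) ws)"
  proof -
    have "\<forall>(B, x, g)\<in>set (zip \<Gamma> (zip xss gs)).
        prv It ?S (bounded_binterp Q (isubst (\<lambda>i. Var (i + (m + k))) B) x (appt g (concat xss @ ws)))"
      using wfh unfolding xss ishift_def[symmetric] by (force intro: prv_hyp)
    moreover have "source_subst (\<lambda>i. Var (i + (m + k)))" by simp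
    ultimately show ?thesis by (intro real_seqD[OF r _ Wxss Wws])
  qed
  then have "prv It (set ?hyps) (binterp Q (ishift (m + k) A) (appt a xs) ws)"
    by (simp only: xss ishift_def)
  then have "il_prov It ?hyps (binterp Q (ishift (m + k) A) (appt a xs) ws)"
    using wfh by (rule prv_il)
  moreover have "il_prov It [] (iWs Q (arrs (ctx_pos Q \<Gamma>) (arrs (bneg Q A) (ctx_bounds Q \<Gamma>)))
      (concat gs))"
    using \<gamma> il_iWs_iff[OF Wt_length[OF \<gamma>] Wt_closed[OF \<gamma>]] by blast
  moreover have "il_prov It [] (iWs Q (arrs (ctx_pos Q \<Gamma>) (bpos Q A)) a)"
    using a il_iWs_iff[OF Wt_length[OF a] Wt_closed[OF a]] by blast
  moreover have "\<forall>t\<in>set (concat gs @ a). closed_term (lang It) t"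
    using Wt_closed[OF a] Wt_closed[OF \<gamma>] by auto
  moreover have "length (concat gs) = length (ctx_bounds Q \<Gamma>)" "length a = length (bpos Q A)"
    using Wt_length[OF a] Wt_length[OF \<gamma>] by simp_all
  moreover have "vars m = xs" by (simp add: xs_def)
  ultimately show ?thesis
    unfolding witnessable_def Let_def m_def[symmetric] k_def[symmetric] ws_def[symmetric]
    by (intro exI[of _ "concat gs"] exI[of _ a] conjI) (simp_all only: bl xss_def[symmetric])
qed

end

section \<open>A Hilbert system over realized formulas, and the rules of IL in it\<close>

section \<open>Soundness\<close>

context source_target
begin

text \<open>All realized formulas are axioms and modus ponens is the only rule, so
  \<open>realized_mp\<close> alone makes derivations without hypotheses sound. There is no
  generalization rule; it would obstruct the deduction theorem.\<close>

inductive der :: "('f, 'p) ifm set \<Rightarrow> ('f, 'p) ifm \<Rightarrow> bool" for S where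
  der_hyp: "A \<in> S \<Longrightarrow> wfs A \<Longrightarrow> der S A"
| der_real: "realized A \<Longrightarrow> wfs A \<Longrightarrow> der S A"
| der_mp: "der S (IImp A B) \<Longrightarrow> der S A \<Longrightarrow> der S B"

lemma der_wfs: "der S A \<Longrightarrow> wfs A"
  by (induction rule: der.induct) auto

lemma der_mono: "der S A \<Longrightarrow> S \<subseteq> S' \<Longrightarrow> der S' A"
  by (induction rule: der.induct) (auto intro: der.intros)

lemma der_cuts: "der S' A \<Longrightarrow> (\<And>B. B \<in> S' \<Longrightarrow> der S B) \<Longrightarrow> der S A"
  by (induction rule: der.induct) (auto intro: der.intros)

lemma der_realized: "der {} A \<Longrightarrow> realized A"
proof (induction rule: der.induct)
  case (der_mp A B)
  then show ?case using der_wfs[of "{}" A] der_wfs[of "{}" B] by (blast intro: realized_mp der.der_mp)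
qed auto

lemma der_K: "der S A \<Longrightarrow> wfs B \<Longrightarrow> der S (IImp B A)"
  using der_mp[OF der_real[OF realized_K]] der_wfs by (metis iwf.simps(4))

lemma deduction: "der (insert A S) B \<Longrightarrow> wfs A \<Longrightarrow> der S (IImp A B)"
proof (induction rule: der.induct)
  case (der_hyp B)
  show ?case
  proof (cases "B = A")
    case True
    \<comment> \<open>The identity as the combinator S K K, with \<open>?I\<close> as the
      intermediate formula.\<close>
    let ?I = "IImp A A"
    have "der S (IImp (IImp A (IImp ?I A)) (IImp (IImp A ?I) ?I))"
      using der_hyp.prems by (intro der_real realized_S) auto
    moreover have "der S (IImp A (IImp ?I A))" "der S (IImp A ?I)"
      using der_hyp.prems by (auto intro!: der_real realized_K)
    ultimately show ?thesis unfolding True by (metis der_mp)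
  next
    case False
    then show ?thesis using der_hyp by (auto intro: der_K der.der_hyp)
  qed
next
  case (der_real B)
  then show ?case by (auto intro: der_K der.der_real)
next
  case (der_mp B C)
  have "wfs B" "wfs C" using der_wfs[OF der_mp.hyps(1)] by auto
  then have "der S (IImp (IImp A (IImp B C)) (IImp (IImp A B) (IImp A C)))"
    using der_mp.prems by (intro der_real realized_S) auto
  then show ?case using der_mp.IH der_mp.prems by (metis der.der_mp)
qed

lemma der_impsI: "der (set \<Gamma> \<union> S) A \<Longrightarrow> \<forall>B\<in>set \<Gamma>. wfs B \<Longrightarrow> der S (imps \<Gamma> A)"
  by (induction \<Gamma> arbitrary: S) (auto intro: deduction)

lemma der_impsE: "der S (imps \<Gamma> A) \<Longrightarrow> set \<Gamma> \<subseteq> S \<Longrightarrow> \<forall>B\<in>set \<Gamma>. wfs B \<Longrightarrow> der S A"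
  by (induction \<Gamma>) (auto dest: der_mp[OF _ der_hyp])

lemma ishift_imps: "ishift n (imps \<Gamma> A) = imps (map (ishift n) \<Gamma>) (ishift n A)"
  by (induction \<Gamma>) auto

lemma ishift_iconj: "ishift n (iconj \<Gamma>) = iconj (map (ishift n) \<Gamma>)"
  by (induction \<Gamma>) (auto simp: iconj_def)

lemma der_and:
  "der S A \<Longrightarrow> der S B \<Longrightarrow> der S (IAnd A B)"
  "der S (IAnd A B) \<Longrightarrow> der S A"
  "der S (IAnd A B) \<Longrightarrow> der S B"
proof -
  assume "der S A" "der S B"
  moreover from this have "der S (IImp A (IImp B (IAnd A B)))"
    by (intro der_real realized_andI) (auto dest: der_wfs)
  ultimately show "der S (IAnd A B)" by (metis der_mp)
next
  assume *: "der S (IAnd A B)"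
  then have "wfs A" "wfs B" using der_wfs by force+
  then have "der S (IImp (IAnd A B) A)" "der S (IImp (IAnd A B) B)"
    by (auto intro!: der_real realized_and)
  with * show "der S A" "der S B" by (blast intro: der_mp)+
qed

lemma der_iconjI:
  assumes "\<And>B. B \<in> set \<Gamma> \<Longrightarrow> der S B" shows "der S (iconj \<Gamma>)"
  using assms
proof (induction \<Gamma>)
  case Nil
  show ?case by (simp add: iconj_def) (rule deduction; simp add: der_hyp)
next
  case (Cons B \<Gamma>)
  then show ?case by (simp add: iconj_def der_and(1))
qed

lemma der_iconjE: "der S (iconj \<Gamma>) \<Longrightarrow> B \<in> set \<Gamma> \<Longrightarrow> der S B"
  by (induction \<Gamma>) (auto simp: iconj_def dest: der_and(2,3))

lemma wfs_iconj: "\<forall>B\<in>set \<Gamma>. wfs B \<Longrightarrow> wfs (iconj \<Gamma>)"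
  by (induction \<Gamma>) (auto simp: iconj_def)

text \<open>\<open>realized_allI\<close> has a single antecedent and no side hypotheses, so the
  context is packed into one conjunction and discharged before generalizing.\<close>

lemma der_allI:
  assumes "der (set (map (ishift 1) \<Gamma>)) A" "\<forall>B\<in>set \<Gamma>. wfs B" shows "der (set \<Gamma>) (IAll A)"
proof -
  let ?G = "iconj \<Gamma>"
  have G: "wfs ?G" by (rule wfs_iconj[OF assms(2)])
  have "der {ishift 1 ?G} (ishift 1 ?G)" using G by (intro der_hyp) auto
  then have "der {ishift 1 ?G} B" if "B \<in> set (map (ishift 1) \<Gamma>)" for B
    using that unfolding ishift_iconj by (rule der_iconjE)
  with assms(1) have "der {ishift 1 ?G} A" by (rule der_cuts)
  then have "realized (IImp (ishift 1 ?G) A)" using G by (intro der_realized deduction) auto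
  then have "der (set \<Gamma>) (IImp ?G (IAll A))"
    using G der_wfs[OF assms(1)] by (intro der_real realized_allI) auto
  moreover have "der (set \<Gamma>) ?G" using assms(2) by (intro der_iconjI der_hyp) auto
  ultimately show ?thesis by (rule der_mp)
qed

text \<open>Here the antecedent of \<open>realized_exE\<close> is taken by \<open>A\<close>, so the
  context moves into the succedent as a chain of implications instead.\<close>

lemma der_exE:
  assumes "der (insert A (set (map (ishift 1) \<Gamma>))) (ishift 1 B)" "\<forall>B\<in>set \<Gamma>. wfs B" "wfs A"
  shows "der (insert (IEx A) (set \<Gamma>)) B"
proof -
  have "der (set (map (ishift 1) \<Gamma>) \<union> {A}) (ishift 1 B)" using assms(1) by simp
  then have "der {A} (imps (map (ishift 1) \<Gamma>) (ishift 1 B))"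
    by (rule der_impsI) (use assms(2) in auto)
  then have "realized (IImp A (ishift 1 (imps \<Gamma> B)))"
    unfolding ishift_imps using assms(3) by (intro der_realized deduction)
  moreover have "wfs (imps \<Gamma> B)" using assms(2) der_wfs[OF assms(1)] by (simp add: iwf_imps)
  ultimately have "der (insert (IEx A) (set \<Gamma>)) (IImp (IEx A) (imps \<Gamma> B))"
    using assms(3) by (intro der_real realized_exE) auto
  moreover have "der (insert (IEx A) (set \<Gamma>)) (IEx A)" using assms(3) by (intro der_hyp) auto
  ultimately have "der (insert (IEx A) (set \<Gamma>)) (imps \<Gamma> B)" by (rule der_mp)
  then show ?thesis by (rule der_impsE) (use assms(2) in auto)
qed

text \<open>Structural rules disappear because \<open>der\<close> refers to sets, and each logical
  rule reduces to a realized axiom with modus ponens, to the deduction theorem, or to the two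
  eigenvariable lemmas. A non-logical axiom enters as a chain of implications realized by its own
  witnesses.\<close>

lemma il_prov_der:
  assumes axs: "\<forall>(\<Gamma>, A) \<in> axs Is. witnessable It Q \<Gamma> A" and prov: "il_prov Is \<Gamma> A"
  shows "der (set \<Gamma>) A"
  using prov
proof (induction rule: il_prov.induct)
  case (il_ax \<Gamma> A)
  have wf: "\<forall>B\<in>set \<Gamma>. wfs B" "wfs A" using il_prov_wf[OF wf_source il_prov.il_ax[OF il_ax]] by auto
  have "witnessable It Q \<Gamma> A" using axs il_ax by auto
  then have "realized (imps \<Gamma> A)"
    using witnessable_real_seq[OF wf] real_seq_imps[OF wf] by blast
  then have "der (set \<Gamma>) (imps \<Gamma> A)" using wf by (intro der_real) (auto simp: iwf_imps)
  then show ?case by (rule der_impsE) (use wf in auto)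
next
  case (il_id A)
  then show ?case by (intro der_hyp) auto
next
  case (il_cut \<Gamma> A \<Delta> B)
  from il_cut.IH(2) show ?case
  proof (rule der_cuts)
    fix C assume C: "C \<in> set (A # \<Delta>)"
    then have "wfs C" using il_prov_wf[OF wf_source il_cut.hyps(2)] by auto
    with C show "der (set (\<Gamma> @ \<Delta>)) C"
      using il_cut.IH(1) by (auto intro: der_hyp der_mono)
  qed
next
  case (il_exch \<Gamma> A \<Delta>)
  then show ?case by (metis mset_eq_setD)
next
  case (il_weak \<Gamma> B A)
  then show ?case by (auto intro: der_mono)
next
  case (il_contr A \<Gamma> B)
  then show ?case by simp
next
  case (il_botL A)
  then have "der (set [IBot]) (IImp IBot A)" by (intro der_real realized_bot) auto
  then show ?case by (rule der_mp) (auto intro: der_hyp)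
next
  case (il_andL A B \<Gamma> C)
  have wf: "wfs D" if "D \<in> set (A # B # \<Gamma>)" for D
    using il_prov_wf[OF wf_source il_andL.hyps] that by auto
  from il_andL.IH show ?case
  proof (rule der_cuts)
    fix D assume D: "D \<in> set (A # B # \<Gamma>)"
    have "der (set (IAnd A B # \<Gamma>)) (IAnd A B)" using wf by (intro der_hyp) auto
    then show "der (set (IAnd A B # \<Gamma>)) D"
      using D wf[OF D] by (auto intro: der_hyp dest: der_and(2,3))
  qed
next
  case (il_andR \<Gamma> A \<Delta> B)
  then show ?case by (intro der_and(1)) (auto intro: der_mono)
next
  case (il_impL \<Gamma> A B \<Delta> C)
  have wf: "wfs A" "wfs B" "\<forall>D\<in>set \<Delta>. wfs D"
    using il_prov_wf[OF wf_source il_impL.hyps(1)] il_prov_wf[OF wf_source il_impL.hyps(2)] by auto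
  let ?S = "set (IImp A B # \<Gamma> @ \<Delta>)"
  have "der ?S (IImp A B)" using wf by (intro der_hyp) auto
  moreover have "der ?S A" using il_impL.IH(1) by (rule der_mono) auto
  ultimately have B: "der ?S B" by (rule der_mp)
  from il_impL.IH(2) show ?case
    by (rule der_cuts) (use B wf in \<open>auto intro: der_hyp\<close>)
next
  case (il_impR A \<Gamma> B)
  have "wfs A" using il_prov_wf[OF wf_source il_impR.hyps] by auto
  with il_impR.IH show ?case by (intro deduction) auto
next
  case (il_allL t A \<Gamma> B)
  have wf: "\<forall>D\<in>set \<Gamma>. wfs D" "wfs (isubst (inst [t]) A)"
    using il_prov_wf[OF wf_source il_allL.hyps(1)] by auto
  let ?S = "set (IAll A # \<Gamma>)"
  have "der ?S (IImp (IAll A) (isubst (inst [t]) A))"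
    using il_allL.hyps wf by (intro der_real realized_allE) auto
  moreover have "der ?S (IAll A)" using il_allL.hyps by (intro der_hyp) auto
  ultimately have t: "der ?S (isubst (inst [t]) A)" by (rule der_mp)
  from il_allL.IH show ?case
    by (rule der_cuts) (use t wf in \<open>auto intro: der_hyp\<close>)
next
  case (il_allR \<Gamma> A)
  then show ?case using il_prov_wf[OF wf_source il_allR.hyps] by (intro der_allI) auto
next
  case (il_exL A \<Gamma> B)
  then show ?case using il_prov_wf[OF wf_source il_exL.hyps] der_exE[of A \<Gamma> B] by simp
next
  case (il_exR \<Gamma> t A)
  have "der (set \<Gamma>) (IImp (isubst (inst [t]) A) (IEx A))"
    using il_exR.hyps il_prov_wf[OF wf_source il_exR.hyps(1)]
    by (intro der_real realized_exI) auto
  then show ?case using il_exR.IH by (rule der_mp)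
qed

lemma il_prov_witnessable:
  assumes "\<forall>(\<Gamma>, A) \<in> axs Is. witnessable It Q \<Gamma> A" and "il_prov Is \<Gamma> A"
  shows "witnessable It Q \<Gamma> A"
proof -
  have wf: "\<forall>B\<in>set \<Gamma>. wfs B" "wfs A" using il_prov_wf[OF wf_source assms(2)] by auto
  have "der (set \<Gamma> \<union> {}) A" using il_prov_der[OF assms] by simp
  from der_impsI[OF this wf(1)] have "realized (imps \<Gamma> A)" by (rule der_realized)
  then show ?thesis using real_seq_imps[OF wf] real_seq_witnessable[OF wf] by blast
qed

end

theorem theorem3p9:
  fixes Is It :: "('f, 'p) il_theory" and Q :: "('f, 'p) il_params"
  assumes "il_wf_theory Is" and "il_wf_theory It"
    and "il_params_in Is It Q"
    and "A1 (star_theory It)"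
    and "A2 (star_theory Is) (star_theory It) (bullet Q)"
    and "A3 (star_theory Is) (star_theory It) (bullet Q)"
    and "A4 (star_theory Is) (star_theory It) (bullet Q)"
    and "A5 (star_theory It) (bullet Q)
           (interp_fms (star_theory Is) (star_theory It) (bullet Q))"
    and "W_inhabited It Q"
    and "\<forall>(\<Gamma>, A) \<in> axs Is. witnessable It Q \<Gamma> A"
  shows "\<forall>\<Gamma> A. il_prov Is \<Gamma> A \<longrightarrow> witnessable It Q \<Gamma> A"
proof -
  interpret source_target It Is Q
    by unfold_locales (use assms in auto)
  show ?thesis using il_prov_witnessable[OF assms(10)] by blast
qed

end
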